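(* Assume that A1, A2 and A3 hold, and let $f(\theta)=\mathcal{T}_c(\rho(\cdot,\theta),\rho^* )$ for $\theta\in\Theta$. Then $f$ is locally Lipschitz continuous on $\Theta$, and for a.e. $\theta_0\in\Theta$ the function $f$ is Gâteaux differentiable at $\theta_0$ with $$\nabla f(\theta_0)=\int_\Omega\phi(x)\nabla_\theta\rho(x,\theta_0)\,dx\qquad(\star)$$ for an arbitrary pair of Kantorovich potentials $(\phi,\psi)\in\Phi_c(\rho(\cdot,\theta_0),\rho^* )$. If additionally A4 holds, then $f$ is locally semiconvex, and $f$ is Gâteaux differentiable with $(\star)$ at every $\theta_0\in\Theta$ outside a set of Hausdorff dimension at most $m-1$.
   Context: Setting: $\Omega\subset\mathbb{R}^d$ is compact, $\mathscr{P}(\Omega)$ is the set of Borel probability measures on $\Omega$, and $\rho^*\in\mathscr{P}(\Omega)$ is arbitrary. Assumptions. A1: $\Theta\subset\mathbb{R}^m$ is open, and $\{\rho(\cdot,\theta)\}_{\theta\in\Theta}\subset\mathscr{P}(\Omega)$ is a family of absolutely continuous (w.r.t. Lebesgue measure) probability measures; the same symbol denotes the measure and its density. A2: for a.e. $x\in\Omega$ the map $\theta\mapsto\rho(x,\theta)$ is differentiable, and $|\nabla_\theta\rho(x,\theta)|\le\eta(x)$ for all $\theta\in\Theta$, for some $\eta\in L^1(\Omega)$. A3: $c:\Omega^2\to\mathbb{R}$ is continuous and nonnegative. A4: for a.e. $x\in\Omega$ the map $\theta\mapsto\rho(x,\theta)$ is locally semiconvex, and $\nabla^2_\theta\rho(x,\theta)\ge-h(x)$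 for $\theta\in\Theta$, for some $h\in L^1(\Omega)$; the Hessian bound means that $\theta\mapsto\rho(x,\theta)+\frac{h(x)|\theta|^2}{2}$ is locally convex on $\Theta$ (convex on every ball contained in $\Theta$). A function $g$ on $\Theta$ is locally semiconvex if every point of $\Theta$ has a ball around it in $\Theta$ on which $g(\theta)+\frac{C}{2}|\theta|^2$ is convex for some constant $C$. Optimal transport cost: for $\mu,\nu\in\mathscr{P}(\Omega)$, $\mathcal{T}_c(\mu,\nu)=\inf_\pi\int_{\Omega\times\Omega}c\,d\pi$ over all $\pi\in\mathscr{P}(\Omega\times\Omega)$ with marginals $\mu$ and $\nu$. $\Phi_c(\mu,\nu)\subset C(\Omega)\times C(\Omega)$ is the set of pairs $(\phi,\psi)$ with $\phi(x)+\psi(y)\le c(x,y)$ for all $(x,y)\in\Omega^2$. Kantorovich duality states $\mathcal{T}_c(\mu,\nu)=\sup_{(\phi,\psi)\in\Phi_c(\mu,\nu)}\int\phi\,d\mu+\int\psi\,d\nu$; maximizing pairs are called Kantorovich potentials. Differentiability: $f$ is Gâteaux differentiable at $\theta_0$ if $f'(\theta_0,\Delta\theta)=\lim_{t\to0+}\frac{f(\theta_0+t\Delta\theta)-f(\theta_0)}{t}$ exists for all $\Delta\theta\in\mathbb{R}^m$ and is linear in $\Delta\theta$; $\nabla f(\theta_0)$ denotes the vector generating this linear map. *)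

theory Defs
  imports "HOL-Probability.Probability"
begin

section \<open>Optimal transport\<close>

definition prob_measures_on :: "'a::topological_space set \<Rightarrow> 'a measure set" where
  "prob_measures_on S = {M. prob_space M \<and> sets M = sets (restrict_space borel S)}"

text \<open>For each set \<open>A\<close> in \<open>sets \<mu>\<close>, \<open>\<mu> A\<close> is the integral of \<open>g\<close> over \<open>A\<close>. The density is only
  required to be Lebesgue measurable, whereas \<open>\<mu>\<close> is a Borel measure; hence this is not phrased
  with the library constant \<open>density\<close>. The sign condition is needed because \<open>ennreal\<close> truncates
  negative values to 0.\<close>

definition has_density_on :: "'a::euclidean_space set \<Rightarrow> 'a measure \<Rightarrow> ('a \<Rightarrow> real) \<Rightarrow> bool" where
  "has_density_on \<Omega> \<mu> g \<longleftrightarrow>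
     g \<in> borel_measurable (lebesgue_on \<Omega>) \<and>
     (AE x in lebesgue_on \<Omega>. 0 \<le> g x) \<and>
     (\<forall>A\<in>sets \<mu>. emeasure \<mu> A = (\<integral>\<^sup>+x\<in>A. ennreal (g x) \<partial>lebesgue_on \<Omega>))"

definition couplings ::
    "'a::topological_space set \<Rightarrow> 'a measure \<Rightarrow> 'a measure \<Rightarrow> ('a \<times> 'a) measure set" where
  "couplings \<Omega> \<mu> \<nu> = {\<pi> \<in> prob_measures_on (\<Omega> \<times> \<Omega>).
     distr \<pi> (restrict_space borel \<Omega>) fst = \<mu> \<and> distr \<pi> (restrict_space borel \<Omega>) snd = \<nu>}"

text \<open>A real infimum of Bochner integrals: it is meant for \<open>c\<close> continuous and nonnegative on
  \<open>\<Omega> \<times> \<Omega>\<close> with \<open>\<Omega>\<close> compact, where every integral exists and the infimum is over a nonempty set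
  bounded below by 0.\<close>

definition transport_cost ::
    "'a::topological_space set \<Rightarrow> ('a \<times> 'a \<Rightarrow> real) \<Rightarrow> 'a measure \<Rightarrow> 'a measure \<Rightarrow> real" where
  "transport_cost \<Omega> c \<mu> \<nu> = (INF \<pi>\<in>couplings \<Omega> \<mu> \<nu>. \<integral>z. c z \<partial>\<pi>)"

text \<open>Elements of \<open>C(\<Omega>)\<close> are represented by total functions; their values outside \<open>\<Omega>\<close> play no role.\<close>

definition dual_admissible ::
    "'a::topological_space set \<Rightarrow> ('a \<times> 'a \<Rightarrow> real) \<Rightarrow> (('a \<Rightarrow> real) \<times> ('a \<Rightarrow> real)) set" where
  "dual_admissible \<Omega> c = {(\<phi>, \<psi>). continuous_on \<Omega> \<phi> \<and> continuous_on \<Omega> \<psi> \<and>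
     (\<forall>x\<in>\<Omega>. \<forall>y\<in>\<Omega>. \<phi> x + \<psi> y \<le> c (x, y))}"

definition dual_value ::
    "'a measure \<Rightarrow> 'a measure \<Rightarrow> ('a \<Rightarrow> real) \<times> ('a \<Rightarrow> real) \<Rightarrow> real" where
  "dual_value \<mu> \<nu> p = (\<integral>x. fst p x \<partial>\<mu>) + (\<integral>y. snd p y \<partial>\<nu>)"

definition kantorovich_potentials ::
    "'a::topological_space set \<Rightarrow> ('a \<times> 'a \<Rightarrow> real) \<Rightarrow> 'a measure \<Rightarrow> 'a measure
      \<Rightarrow> (('a \<Rightarrow> real) \<times> ('a \<Rightarrow> real)) set" where
  "kantorovich_potentials \<Omega> c \<mu> \<nu> = {p \<in> dual_admissible \<Omega> c.
     \<forall>q\<in>dual_admissible \<Omega> c. dual_value \<mu> \<nu> q \<le> dual_value \<mu> \<nu> p}"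

section \<open>Differentiability and semiconvexity\<close>

definition gradient :: "('b::real_inner \<Rightarrow> real) \<Rightarrow> 'b \<Rightarrow> 'b" where
  "gradient g \<theta> = (THE D. GDERIV g \<theta> :> D)"

definition has_directional_derivative ::
    "('b::real_normed_vector \<Rightarrow> real) \<Rightarrow> 'b \<Rightarrow> 'b \<Rightarrow> real \<Rightarrow> bool" where
  "has_directional_derivative f \<theta> v l \<longleftrightarrow>
     ((\<lambda>t. (f (\<theta> + t *\<^sub>R v) - f \<theta>) / t) \<longlongrightarrow> l) (at_right 0)"

definition gateaux_differentiable :: "('b::real_normed_vector \<Rightarrow> real) \<Rightarrow> 'b \<Rightarrow> bool" where
  "gateaux_differentiable f \<theta> \<longleftrightarrow>
     (\<exists>f'. linear f' \<and> (\<forall>v. has_directional_derivative f \<theta> v (f' v)))"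

definition gateaux_gradient :: "('b::real_inner \<Rightarrow> real) \<Rightarrow> 'b \<Rightarrow> 'b" where
  "gateaux_gradient f \<theta> = (THE g. \<forall>v. has_directional_derivative f \<theta> v (g \<bullet> v))"

definition locally_lipschitz_on :: "'b::metric_space set \<Rightarrow> ('b \<Rightarrow> real) \<Rightarrow> bool" where
  "locally_lipschitz_on \<Theta> f \<longleftrightarrow>
     (\<forall>\<theta>\<in>\<Theta>. \<exists>r>0. \<exists>L. L-lipschitz_on (ball \<theta> r \<inter> \<Theta>) f)"

definition locally_convex_on :: "'b::real_normed_vector set \<Rightarrow> ('b \<Rightarrow> real) \<Rightarrow> bool" where
  "locally_convex_on \<Theta> g \<longleftrightarrow> (\<forall>\<theta> r. ball \<theta> r \<subseteq> \<Theta> \<longrightarrow> convex_on (ball \<theta> r) g)"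

definition locally_semiconvex_on :: "'b::real_normed_vector set \<Rightarrow> ('b \<Rightarrow> real) \<Rightarrow> bool" where
  "locally_semiconvex_on \<Theta> g \<longleftrightarrow>
     (\<forall>\<theta>\<in>\<Theta>. \<exists>r>0. \<exists>C. ball \<theta> r \<subseteq> \<Theta> \<and> convex_on (ball \<theta> r) (\<lambda>\<xi>. g \<xi> + C / 2 * (norm \<xi>)\<^sup>2))"

section \<open>Hausdorff dimension\<close>

text \<open>\<open>diam(U)\<^sup>s\<close> with the conventions that the empty set contributes 0 and that nonempty sets
  contribute 1 for \<open>s = 0\<close>. The latter needs a case distinction since \<open>0 powr 0 = 0\<close>.\<close>

definition hausdorff_gauge :: "real \<Rightarrow> 'b::metric_space set \<Rightarrow> ennreal" where
  "hausdorff_gauge s U = (if U = {} then 0 else if s = 0 then 1 else ennreal (diameter U powr s))"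

text \<open>Boundedness of the covering sets is required explicitly because \<open>diameter\<close> is a real supremum,
  which is meaningless for unbounded sets. Finite covers are included since the covering sets may
  be empty.\<close>

definition hausdorff_premeasure :: "real \<Rightarrow> real \<Rightarrow> 'b::metric_space set \<Rightarrow> ennreal" where
  "hausdorff_premeasure s \<delta> A =
     (INF U\<in>{U :: nat \<Rightarrow> 'b set. A \<subseteq> (\<Union>n. U n) \<and> (\<forall>n. bounded (U n) \<and> diameter (U n) \<le> \<delta>)}.
        \<Sum>n. hausdorff_gauge s (U n))"

definition hausdorff_measure :: "real \<Rightarrow> 'b::metric_space set \<Rightarrow> ennreal" where
  "hausdorff_measure s A = (SUP \<delta>\<in>{0<..}. hausdorff_premeasure s \<delta> A)"

definition hausdorff_dimension :: "'b::metric_space set \<Rightarrow> ereal" where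
  "hausdorff_dimension A = (INF s\<in>{s. 0 \<le> s \<and> hausdorff_measure s A = 0}. ereal s)"

end

theory Submission
  imports Defs "HOL-Complex_Analysis.Great_Picard"
begin

text \<open>
  For a fixed pair \<open>(\<phi>, \<psi>)\<close> of admissible functions the dual value
  \<open>\<theta> \<mapsto> \<integral>\<phi>(x) \<rho>(x, \<theta>) dx + \<integral>\<psi> d\<rho>*\<close> is differentiable with gradient
  \<open>\<integral>\<phi>(x) \<nabla>\<rho>(x, \<theta>) dx\<close>, by dominated convergence. Kantorovich duality makes \<open>f\<close> the maximum of
  these functions, and Danskin's principle for a maximum over a compact family gives one-sided
  derivatives of \<open>f\<close> at every \<open>\<theta>\<close> and in every direction \<open>v\<close>: the derivative is the largest
  \<open>p \<bullet> v\<close>, where \<open>p\<close> runs through the slopes \<open>\<integral>\<phi>(x) \<nabla>\<rho>(x, \<theta>) dx\<close> of the potentials that are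
  optimal at \<open>\<theta>\<close> (lemma \<open>danskin\<close>). Hence \<open>f\<close> is Gateaux differentiable, with the gradient formula,
  as soon as all optimal potentials have the same slope.

  The compact family consists of the functions \<open>\<phi>\<close> with \<open>0 \<le> \<phi> \<le> M\<close>, where \<open>M\<close> bounds the cost, whose
  modulus of continuity is that of the cost, each paired with its \<open>c\<close>-transform. Every admissible pair is dominated by such
  a pair (\<open>normalize_admissible_pair\<close>), and Arzela-Ascoli gives the compactness. Duality itself
  (\<open>kantorovich_approximate_duality\<close>) is obtained by discretization: \<open>\<Omega>\<close> is cut into
  small cells, the finite transport problem is solved approximately by maximizing a dual functional
  with exponential penalty, the finite plan is spread over the cells in proportion to the product of
  the marginals, and the finite potentials are extended by \<open>c\<close>-transforms.

  The set of \<open>\<theta>\<close> with several slopes is small for two different reasons. In general, two slopes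
  differ in some coordinate direction \<open>b\<close>, and then the right derivative of \<open>f\<close> along \<open>b\<close> exceeds the
  left one. A function of one real variable has at most countably many such kinks, so the
  exceptional set meets each line parallel to \<open>b\<close> in a countable set and is null by Tonelli's
  theorem (\<open>null_sets_convex_kinks\<close>). If the densities are semiconvex with an integrable bound \<open>h\<close>, then
  \<open>F = f + C |\<theta>|\<^sup>2 / 2\<close> is convex on balls, with \<open>C = M \<integral>|h|\<close>, because the potentials are
  nonnegative and integration against them preserves convexity. Distinct slopes are then distinct
  subgradients of \<open>F\<close>, up to the shift \<open>C \<theta>\<close>. The inverse of \<open>\<theta> \<mapsto> \<theta> + \<partial>F(\<theta>)\<close> is 1-Lipschitz, and
  a point with two subgradients is the image under this inverse of a point of one of countably many
  coordinate hyperplanes, so these points have dimension at most \<open>m - 1\<close>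
  (\<open>hausdorff_null_multiple_subgradients\<close>).
\<close>

section \<open>Finite transport duality by entropic regularization\<close>

text \<open>
  The dual of the transport problem with an entropy penalty of strength \<open>\<epsilon>\<close> on the plan: the
  constraint \<open>u i + v j \<le> C i j\<close> becomes an exponential penalty, so that a maximizer is characterized
  by vanishing partial derivatives.
\<close>
definition entropic_dual where
  "entropic_dual I J a b C \<epsilon> u v = (\<Sum>i\<in>I. a i * u i) + (\<Sum>j\<in>J. b j * v j)
     - \<epsilon> * (\<Sum>i\<in>I. \<Sum>j\<in>J. exp ((u i + v j - C i j) / \<epsilon>))"
  for C :: "'i \<Rightarrow> 'j \<Rightarrow> real" and \<epsilon> :: real

lemma entropic_dual_swap:
  "entropic_dual I J a b C \<epsilon> u v = entropic_dual J I b a (\<lambda>j i. C i j) \<epsilon> v u"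
  unfolding entropic_dual_def
  using sum.swap[of "\<lambda>i j. exp ((u i + v j - C i j) / \<epsilon>)" J I] by (simp add: add.commute)

text \<open>
  The partial derivative in \<open>u i\<close> vanishes at a maximum. This says that
  \<open>exp ((u i + v j - C i j) / \<epsilon>)\<close> has row sums \<open>a i\<close>, so a maximizer produces a transport plan.
\<close>
lemma entropic_dual_stationary:
  assumes I: "finite I" "i \<in> I" and \<epsilon>: "\<epsilon> > 0"
    and max: "\<And>u'. entropic_dual I J a b C \<epsilon> u' v \<le> entropic_dual I J a b C \<epsilon> u v"
  shows "(\<Sum>j\<in>J. exp ((u i + v j - C i j) / \<epsilon>)) = a i"
proof -
  define P where "P = (\<Sum>j\<in>J. exp ((u i + v j - C i j) / \<epsilon>))"
  define k where "k t = a i * t - \<epsilon> * (exp (t / \<epsilon>) - 1) * P" for t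
  have "k t \<le> k 0" for t
  proof -
    let ?u = "u(i := u i + t)"
    have 1: "(\<Sum>i\<in>I. a i * ?u i) = (\<Sum>i\<in>I. a i * u i) + a i * t"
      using I by (simp add: sum.remove[of I i] distrib_left)
    have "(\<Sum>j\<in>J. exp ((?u i + v j - C i j) / \<epsilon>)) = exp (t / \<epsilon>) * P"
      unfolding P_def sum_distrib_left
      by (intro sum.cong) (simp_all add: add_divide_distrib diff_divide_distrib flip: exp_add)
    then have 2: "(\<Sum>i\<in>I. \<Sum>j\<in>J. exp ((?u i + v j - C i j) / \<epsilon>)) =
        (\<Sum>i\<in>I. \<Sum>j\<in>J. exp ((u i + v j - C i j) / \<epsilon>)) + (exp (t / \<epsilon>) - 1) * P"
      using I by (simp add: sum.remove[of I i] P_def algebra_simps)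
    have "entropic_dual I J a b C \<epsilon> ?u v = entropic_dual I J a b C \<epsilon> u v + k t"
      unfolding entropic_dual_def k_def 1 2 by (simp add: algebra_simps)
    then show ?thesis using max[of ?u] by (simp add: k_def)
  qed
  moreover have "(k has_real_derivative a i - \<epsilon> * (exp (0 / \<epsilon>) * (1 / \<epsilon>)) * P) (at 0)"
    unfolding k_def by (auto intro!: derivative_eq_intros)
  ultimately have "a i - \<epsilon> * (exp (0 / \<epsilon>) * (1 / \<epsilon>)) * P = 0"
    by - (rule DERIV_local_max[where f = k and x = 0 and d = 1], assumption, simp, simp)
  then show ?thesis using \<epsilon> by (simp add: P_def)
qed

text \<open>
  The coercivity behind the existence of maximizers. For \<open>t \<ge> 0\<close> it follows from
  \<open>exp t \<ge> t\<^sup>2 / 2\<close> and \<open>(t - 2 p)\<^sup>2 \<ge> 0\<close>; for \<open>t < 0\<close> the linear term already decays.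
\<close>
lemma linear_minus_exp_le:
  fixes p t :: real
  assumes "p > 0"
  shows "p * t - exp t \<le> 2 * p\<^sup>2 - p * \<bar>t\<bar>"
proof (cases "t \<ge> 0")
  case True
  then have "1 + t + t\<^sup>2 / 2 \<le> exp t" by (rule exp_lower_Taylor_quadratic)
  moreover have "(t - 2 * p)\<^sup>2 \<ge> 0" by simp
  ultimately show ?thesis using True by (simp add: power2_eq_square algebra_simps)
next
  case False
  then have "p * t = - p * \<bar>t\<bar>" by simp
  moreover have "0 \<le> 2 * p\<^sup>2" "0 \<le> exp t" by simp_all
  ultimately show ?thesis by linarith
qed

lemma compact_coordinate_box: "compact {u :: 'i \<Rightarrow> real. \<forall>i. \<bar>u i\<bar> \<le> R}"
proof -
  have "compactin (product_topology (\<lambda>_::'i. euclidean) UNIV) (PiE UNIV (\<lambda>_. {-R..R}))"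
    unfolding compactin_PiE by simp
  moreover have "PiE UNIV (\<lambda>_. {-R..R}) = {u :: 'i \<Rightarrow> real. \<forall>i. \<bar>u i\<bar> \<le> R}"
    by (simp add: PiE_def Pi_def abs_le_iff minus_le_iff[of R] conj_commute)
  ultimately show ?thesis by (simp add: euclidean_product_topology)
qed

text \<open>
  Since both marginals have mass 1, the functional is a sum of one-variable functions of the numbers
  \<open>u i + v j\<close>, each tending to \<open>-\<infinity>\<close> in both directions because all masses are positive. A bound
  from below on the functional therefore bounds all \<open>u i + v j\<close>. The remaining freedom is the shift
  \<open>(u + t, v - t)\<close>, which leaves the functional unchanged and is used to make one coordinate zero;
  what is left is a compact box.
\<close>
lemma entropic_dual_attains_max:
  fixes a :: "'i \<Rightarrow> real" and b :: "'j \<Rightarrow> real"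
  assumes fin: "finite I" "finite J" and pos: "\<And>i. i \<in> I \<Longrightarrow> a i > 0" "\<And>j. j \<in> J \<Longrightarrow> b j > 0"
    and mass: "sum a I = 1" "sum b J = 1" and \<epsilon>: "\<epsilon> > 0"
  obtains u v where "\<And>u' v'. entropic_dual I J a b C \<epsilon> u' v' \<le> entropic_dual I J a b C \<epsilon> u v"
proof -
  let ?D = "entropic_dual I J a b C \<epsilon>"
  define F where "F i j s = a i * b j * s - \<epsilon> * exp ((s - C i j) / \<epsilon>)" for i j s
  define U where "U i j = a i * b j * C i j + 2 * \<epsilon> * (a i * b j)\<^sup>2" for i j
  have D_eq: "?D u v = (\<Sum>i\<in>I. \<Sum>j\<in>J. F i j (u i + v j))" for u v
  proof -
    have "(\<Sum>i\<in>I. \<Sum>j\<in>J. a i * b j * (u i + v j)) =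
        (\<Sum>i\<in>I. a i * u i * sum b J) + (\<Sum>i\<in>I. a i * (\<Sum>j\<in>J. b j * v j))"
      by (simp add: sum_distrib_left sum.distrib[symmetric] distrib_left mult_ac)
    also have "\<dots> = (\<Sum>i\<in>I. a i * u i) + (\<Sum>j\<in>J. b j * v j)"
      using mass by (simp flip: sum_distrib_right)
    finally show ?thesis
      by (simp add: entropic_dual_def F_def sum_subtractf sum_distrib_left)
  qed
  have F_le: "F i j s \<le> U i j - a i * b j * \<bar>s - C i j\<bar>" if "i \<in> I" "j \<in> J" for i j s
  proof -
    define t where "t = (s - C i j) / \<epsilon>"
    have "a i * b j > 0" using pos that by simp
    from mult_left_mono[OF linear_minus_exp_le[OF this, of t], of \<epsilon>]
    have "\<epsilon> * (a i * b j * t - exp t) \<le> \<epsilon> * (2 * (a i * b j)\<^sup>2 - a i * b j * \<bar>t\<bar>)"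
      using \<epsilon> by simp
    moreover have "\<epsilon> * t = s - C i j" "\<epsilon> * \<bar>t\<bar> = \<bar>s - C i j\<bar>"
      using \<epsilon> by (simp_all add: t_def abs_divide)
    moreover have "\<epsilon> * (a i * b j * t - exp t) = a i * b j * (\<epsilon> * t) - \<epsilon> * exp t"
      "\<epsilon> * (2 * (a i * b j)\<^sup>2 - a i * b j * \<bar>t\<bar>) = 2 * \<epsilon> * (a i * b j)\<^sup>2 - a i * b j * (\<epsilon> * \<bar>t\<bar>)"
      by (simp_all add: right_diff_distrib mult.left_commute mult.assoc)
    ultimately have "a i * b j * (s - C i j) - \<epsilon> * exp t \<le> 2 * \<epsilon> * (a i * b j)\<^sup>2 - a i * b j * \<bar>s - C i j\<bar>"
      by simp
    then show ?thesis by (simp add: F_def U_def t_def algebra_simps)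
  qed
  \<comment> \<open>only arguments whose value is at least the value at 0 compete for the maximum\<close>
  define B where "B = (\<Sum>i\<in>I. \<Sum>j\<in>J. U i j) - ?D (\<lambda>_. 0) (\<lambda>_. 0)"
  define R where "R = (\<Sum>i\<in>I. \<Sum>j\<in>J. \<bar>C i j\<bar> + \<bar>B\<bar> / (a i * b j))"
  have s_le: "\<bar>u i + v j\<bar> \<le> R"
    if level: "?D (\<lambda>_. 0) (\<lambda>_. 0) \<le> ?D u v" and ij: "i \<in> I" "j \<in> J" for u v i j
  proof -
    define G where "G z = U (fst z) (snd z) - F (fst z) (snd z) (u (fst z) + v (snd z))" for z
    have G: "a i * b j * \<bar>u i + v j - C i j\<bar> \<le> G (i, j)" if "i \<in> I" "j \<in> J" for i j
      using F_le[OF that, of "u i + v j"] by (simp add: G_def)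
    have "0 \<le> a i * b j * \<bar>u i + v j - C i j\<bar>" if "i \<in> I" "j \<in> J" for i j
      using pos[THEN less_imp_le] that by simp
    then have "G z \<ge> 0" if "z \<in> I \<times> J" for z
      using G that by (cases z) (fastforce intro: order_trans)
    then have "G (i, j) \<le> sum G (I \<times> J)"
      using fin ij by (intro member_le_sum) auto
    also have "sum G (I \<times> J) = (\<Sum>i\<in>I. \<Sum>j\<in>J. U i j) - ?D u v"
      unfolding D_eq G_def by (simp add: sum.cartesian_product' sum_subtractf)
    also have "\<dots> \<le> \<bar>B\<bar>" using level by (simp add: B_def)
    finally have "a i * b j * \<bar>u i + v j - C i j\<bar> \<le> \<bar>B\<bar>" using G[OF ij] by simp
    then have "\<bar>u i + v j - C i j\<bar> \<le> \<bar>B\<bar> / (a i * b j)"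
      using pos ij by (simp add: pos_le_divide_eq mult.commute)
    then have "\<bar>u i + v j\<bar> \<le> \<bar>C i j\<bar> + \<bar>B\<bar> / (a i * b j)" by linarith
    also have "\<dots> \<le> (\<Sum>j\<in>J. \<bar>C i j\<bar> + \<bar>B\<bar> / (a i * b j))"
      using fin ij pos[THEN less_imp_le] by (intro member_le_sum) auto
    also have "\<dots> \<le> R"
      unfolding R_def using fin ij pos[THEN less_imp_le]
      by (intro member_le_sum[of i I "\<lambda>i. \<Sum>j\<in>J. \<bar>C i j\<bar> + \<bar>B\<bar> / (a i * b j)"] sum_nonneg) auto
    finally show ?thesis .
  qed
  have "I \<noteq> {}" "J \<noteq> {}" using mass by auto
  then obtain i0 j0 where i0: "i0 \<in> I" and j0: "j0 \<in> J" by blast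
  have "0 \<le> R" unfolding R_def using pos[THEN less_imp_le] by (intro sum_nonneg) auto
  define K where "K = {u :: 'i \<Rightarrow> real. \<forall>i. \<bar>u i\<bar> \<le> 2 * R} \<times> {v :: 'j \<Rightarrow> real. \<forall>j. \<bar>v j\<bar> \<le> 2 * R}"
  have zero: "(\<lambda>_. 0, \<lambda>_. 0) \<in> K" using \<open>0 \<le> R\<close> by (simp add: K_def)
  have coord: "continuous_on K (\<lambda>w. fst w i)" "continuous_on K (\<lambda>w. snd w j)" for i j
    by (rule continuous_on_compose2[OF continuous_on_product_coordinates];
        auto intro: continuous_intros)+
  have "continuous_on K (\<lambda>w. ?D (fst w) (snd w))"
    unfolding entropic_dual_def using \<epsilon> by (intro continuous_intros coord) auto
  moreover have "compact K" unfolding K_def by (intro compact_Times compact_coordinate_box)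
  ultimately obtain w where w: "w \<in> K" "\<And>w'. w' \<in> K \<Longrightarrow> ?D (fst w') (snd w') \<le> ?D (fst w) (snd w)"
    using continuous_attains_sup[of K "\<lambda>w. ?D (fst w) (snd w)"] zero by blast
  have "?D u' v' \<le> ?D (fst w) (snd w)" for u' v'
  proof (cases "?D (\<lambda>_. 0) (\<lambda>_. 0) \<le> ?D u' v'")
    case False
    then show ?thesis using w(2)[OF zero] by simp
  next
    case True
    define u where "u i = (if i \<in> I then u' i - u' i0 else 0)" for i
    define v where "v j = (if j \<in> J then v' j + u' i0 else 0)" for j
    have eq: "?D u' v' = ?D u v"
      unfolding D_eq by (intro sum.cong) (auto simp: u_def v_def)
    have "\<bar>v j\<bar> \<le> R" for j
      using s_le[OF True i0, of j] \<open>0 \<le> R\<close> by (auto simp: v_def add.commute)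
    moreover have "\<bar>u i\<bar> \<le> 2 * R" for i
      using s_le[OF True _ j0, of i] s_le[OF True i0 j0] \<open>0 \<le> R\<close>
      by (auto simp: u_def)
    ultimately have "(u, v) \<in> K" using \<open>0 \<le> R\<close> by (auto simp: K_def intro: order_trans[where y = R])
    from w(2)[OF this] show ?thesis unfolding eq by simp
  qed
  then show thesis by (rule that)
qed

text \<open>
  The Gibbs plan \<open>\<pi> i j = exp ((u i + v j - C i j) / \<epsilon>)\<close> of a maximizer of the entropic dual is a
  coupling. Its entries are at most 1, which is exactly admissibility of \<open>(u, v)\<close>, and its cost exceeds
  the dual value by \<open>\<epsilon>\<close> times its entropy, where each entry has entropy at most 1.
\<close>
lemma finite_transport_duality:
  fixes a :: "'i \<Rightarrow> real" and b :: "'j \<Rightarrow> real"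
  assumes fin: "finite I" "finite J" and pos: "\<And>i. i \<in> I \<Longrightarrow> a i > 0" "\<And>j. j \<in> J \<Longrightarrow> b j > 0"
    and mass: "sum a I = 1" "sum b J = 1" and \<delta>: "\<delta> > 0"
  obtains \<pi> :: "'i \<Rightarrow> 'j \<Rightarrow> real" and u v where
    "\<And>i j. \<pi> i j \<ge> 0"
    "\<And>i. i \<in> I \<Longrightarrow> (\<Sum>j\<in>J. \<pi> i j) = a i" "\<And>j. j \<in> J \<Longrightarrow> (\<Sum>i\<in>I. \<pi> i j) = b j"
    "\<And>i j. i \<in> I \<Longrightarrow> j \<in> J \<Longrightarrow> u i + v j \<le> C i j"
    "(\<Sum>i\<in>I. \<Sum>j\<in>J. \<pi> i j * C i j) \<le> (\<Sum>i\<in>I. a i * u i) + (\<Sum>j\<in>J. b j * v j) + \<delta>"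
proof -
  have "I \<noteq> {}" "J \<noteq> {}" using mass by auto
  then have card: "real (card I) * real (card J) > 0" using fin by (simp add: card_gt_0_iff)
  \<comment> \<open>there are \<open>card I * card J\<close> entries, each contributing at most \<open>\<epsilon>\<close> to the gap\<close>
  define \<epsilon> where "\<epsilon> = \<delta> / (real (card I) * real (card J))"
  have \<epsilon>: "\<epsilon> > 0" using \<delta> card by (simp add: \<epsilon>_def)
  obtain u v where max: "\<And>u' v'. entropic_dual I J a b C \<epsilon> u' v' \<le> entropic_dual I J a b C \<epsilon> u v"
    using entropic_dual_attains_max[OF fin pos mass \<epsilon>, where C = C] by blast
  define \<pi> where "\<pi> i j = exp ((u i + v j - C i j) / \<epsilon>)" for i j
  have row: "(\<Sum>j\<in>J. \<pi> i j) = a i" if "i \<in> I" for i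
    unfolding \<pi>_def using fin that \<epsilon> max by (intro entropic_dual_stationary) auto
  have col: "(\<Sum>i\<in>I. \<pi> i j) = b j" if "j \<in> J" for j
    using entropic_dual_stationary[OF fin(2) that \<epsilon>, where J = I and C = "\<lambda>j i. C i j" and a = b and b = a and u = v and v = u]
      max unfolding \<pi>_def entropic_dual_swap[symmetric, of J] by (simp add: add.commute)
  have nonneg: "\<pi> i j \<ge> 0" for i j by (simp add: \<pi>_def)
  have adm: "u i + v j \<le> C i j" if "i \<in> I" "j \<in> J" for i j
  proof -
    have "\<pi> i j \<le> (\<Sum>j\<in>J. \<pi> i j)" using fin that nonneg by (intro member_le_sum) auto
    also have "\<dots> = a i" using row that by simp
    also have "\<dots> \<le> sum a I" using fin that pos[THEN less_imp_le] by (intro member_le_sum) auto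
    finally have "(u i + v j - C i j) / \<epsilon> \<le> 0" using mass by (simp add: \<pi>_def)
    then show ?thesis using \<epsilon> by (simp add: divide_le_0_iff)
  qed
  have entropy: "\<pi> i j * C i j \<le> \<pi> i j * (u i + v j) + \<epsilon>" for i j
  proof -
    define t where "t = (u i + v j - C i j) / \<epsilon>"
    \<comment> \<open>the entropy \<open>- \<pi> ln \<pi>\<close> of one entry, with \<open>t = ln \<pi>\<close>\<close>
    have "- t * exp t \<le> 1"
    proof -
      have "1 + (- t) \<le> exp (- t)" by (rule exp_ge_add_one_self)
      then have "(- t) * exp t \<le> exp (- t) * exp t" by (intro mult_right_mono) auto
      then show ?thesis by (simp flip: exp_add)
    qed
    then have "\<epsilon> * (- t * exp t) \<le> \<epsilon> * 1" using \<epsilon> by (intro mult_left_mono) auto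
    moreover have "\<epsilon> * t = u i + v j - C i j" using \<epsilon> by (simp add: t_def)
    then have "\<epsilon> * (- t * exp t) = (C i j - (u i + v j)) * exp t"
      by (metis minus_diff_eq mult.assoc mult_minus_left mult_minus_right)
    ultimately show ?thesis by (simp add: \<pi>_def t_def algebra_simps)
  qed
  have "(\<Sum>i\<in>I. \<Sum>j\<in>J. \<pi> i j * C i j) \<le> (\<Sum>i\<in>I. \<Sum>j\<in>J. \<pi> i j * (u i + v j) + \<epsilon>)"
    by (intro sum_mono entropy)
  also have "\<dots> = (\<Sum>i\<in>I. (\<Sum>j\<in>J. \<pi> i j) * u i) + (\<Sum>i\<in>I. \<Sum>j\<in>J. \<pi> i j * v j) + real (card I) * real (card J) * \<epsilon>"
    by (simp add: sum.distrib distrib_left sum_distrib_right)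
  also have "(\<Sum>i\<in>I. \<Sum>j\<in>J. \<pi> i j * v j) = (\<Sum>j\<in>J. (\<Sum>i\<in>I. \<pi> i j) * v j)"
    by (subst sum.swap) (simp add: sum_distrib_right)
  also have "real (card I) * real (card J) * \<epsilon> = \<delta>"
    using card unfolding \<epsilon>_def times_divide_eq_right by (intro nonzero_mult_div_cancel_left) linarith
  finally have "(\<Sum>i\<in>I. \<Sum>j\<in>J. \<pi> i j * C i j) \<le> (\<Sum>i\<in>I. a i * u i) + (\<Sum>j\<in>J. b j * v j) + \<delta>"
    using row col by simp
  from that[OF nonneg row col adm this] show thesis .
qed

section \<open>Kantorovich duality up to an arbitrary error\<close>

lemma prob_measures_onD:
  assumes "M \<in> prob_measures_on S"
  shows "prob_space M" "sets M = sets (restrict_space borel S)" "space M = S"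
  using assms sets_eq_imp_space_eq[of M "restrict_space borel S"]
  by (auto simp: prob_measures_on_def space_restrict_space)

lemma continuous_on_integrable_prob_measures_on:
  fixes g :: "'a::topological_space \<Rightarrow> real"
  assumes M: "M \<in> prob_measures_on S" and S: "compact S" and g: "continuous_on S g"
  shows "integrable M g"
proof -
  interpret prob_space M using M by (rule prob_measures_onD)
  have "g \<in> borel_measurable (restrict_space borel S)"
    using g by (rule borel_measurable_continuous_on_restrict)
  then have "g \<in> borel_measurable M"
    using measurable_cong_sets[OF prob_measures_onD(2)[OF M] refl] by blast
  moreover obtain B where "\<And>x. x \<in> S \<Longrightarrow> \<bar>g x\<bar> \<le> B"
    using compact_imp_bounded[OF compact_continuous_image[OF g S]] by (auto simp: bounded_iff)
  ultimately show ?thesis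
    by (intro integrable_const_bound[of _ B]) (auto simp: prob_measures_onD(3)[OF M])
qed

lemma integral_marginals:
  fixes g :: "'a::euclidean_space \<Rightarrow> real"
  assumes \<pi>: "\<pi> \<in> couplings S \<mu> \<nu>" and g: "g \<in> borel_measurable (restrict_space borel S)"
  shows "(\<integral>x. g x \<partial>\<mu>) = (\<integral>z. g (fst z) \<partial>\<pi>)" "(\<integral>y. g y \<partial>\<nu>) = (\<integral>z. g (snd z) \<partial>\<pi>)"
proof -
  have \<pi>': "\<pi> \<in> prob_measures_on (S \<times> S)"
    and marg: "\<mu> = distr \<pi> (restrict_space borel S) fst" "\<nu> = distr \<pi> (restrict_space borel S) snd"
    using \<pi> by (auto simp: couplings_def)
  have "fst \<in> measurable (restrict_space borel (S \<times> S)) (restrict_space borel S)"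
    "snd \<in> measurable (restrict_space borel (S \<times> S)) (restrict_space borel S)"
    by (auto intro!: measurable_restrict_space3 borel_measurable_continuous_onI continuous_intros)
  then have "fst \<in> measurable \<pi> (restrict_space borel S)" "snd \<in> measurable \<pi> (restrict_space borel S)"
    using measurable_cong_sets[OF prob_measures_onD(2)[OF \<pi>'] refl] by blast+
  then show "(\<integral>x. g x \<partial>\<mu>) = (\<integral>z. g (fst z) \<partial>\<pi>)" "(\<integral>y. g y \<partial>\<nu>) = (\<integral>z. g (snd z) \<partial>\<pi>)"
    unfolding marg using g by (auto simp: integral_distr)
qed

text \<open>
  Weak duality: integrate \<open>\<phi> x + \<psi> y \<le> c (x, y)\<close> against the coupling.
\<close>
lemma dual_value_le_coupling:
  fixes S :: "'a::euclidean_space set"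
  assumes S: "compact S" and c: "continuous_on (S \<times> S) c"
    and \<pi>: "\<pi> \<in> couplings S \<mu> \<nu>" and p: "p \<in> dual_admissible S c"
  shows "dual_value \<mu> \<nu> p \<le> (\<integral>z. c z \<partial>\<pi>)"
proof -
  obtain \<phi> \<psi> where p_eq: "p = (\<phi>, \<psi>)" by (cases p)
  have cont: "continuous_on S \<phi>" "continuous_on S \<psi>"
    and le: "\<And>x y. x \<in> S \<Longrightarrow> y \<in> S \<Longrightarrow> \<phi> x + \<psi> y \<le> c (x, y)"
    using p by (auto simp: p_eq dual_admissible_def)
  have \<pi>': "\<pi> \<in> prob_measures_on (S \<times> S)" using \<pi> by (auto simp: couplings_def)
  have int: "integrable \<pi> (\<lambda>z. \<phi> (fst z))" "integrable \<pi> (\<lambda>z. \<psi> (snd z))" "integrable \<pi> c"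
    by (auto intro!: continuous_on_integrable_prob_measures_on[OF \<pi>'] compact_Times S c
        continuous_on_compose2[OF cont(1)] continuous_on_compose2[OF cont(2)] continuous_intros)
  have "dual_value \<mu> \<nu> p = (\<integral>z. \<phi> (fst z) \<partial>\<pi>) + (\<integral>z. \<psi> (snd z) \<partial>\<pi>)"
    unfolding dual_value_def p_eq
    using cont by (simp add: integral_marginals[OF \<pi>] borel_measurable_continuous_on_restrict)
  also have "\<dots> = (\<integral>z. \<phi> (fst z) + \<psi> (snd z) \<partial>\<pi>)" using int by simp
  also have "\<dots> \<le> (\<integral>z. c z \<partial>\<pi>)"
    using int le by (intro integral_mono) (auto simp: prob_measures_onD(3)[OF \<pi>'])
  finally show ?thesis .
qed

text \<open>
  The \<open>c\<close>-transform, with an arbitrary index set in place of the first factor: it is used with the cells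
  of a partition as indices, and with the points of \<open>S\<close> in either order of the two variables.
\<close>
definition c_transform :: "'i set \<Rightarrow> ('i \<Rightarrow> 'y \<Rightarrow> real) \<Rightarrow> ('i \<Rightarrow> real) \<Rightarrow> 'y \<Rightarrow> real" where
  "c_transform I k \<phi> y = (INF i\<in>I. k i y - \<phi> i)"

lemma c_transform_le:
  assumes "\<And>i. i \<in> I \<Longrightarrow> m \<le> k i y - \<phi> i" and "i \<in> I"
  shows "c_transform I k \<phi> y \<le> k i y - \<phi> i"
  unfolding c_transform_def using assms by (intro cINF_lower bdd_belowI2) auto

lemma c_transform_ge:
  assumes "\<And>i. i \<in> I \<Longrightarrow> m \<le> k i y - \<phi> i" and "I \<noteq> {}"
  shows "m \<le> c_transform I k \<phi> y"
  unfolding c_transform_def using assms by (intro cINF_greatest) auto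

text \<open>
  An infimum is 1-Lipschitz in the sup norm of the family. This yields at once the modulus of
  continuity of a \<open>c\<close>-transform (vary \<open>y\<close>) and its dependence on the potential (vary \<open>\<phi>\<close>).
\<close>
lemma c_transform_diff_le:
  assumes bdd: "\<And>i. i \<in> I \<Longrightarrow> m \<le> k i y - \<phi> i" and "I \<noteq> {}"
    and close: "\<And>i. i \<in> I \<Longrightarrow> (k i y - \<phi> i) - (k' i y' - \<phi>' i) \<le> e"
  shows "c_transform I k \<phi> y - c_transform I k' \<phi>' y' \<le> e"
proof -
  have "c_transform I k \<phi> y - e \<le> c_transform I k' \<phi>' y'"
  proof (rule c_transform_ge)
    fix i assume i: "i \<in> I"
    show "c_transform I k \<phi> y - e \<le> k' i y' - \<phi>' i"
      using c_transform_le[of I m k y \<phi> i] bdd i close[OF i] by force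
  qed fact
  then show ?thesis by simp
qed

lemma c_transform_continuous_on:
  fixes S :: "'a::metric_space set"
  assumes bdd: "\<And>i y. i \<in> I \<Longrightarrow> y \<in> S \<Longrightarrow> m \<le> k i y - \<phi> i" and "I \<noteq> {}"
    and equi: "\<And>e. e > 0 \<Longrightarrow> \<exists>d>0. \<forall>i\<in>I. \<forall>y\<in>S. \<forall>y'\<in>S. dist y y' < d \<longrightarrow> \<bar>k i y - k i y'\<bar> \<le> e"
  shows "continuous_on S (c_transform I k \<phi>)"
  unfolding continuous_on_iff
proof (intro ballI allI impI)
  fix y and e :: real assume y: "y \<in> S" and "e > 0"
  then have "e / 2 > 0" by simp
  from equi[OF this] obtain d where d: "d > 0"
    "\<And>i y y'. i \<in> I \<Longrightarrow> y \<in> S \<Longrightarrow> y' \<in> S \<Longrightarrow> dist y y' < d \<Longrightarrow> \<bar>k i y - k i y'\<bar> \<le> e / 2"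
    by blast
  have *: "c_transform I k \<phi> y - c_transform I k \<phi> y' \<le> e / 2" if "y \<in> S" "y' \<in> S" "dist y y' < d" for y y'
  proof (rule c_transform_diff_le)
    fix i assume "i \<in> I"
    from d(2)[OF this that] show "(k i y - \<phi> i) - (k i y' - \<phi> i) \<le> e / 2" by linarith
  qed (use bdd that \<open>I \<noteq> {}\<close> in auto)
  have "dist (c_transform I k \<phi> y') (c_transform I k \<phi> y) < e" if "y' \<in> S" "dist y' y < d" for y'
    using *[of y y'] *[of y' y] that y \<open>e > 0\<close> by (auto simp: dist_real_def dist_commute)
  then show "\<exists>d>0. \<forall>y'\<in>S. dist y' y < d \<longrightarrow> dist (c_transform I k \<phi> y') (c_transform I k \<phi> y) < e"
    using d(1) by blast
qed

lemma integral_finite_range: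
  fixes W :: "'t \<Rightarrow> real"
  assumes "prob_space M" and T: "finite T" "\<And>x. x \<in> space M \<Longrightarrow> K x \<in> T"
    and meas: "\<And>t. t \<in> T \<Longrightarrow> {x\<in>space M. K x = t} \<in> sets M"
  shows "integrable M (\<lambda>x. W (K x))"
    "(\<integral>x. W (K x) \<partial>M) = (\<Sum>t\<in>T. W t * measure M {x\<in>space M. K x = t})"
proof -
  interpret prob_space M by fact
  have eq: "W (K x) = (\<Sum>t\<in>T. W t * indicator {x\<in>space M. K x = t} x)" if "x \<in> space M" for x
  proof -
    have "(\<Sum>t\<in>T. W t * indicator {x\<in>space M. K x = t} x) = (\<Sum>t\<in>T. if t = K x then W t else 0)"
      using that by (intro sum.cong) (auto simp: indicator_def)
    then show ?thesis using T that by simp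
  qed
  have int: "integrable M (\<lambda>x. W t * indicator {x\<in>space M. K x = t} x)" if "t \<in> T" for t
    using meas[OF that] by (intro integrable_mult_right) (simp add: emeasure_eq_measure)
  have "integrable M (\<lambda>x. W (K x)) \<longleftrightarrow> integrable M (\<lambda>x. \<Sum>t\<in>T. W t * indicator {x\<in>space M. K x = t} x)"
    by (intro Bochner_Integration.integrable_cong refl eq)
  then show "integrable M (\<lambda>x. W (K x))" using int by simp
  have "(\<integral>x. W (K x) \<partial>M) = (\<integral>x. (\<Sum>t\<in>T. W t * indicator {x\<in>space M. K x = t} x) \<partial>M)"
    by (intro Bochner_Integration.integral_cong refl eq)
  also have "\<dots> = (\<Sum>t\<in>T. \<integral>x. W t * indicator {x\<in>space M. K x = t} x \<partial>M)"
    using int by (rule Bochner_Integration.integral_sum)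
  also have "\<dots> = (\<Sum>t\<in>T. W t * measure M {x\<in>space M. K x = t})"
    by (intro sum.cong) (simp_all add: Int_absorb2[OF Collect_restrict])
  finally show "(\<integral>x. W (K x) \<partial>M) = (\<Sum>t\<in>T. W t * measure M {x\<in>space M. K x = t})" .
qed

text \<open>
  The cell of a point is the index of the first ball of a finite cover that contains it.
\<close>
lemma compact_measurable_partition:
  fixes S :: "'a::euclidean_space set"
  assumes S: "compact S" and "\<delta> > 0"
  obtains n :: nat and p :: "nat \<Rightarrow> 'a" and k :: "'a \<Rightarrow> nat" where
    "\<And>i. i < n \<Longrightarrow> p i \<in> S" "\<And>x. x \<in> S \<Longrightarrow> k x < n" "\<And>x. x \<in> S \<Longrightarrow> dist x (p (k x)) < \<delta>"
    "k \<in> borel \<rightarrow>\<^sub>M count_space UNIV"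
proof -
  have "S \<subseteq> (\<Union>x\<in>S. ball x \<delta>)" using \<open>\<delta> > 0\<close> by auto
  then obtain T where T: "T \<subseteq> S" "finite T" "S \<subseteq> (\<Union>x\<in>T. ball x \<delta>)"
    by (rule compactE_image[OF S, rotated]) auto
  obtain p n where p: "p ` {..<n::nat} = T"
    using finite_imp_nat_seg_image_inj_on[OF T(2)] by (auto simp: lessThan_def)
  define k where "k x = (LEAST i. dist x (p i) < \<delta>)" for x
  have "\<exists>i<n. dist x (p i) < \<delta>" if x: "x \<in> S" for x
  proof -
    from T(3) x obtain y where "y \<in> T" "dist y x < \<delta>" by auto
    with p show ?thesis by (auto simp: dist_commute image_iff)
  qed
  then have "k x < n" "dist x (p (k x)) < \<delta>" if x: "x \<in> S" for x
    unfolding k_def using that by (meson LeastI Least_le le_less_trans)+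
  moreover have "p i \<in> S" if "i < n" for i using p T(1) that by auto
  moreover have "k \<in> borel \<rightarrow>\<^sub>M count_space UNIV"
    unfolding k_def[abs_def] by measurable
  ultimately show thesis using that by blast
qed

lemma AE_charged_cell:
  fixes k :: "'a \<Rightarrow> nat"
  assumes M: "prob_space M" "space M = S" and cell: "\<And>i. {x\<in>S. k x = i} \<in> sets M"
    and k_less: "\<And>x. x \<in> S \<Longrightarrow> k x < n"
  shows "AE x in M. k x \<in> {i\<in>{..<n}. measure M {x\<in>S. k x = i} > 0}"
proof -
  interpret M: prob_space M by (rule M)
  have "AE x in M. \<forall>i\<in>{..<n}. k x = i \<longrightarrow> measure M {x\<in>S. k x = i} > 0"
  proof (rule AE_finite_allI)
    fix i
    show "AE x in M. k x = i \<longrightarrow> measure M {x\<in>S. k x = i} > 0"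
    proof (cases "measure M {x\<in>S. k x = i} > 0")
      case False
      then have "{x\<in>S. k x = i} \<in> null_sets M"
        using cell by (simp add: null_sets_def M.emeasure_eq_measure zero_less_measure_iff)
      from AE_not_in[OF this] AE_space show ?thesis by eventually_elim (use M(2) in simp)
    qed simp
  qed simp
  then show ?thesis
    using AE_space by eventually_elim (use k_less M(2) in auto)
qed

text \<open>
  A plan for the masses of the cells is spread to a coupling of \<open>\<mu>\<close> and \<open>\<nu>\<close> by giving
  \<open>\<mu> \<Otimes>\<^sub>M \<nu>\<close> the density \<open>\<pi> i j / (a i b j)\<close> on the product of cells \<open>i\<close> and \<open>j\<close>. Rows and columns
  of mass 0 are left out of the plan to make this quotient meaningful, which costs only a null set.
\<close>
lemma coupling_of_partition:
  fixes S :: "'a::euclidean_space set"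
  assumes \<mu>: "\<mu> \<in> prob_measures_on S" and \<nu>: "\<nu> \<in> prob_measures_on S"
    and k: "k \<in> borel \<rightarrow>\<^sub>M count_space UNIV" and k_less: "\<And>x. x \<in> S \<Longrightarrow> k x < n"
    and a_def: "\<And>i. a i = measure \<mu> {x\<in>S. k x = i}" and b_def: "\<And>j. b j = measure \<nu> {y\<in>S. k y = j}"
    and I_def: "I = {i\<in>{..<n}. a i > 0}" and J_def: "J = {j\<in>{..<n}. b j > 0}"
    and nonneg: "\<And>i j. \<pi> i j \<ge> 0"
    and row: "\<And>i. i \<in> I \<Longrightarrow> (\<Sum>j\<in>J. \<pi> i j) = a i"
    and col: "\<And>j. j \<in> J \<Longrightarrow> (\<Sum>i\<in>I. \<pi> i j) = b j"
  obtains \<gamma> where "\<gamma> \<in> couplings S \<mu> \<nu>"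
    "\<And>C :: nat \<Rightarrow> nat \<Rightarrow> real. integrable \<gamma> (\<lambda>z. C (k (fst z)) (k (snd z)))"
    "\<And>C :: nat \<Rightarrow> nat \<Rightarrow> real. (\<integral>z. C (k (fst z)) (k (snd z)) \<partial>\<gamma>) = (\<Sum>i\<in>I. \<Sum>j\<in>J. \<pi> i j * C i j)"
proof -
  interpret \<mu>: prob_space \<mu> using \<mu> by (rule prob_measures_onD)
  interpret \<nu>: prob_space \<nu> using \<nu> by (rule prob_measures_onD)
  interpret P: pair_prob_space \<mu> \<nu> ..
  note space = prob_measures_onD(3)[OF \<mu>] prob_measures_onD(3)[OF \<nu>]
  let ?P = "\<mu> \<Otimes>\<^sub>M \<nu>" and ?R = "restrict_space borel S"
  have [measurable]: "k \<in> \<mu> \<rightarrow>\<^sub>M count_space UNIV" "k \<in> \<nu> \<rightarrow>\<^sub>M count_space UNIV"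
    using measurable_restrict_space1[OF k, of S]
      measurable_cong_sets[OF prob_measures_onD(2)[OF \<mu>] refl]
      measurable_cong_sets[OF prob_measures_onD(2)[OF \<nu>] refl] by blast+
  define w where "w i j = (if i \<in> I \<and> j \<in> J then \<pi> i j / (a i * b j) else 0)" for i j
  have w_nonneg: "w i j \<ge> 0" for i j using nonneg by (simp add: w_def I_def J_def)
  define g where "g z = ennreal (w (k (fst z)) (k (snd z)))" for z
  have [measurable]: "(\<lambda>z. w (k (fst z)) (k (snd z))) \<in> borel_measurable ?P"
  proof (rule measurable_compose_countable[where f = "\<lambda>i z. w i (k (snd z))" and g = "\<lambda>z. k (fst z)"])
    show "(\<lambda>z. w i (k (snd z))) \<in> borel_measurable ?P" for i
      by (rule measurable_compose[where f = "\<lambda>z. k (snd z)" and g = "w i" and N = "count_space UNIV"])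
        simp_all
    show "(\<lambda>z. k (fst z)) \<in> ?P \<rightarrow>\<^sub>M count_space UNIV" by measurable
  qed
  have g[measurable]: "g \<in> borel_measurable ?P"
    unfolding g_def by measurable
  have fin: "finite I" "finite J" by (simp_all add: I_def J_def)
  have meas_k: "{x\<in>space M. k x = i} \<in> sets M" if "k \<in> M \<rightarrow>\<^sub>M count_space UNIV" for M and i :: nat
    using that by measurable
  have cell_\<mu>: "{x\<in>S. k x = i} \<in> sets \<mu>" and cell_\<nu>: "{x\<in>S. k x = i} \<in> sets \<nu>" for i
    using meas_k[of \<mu> i] meas_k[of \<nu> i] by (simp_all add: space)
  have row_mass: "(\<integral>\<^sup>+y. ennreal (w i (k y)) \<partial>\<nu>) = 1" if "i \<in> I" for i
  proof -
    have "(\<integral>\<^sup>+y. ennreal (w i (k y)) \<partial>\<nu>) = ennreal (\<integral>y. w i (k y) \<partial>\<nu>)"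
      using w_nonneg k_less
      by (intro nn_integral_eq_integral integral_finite_range[where T = "{..<n}"] \<nu>.prob_space_axioms)
        (auto simp: space cell_\<nu>)
    also have "(\<integral>y. w i (k y) \<partial>\<nu>) = (\<Sum>j<n. w i j * b j)"
      using k_less by (subst integral_finite_range[where T = "{..<n}"])
        (auto simp: b_def space \<nu>.prob_space_axioms cell_\<nu>)
    also have "\<dots> = (\<Sum>j\<in>J. \<pi> i j / a i)"
      using that by (intro sum.mono_neutral_cong_right) (auto simp: w_def I_def J_def)
    also have "\<dots> = 1"
      using row[OF that] that by (simp add: I_def flip: sum_divide_distrib)
    finally show ?thesis by simp
  qed
  have col_mass: "(\<integral>\<^sup>+x. ennreal (w (k x) j) \<partial>\<mu>) = 1" if "j \<in> J" for j
  proof -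
    have "(\<integral>\<^sup>+x. ennreal (w (k x) j) \<partial>\<mu>) = ennreal (\<integral>x. w (k x) j \<partial>\<mu>)"
      using w_nonneg k_less
      by (intro nn_integral_eq_integral integral_finite_range[where T = "{..<n}" and W = "\<lambda>i. w i j"] \<mu>.prob_space_axioms)
        (auto simp: space cell_\<mu>)
    also have "(\<integral>x. w (k x) j \<partial>\<mu>) = (\<Sum>i<n. w i j * a i)"
      using k_less by (subst integral_finite_range[where T = "{..<n}" and W = "\<lambda>i. w i j"])
        (auto simp: a_def space \<mu>.prob_space_axioms cell_\<mu>)
    also have "\<dots> = (\<Sum>i\<in>I. \<pi> i j / b j)"
      using that by (intro sum.mono_neutral_cong_right) (auto simp: w_def I_def J_def)
    also have "\<dots> = 1"
      using col[OF that] that by (simp add: J_def flip: sum_divide_distrib)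
    finally show ?thesis by simp
  qed
  have AE_I: "AE x in \<mu>. k x \<in> I" and AE_J: "AE y in \<nu>. k y \<in> J"
    unfolding I_def J_def a_def b_def
    using cell_\<mu> cell_\<nu> k_less
    by (intro AE_charged_cell; simp add: space \<mu>.prob_space_axioms \<nu>.prob_space_axioms)+
  define \<gamma>0 where "\<gamma>0 = density ?P g"
  define \<gamma> where "\<gamma> = distr \<gamma>0 (restrict_space borel (S \<times> S)) (\<lambda>z. z)"
  have sets_\<gamma>0[measurable_cong]: "sets \<gamma>0 = sets ?P" and space_\<gamma>0: "space \<gamma>0 = S \<times> S"
    by (simp_all add: \<gamma>0_def space_pair_measure space)
  have fst_R: "fst \<in> ?P \<rightarrow>\<^sub>M ?R" and snd_R: "snd \<in> ?P \<rightarrow>\<^sub>M ?R"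
    using measurable_cong_sets[OF refl prob_measures_onD(2)[OF \<mu>], of ?P] measurable_fst[of \<mu> \<nu>]
      measurable_cong_sets[OF refl prob_measures_onD(2)[OF \<nu>], of ?P] measurable_snd[of \<mu> \<nu>] by blast+
  have "(\<lambda>z. (fst z, snd z)) \<in> ?P \<rightarrow>\<^sub>M borel \<Otimes>\<^sub>M borel"
    using fst_R snd_R by (intro measurable_Pair) (auto simp: measurable_restrict_space2_iff)
  then have "(\<lambda>z. z) \<in> ?P \<rightarrow>\<^sub>M borel" by (simp add: borel_prod)
  then have "(\<lambda>z. z) \<in> \<gamma>0 \<rightarrow>\<^sub>M borel"
    using measurable_cong_sets[OF sets_\<gamma>0 refl] by blast
  then have id_R: "(\<lambda>z. z) \<in> \<gamma>0 \<rightarrow>\<^sub>M restrict_space borel (S \<times> S)"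
    by (intro measurable_restrict_space2) (auto simp: space_\<gamma>0)
  have proj: "fst \<in> restrict_space borel (S \<times> S) \<rightarrow>\<^sub>M ?R" "snd \<in> restrict_space borel (S \<times> S) \<rightarrow>\<^sub>M ?R"
    by (auto intro!: measurable_restrict_space3 borel_measurable_continuous_onI continuous_intros)
  have marg: "distr \<gamma> ?R fst = distr \<gamma>0 ?R fst" "distr \<gamma> ?R snd = distr \<gamma>0 ?R snd"
    unfolding \<gamma>_def using distr_distr[OF proj(1) id_R] distr_distr[OF proj(2) id_R]
    by (simp_all add: comp_def)
  have fst_marg: "distr \<gamma>0 ?R fst = \<mu>"
  proof (rule measure_eqI)
    show "sets (distr \<gamma>0 ?R fst) = sets \<mu>" using prob_measures_onD(2)[OF \<mu>] by simp
    fix A assume "A \<in> sets (distr \<gamma>0 ?R fst)"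
    then have A: "A \<in> sets ?R" and [measurable]: "A \<in> sets \<mu>"
      using prob_measures_onD(2)[OF \<mu>] by simp_all
    have "emeasure (distr \<gamma>0 ?R fst) A = (\<integral>\<^sup>+z. g z * indicator A (fst z) \<partial>?P)"
      using A fst_R
      by (simp add: emeasure_distr \<gamma>0_def emeasure_density measurable_sets)
        (auto intro!: nn_integral_cong simp: indicator_def)
    also have "\<dots> = (\<integral>\<^sup>+x. \<integral>\<^sup>+y. g (x, y) * indicator A x \<partial>\<nu> \<partial>\<mu>)"
      by (subst \<nu>.nn_integral_fst[symmetric]) simp_all
    also have "\<dots> = (\<integral>\<^sup>+x. indicator A x \<partial>\<mu>)"
    proof (rule nn_integral_cong_AE)
      show "AE x in \<mu>. (\<integral>\<^sup>+y. g (x, y) * indicator A x \<partial>\<nu>) = indicator A x"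
        using AE_I
      proof eventually_elim
        case (elim x)
        have "(\<integral>\<^sup>+y. g (x, y) * indicator A x \<partial>\<nu>) = (\<integral>\<^sup>+y. ennreal (w (k x) (k y)) \<partial>\<nu>) * indicator A x"
          unfolding g_def by (subst nn_integral_multc) (auto intro!: measurable_compose[OF _ measurable_count_space])
        then show ?case using row_mass[OF elim] by simp
      qed
    qed
    finally show "emeasure (distr \<gamma>0 ?R fst) A = emeasure \<mu> A" by simp
  qed
  have snd_marg: "distr \<gamma>0 ?R snd = \<nu>"
  proof (rule measure_eqI)
    show "sets (distr \<gamma>0 ?R snd) = sets \<nu>" using prob_measures_onD(2)[OF \<nu>] by simp
    fix A assume "A \<in> sets (distr \<gamma>0 ?R snd)"
    then have A: "A \<in> sets ?R" and [measurable]: "A \<in> sets \<nu>"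
      using prob_measures_onD(2)[OF \<nu>] by simp_all
    have "emeasure (distr \<gamma>0 ?R snd) A = (\<integral>\<^sup>+z. g z * indicator A (snd z) \<partial>?P)"
      using A snd_R
      by (simp add: emeasure_distr \<gamma>0_def emeasure_density measurable_sets)
        (auto intro!: nn_integral_cong simp: indicator_def)
    also have "\<dots> = (\<integral>\<^sup>+y. \<integral>\<^sup>+x. g (x, y) * indicator A y \<partial>\<mu> \<partial>\<nu>)"
      by (subst P.nn_integral_snd[symmetric]) simp_all
    also have "\<dots> = (\<integral>\<^sup>+y. indicator A y \<partial>\<nu>)"
    proof (rule nn_integral_cong_AE)
      show "AE y in \<nu>. (\<integral>\<^sup>+x. g (x, y) * indicator A y \<partial>\<mu>) = indicator A y"
        using AE_J
      proof eventually_elim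
        case (elim y)
        have "(\<integral>\<^sup>+x. g (x, y) * indicator A y \<partial>\<mu>) = (\<integral>\<^sup>+x. ennreal (w (k x) (k y)) \<partial>\<mu>) * indicator A y"
          unfolding g_def by (subst nn_integral_multc)
            (auto intro!: measurable_compose[OF _ measurable_count_space[where f = "\<lambda>i. ennreal (w i (k y))"]])
        then show ?case using col_mass[OF elim] by simp
      qed
    qed
    finally show "emeasure (distr \<gamma>0 ?R snd) A = emeasure \<nu> A" by simp
  qed
  have space_\<gamma>: "space \<gamma> = S \<times> S" by (simp add: \<gamma>_def space_restrict_space)
  have "fst \<in> \<gamma> \<rightarrow>\<^sub>M ?R" using proj(1) by (simp add: \<gamma>_def)
  then have prob_\<gamma>: "prob_space \<gamma>"
    using marg(1) fst_marg \<mu>.prob_space_axioms by (auto intro: prob_space_distrD)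
  have coupling: "\<gamma> \<in> couplings S \<mu> \<nu>"
    using prob_\<gamma> marg fst_marg snd_marg by (simp add: couplings_def prob_measures_on_def \<gamma>_def)
  have cell: "{z\<in>S \<times> S. k (fst z) = i \<and> k (snd z) = j} \<in> sets ?P" for i j
  proof -
    have "{z\<in>space ?P. k (fst z) = i \<and> k (snd z) = j} \<in> sets ?P" by measurable
    then show ?thesis by (simp add: space_pair_measure space)
  qed
  have meas_cell: "{z\<in>S \<times> S. k (fst z) = i \<and> k (snd z) = j} \<in> sets \<gamma>" for i j
  proof -
    have "k \<in> ?R \<rightarrow>\<^sub>M count_space UNIV" using k by (rule measurable_restrict_space1)
    note [measurable] = measurable_compose[OF proj(1) this] measurable_compose[OF proj(2) this]
    have "{z\<in>space (restrict_space borel (S \<times> S)). k (fst z) = i \<and> k (snd z) = j}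
        \<in> sets (restrict_space borel (S \<times> S))" by measurable
    then show ?thesis by (simp add: \<gamma>_def space_restrict_space)
  qed
  have measure_cell: "measure \<gamma> {z\<in>S \<times> S. k (fst z) = i \<and> k (snd z) = j} = w i j * (a i * b j)" for i j
  proof -
    let ?A = "{z\<in>S \<times> S. k (fst z) = i \<and> k (snd z) = j}"
    have "emeasure \<gamma> ?A = emeasure \<gamma>0 ?A"
      using id_R meas_cell[of i j] unfolding \<gamma>_def
      by (subst emeasure_distr) (auto simp: space_\<gamma>0 intro!: arg_cong2[where f = emeasure])
    also have "\<dots> = (\<integral>\<^sup>+z. ennreal (w i j) * indicator ?A z \<partial>?P)"
      unfolding \<gamma>0_def using cell[of i j]
      by (subst emeasure_density) (auto intro!: nn_integral_cong simp: g_def indicator_def)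
    also have "\<dots> = ennreal (w i j) * emeasure ?P ({x\<in>S. k x = i} \<times> {y\<in>S. k y = j})"
      using cell[of i j] by (subst nn_integral_cmult_indicator) (auto intro!: arg_cong2[where f = emeasure] arg_cong2[where f = times])
    also have "\<dots> = ennreal (w i j * (a i * b j))"
      using cell_\<mu>[of i] cell_\<nu>[of j] w_nonneg
      by (subst \<nu>.emeasure_pair_measure_Times)
        (auto simp: space a_def b_def \<mu>.emeasure_eq_measure \<nu>.emeasure_eq_measure simp flip: ennreal_mult)
    finally show ?thesis
      using w_nonneg by (simp add: measure_def a_def b_def)
  qed
  have range: "(\<lambda>z. (k (fst z), k (snd z))) z \<in> {..<n} \<times> {..<n}" if "z \<in> space \<gamma>" for z
    using that k_less by (auto simp: space_\<gamma>)
  have cells: "{z\<in>space \<gamma>. (k (fst z), k (snd z)) = t} = {z\<in>S \<times> S. k (fst z) = fst t \<and> k (snd z) = snd t}" for t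
    by (auto simp: space_\<gamma>)
  note finite_range = integral_finite_range[where K = "\<lambda>z. (k (fst z), k (snd z))" and T = "{..<n} \<times> {..<n}", OF prob_\<gamma> _ range]
  have "integrable \<gamma> (\<lambda>z. C (k (fst z)) (k (snd z)))" for C :: "nat \<Rightarrow> nat \<Rightarrow> real"
    using finite_range(1)[where W = "\<lambda>(i, j). C i j"] by (simp add: cells meas_cell)
  moreover have "(\<integral>z. C (k (fst z)) (k (snd z)) \<partial>\<gamma>) = (\<Sum>i\<in>I. \<Sum>j\<in>J. \<pi> i j * C i j)" for C :: "nat \<Rightarrow> nat \<Rightarrow> real"
  proof -
    have "(\<integral>z. C (k (fst z)) (k (snd z)) \<partial>\<gamma>) =
        (\<Sum>t\<in>{..<n} \<times> {..<n}. C (fst t) (snd t) * (w (fst t) (snd t) * (a (fst t) * b (snd t))))"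
      using finite_range(2)[where W = "\<lambda>(i, j). C i j"]
      by (simp add: cells meas_cell measure_cell case_prod_beta)
    also have "\<dots> = (\<Sum>t\<in>I \<times> J. \<pi> (fst t) (snd t) * C (fst t) (snd t))"
      by (intro sum.mono_neutral_cong_right) (auto simp: w_def I_def J_def)
    finally show ?thesis by (simp add: sum.cartesian_product')
  qed
  ultimately show thesis using that coupling by blast
qed

lemma compact_product_uniform_modulus:
  fixes c :: "'a::metric_space \<times> 'b::metric_space \<Rightarrow> real"
  assumes "compact S" "compact T" "continuous_on (S \<times> T) c" "e > 0"
  obtains d where "d > 0"
    "\<And>x x' y y'. x \<in> S \<Longrightarrow> x' \<in> S \<Longrightarrow> y \<in> T \<Longrightarrow> y' \<in> T \<Longrightarrow> dist x x' < d \<Longrightarrow> dist y y' < d \<Longrightarrow>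
      \<bar>c (x, y) - c (x', y')\<bar> \<le> e"
proof -
  have "uniformly_continuous_on (S \<times> T) c"
    using assms by (intro compact_uniformly_continuous compact_Times)
  then obtain d where d: "d > 0"
    "\<And>z z'. z \<in> S \<times> T \<Longrightarrow> z' \<in> S \<times> T \<Longrightarrow> dist z' z < d \<Longrightarrow> dist (c z') (c z) < e"
    using \<open>e > 0\<close> unfolding uniformly_continuous_on_def by metis
  have "\<bar>c (x, y) - c (x', y')\<bar> \<le> e"
    if "x \<in> S" "x' \<in> S" "y \<in> T" "y' \<in> T" "dist x x' < d / 2" "dist y y' < d / 2" for x x' y y'
  proof -
    have "dist (x, y) (x', y') \<le> dist x x' + dist y y'"
      unfolding dist_Pair_Pair by (rule sqrt_sum_squares_le_sum) simp_all
    also have "\<dots> < d" using that by simp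
    finally show ?thesis using d(2)[of "(x', y')" "(x, y)"] that by (simp add: dist_real_def)
  qed
  with \<open>d > 0\<close> show thesis by (intro that[of "d / 2"]) auto
qed

lemma c_transform_continuous_on_left:
  fixes S :: "'a::metric_space set"
  assumes S: "compact S" "S \<noteq> {}" and c: "continuous_on (S \<times> S) c" and \<phi>: "\<And>x. x \<in> S \<Longrightarrow> \<phi> x \<le> B"
  shows "continuous_on S (c_transform S (\<lambda>x y. c (x, y)) \<phi>)"
proof -
  obtain M where M: "\<And>x y. x \<in> S \<Longrightarrow> y \<in> S \<Longrightarrow> \<bar>c (x, y)\<bar> \<le> M"
    using compact_imp_bounded[OF compact_continuous_image[OF c compact_Times[OF S(1) S(1)]]]
    by (auto simp: bounded_iff)
  show ?thesis
  proof (rule c_transform_continuous_on)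
    show "- M - B \<le> c (x, y) - \<phi> x" if "x \<in> S" "y \<in> S" for x y
      using M[OF that] \<phi>[OF that(1)] by linarith
    fix e :: real assume "e > 0"
    from compact_product_uniform_modulus[OF S(1) S(1) c this] obtain d where "d > 0"
      "\<And>x x' y y'. x \<in> S \<Longrightarrow> x' \<in> S \<Longrightarrow> y \<in> S \<Longrightarrow> y' \<in> S \<Longrightarrow> dist x x' < d \<Longrightarrow> dist y y' < d \<Longrightarrow>
        \<bar>c (x, y) - c (x', y')\<bar> \<le> e" by metis
    then show "\<exists>d>0. \<forall>x\<in>S. \<forall>y\<in>S. \<forall>y'\<in>S. dist y y' < d \<longrightarrow> \<bar>c (x, y) - c (x, y')\<bar> \<le> e"
      by (intro exI[of _ d]) auto
  qed fact
qed

text \<open>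
  The cells are so small that replacing points by the centres of their cells changes \<open>c\<close> by at most
  \<open>\<omega>\<close>, which reduces the problem to a finite one. The finite potential \<open>v\<close> on the cells is turned into a continuous \<open>\<phi>\<close> by a transform over the
  cells, and \<open>\<psi>\<close> is the transform of \<open>\<phi>\<close>; on charged cells they are at least \<open>u\<close> and \<open>v\<close> up to \<open>\<omega>\<close>.
\<close>
lemma kantorovich_approximate_duality:
  fixes S :: "'a::euclidean_space set"
  assumes S: "compact S" and \<mu>: "\<mu> \<in> prob_measures_on S" and \<nu>: "\<nu> \<in> prob_measures_on S"
    and c: "continuous_on (S \<times> S) c" and "e > 0"
  obtains \<gamma> p where "\<gamma> \<in> couplings S \<mu> \<nu>" "p \<in> dual_admissible S c"
    "(\<integral>z. c z \<partial>\<gamma>) \<le> dual_value \<mu> \<nu> p + e"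
proof -
  interpret \<mu>: prob_space \<mu> using \<mu> by (rule prob_measures_onD)
  interpret \<nu>: prob_space \<nu> using \<nu> by (rule prob_measures_onD)
  note space = prob_measures_onD(3)[OF \<mu>] prob_measures_onD(3)[OF \<nu>]
  have "S \<noteq> {}" using \<mu>.not_empty space by simp
  \<comment> \<open>four errors: discretizing the cost, the finite duality gap, and one for each of the two potentials\<close>
  define \<omega> where "\<omega> = e / 4"
  have \<omega>: "\<omega> > 0" using \<open>e > 0\<close> by (simp add: \<omega>_def)
  obtain d where d: "d > 0"
    "\<And>x x' y y'. x \<in> S \<Longrightarrow> x' \<in> S \<Longrightarrow> y \<in> S \<Longrightarrow> y' \<in> S \<Longrightarrow> dist x x' < d \<Longrightarrow> dist y y' < d \<Longrightarrow>
      \<bar>c (x, y) - c (x', y')\<bar> \<le> \<omega>"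
    using compact_product_uniform_modulus[OF S S c \<omega>] by metis
  obtain n :: nat and p k where part: "\<And>i. i < n \<Longrightarrow> p i \<in> S" "\<And>x. x \<in> S \<Longrightarrow> k x < n"
      "\<And>x. x \<in> S \<Longrightarrow> dist x (p (k x)) < d" and k: "k \<in> borel \<rightarrow>\<^sub>M count_space UNIV"
    using compact_measurable_partition[OF S d(1)] by blast
  define a where "a i = measure \<mu> {x\<in>S. k x = i}" for i
  define b where "b j = measure \<nu> {y\<in>S. k y = j}" for j
  define I where "I = {i\<in>{..<n}. a i > 0}"
  define J where "J = {j\<in>{..<n}. b j > 0}"
  have "k \<in> restrict_space borel S \<rightarrow>\<^sub>M count_space UNIV" using k by (rule measurable_restrict_space1)
  then have "k \<in> \<mu> \<rightarrow>\<^sub>M count_space UNIV" "k \<in> \<nu> \<rightarrow>\<^sub>M count_space UNIV"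
    using measurable_cong_sets[OF prob_measures_onD(2)[OF \<mu>] refl]
      measurable_cong_sets[OF prob_measures_onD(2)[OF \<nu>] refl] by blast+
  then have "{x\<in>space \<mu>. k x = i} \<in> sets \<mu>" "{x\<in>space \<nu>. k x = i} \<in> sets \<nu>" for i
    by measurable
  then have cell: "{x\<in>S. k x = i} \<in> sets \<mu>" "{x\<in>S. k x = i} \<in> sets \<nu>" for i
    by (simp_all add: space)
  have int_\<mu>: "integrable \<mu> (\<lambda>x. W (k x))" and int_\<nu>: "integrable \<nu> (\<lambda>x. W (k x))" for W :: "nat \<Rightarrow> real"
    using part(2) cell
    by (auto intro!: integral_finite_range(1)[where T = "{..<n}"] \<mu>.prob_space_axioms \<nu>.prob_space_axioms simp: space)
  have sum_\<mu>: "(\<integral>x. W (k x) \<partial>\<mu>) = (\<Sum>i\<in>I. a i * W i)" for W :: "nat \<Rightarrow> real"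
  proof -
    have "(\<integral>x. W (k x) \<partial>\<mu>) = (\<Sum>i<n. W i * a i)"
      using part(2) cell by (subst integral_finite_range(2)[where T = "{..<n}"])
        (auto simp: space a_def \<mu>.prob_space_axioms)
    also have "\<dots> = (\<Sum>i\<in>I. a i * W i)"
      by (intro sum.mono_neutral_cong_right) (auto simp: I_def a_def zero_less_measure_iff)
    finally show ?thesis .
  qed
  have sum_\<nu>: "(\<integral>x. W (k x) \<partial>\<nu>) = (\<Sum>j\<in>J. b j * W j)" for W :: "nat \<Rightarrow> real"
  proof -
    have "(\<integral>x. W (k x) \<partial>\<nu>) = (\<Sum>j<n. W j * b j)"
      using part(2) cell by (subst integral_finite_range(2)[where T = "{..<n}"])
        (auto simp: space b_def \<nu>.prob_space_axioms)
    also have "\<dots> = (\<Sum>j\<in>J. b j * W j)"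
      by (intro sum.mono_neutral_cong_right) (auto simp: J_def b_def zero_less_measure_iff)
    finally show ?thesis .
  qed
  have mass: "sum a I = 1" "sum b J = 1"
    using sum_\<mu>[of "\<lambda>_. 1"] sum_\<nu>[of "\<lambda>_. 1"] by (simp_all add: \<mu>.prob_space \<nu>.prob_space)
  define C where "C i j = c (p i, p j)" for i j
  have fin: "finite I" "finite J" by (simp_all add: I_def J_def)
  have pos: "\<And>i. i \<in> I \<Longrightarrow> a i > 0" "\<And>j. j \<in> J \<Longrightarrow> b j > 0" by (simp_all add: I_def J_def)
  obtain \<pi> :: "nat \<Rightarrow> nat \<Rightarrow> real" and u v where nonneg: "\<And>i j. \<pi> i j \<ge> 0"
    and row: "\<And>i. i \<in> I \<Longrightarrow> (\<Sum>j\<in>J. \<pi> i j) = a i" and col: "\<And>j. j \<in> J \<Longrightarrow> (\<Sum>i\<in>I. \<pi> i j) = b j"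
    and adm: "\<And>i j. i \<in> I \<Longrightarrow> j \<in> J \<Longrightarrow> u i + v j \<le> C i j"
    and gap: "(\<Sum>i\<in>I. \<Sum>j\<in>J. \<pi> i j * C i j) \<le> (\<Sum>i\<in>I. a i * u i) + (\<Sum>j\<in>J. b j * v j) + \<omega>"
    using finite_transport_duality[OF fin pos mass \<omega>, where C = C] by blast
  obtain \<gamma> where \<gamma>: "\<gamma> \<in> couplings S \<mu> \<nu>"
    and \<gamma>_int: "\<And>C :: nat \<Rightarrow> nat \<Rightarrow> real. integrable \<gamma> (\<lambda>z. C (k (fst z)) (k (snd z)))"
    and \<gamma>_sum: "\<And>C :: nat \<Rightarrow> nat \<Rightarrow> real. (\<integral>z. C (k (fst z)) (k (snd z)) \<partial>\<gamma>) = (\<Sum>i\<in>I. \<Sum>j\<in>J. \<pi> i j * C i j)"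
    using coupling_of_partition[OF \<mu> \<nu> k part(2) a_def b_def I_def J_def nonneg row col] by blast
  have \<gamma>': "\<gamma> \<in> prob_measures_on (S \<times> S)" using \<gamma> by (simp add: couplings_def)
  interpret \<gamma>: prob_space \<gamma> using \<gamma>' by (rule prob_measures_onD)
  have "(\<integral>z. c z \<partial>\<gamma>) \<le> (\<integral>z. C (k (fst z)) (k (snd z)) + \<omega> \<partial>\<gamma>)"
  proof (intro integral_mono)
    show "integrable \<gamma> c"
      by (rule continuous_on_integrable_prob_measures_on[OF \<gamma>' compact_Times[OF S S] c])
    show "integrable \<gamma> (\<lambda>z. C (k (fst z)) (k (snd z)) + \<omega>)" using \<gamma>_int by simp
    fix z assume "z \<in> space \<gamma>"
    then obtain x y where z: "z = (x, y)" "x \<in> S" "y \<in> S" using prob_measures_onD(3)[OF \<gamma>'] by auto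
    then show "c z \<le> C (k (fst z)) (k (snd z)) + \<omega>"
      using d(2)[of x "p (k x)" y "p (k y)"] part by (simp add: C_def abs_le_iff)
  qed
  also have "\<dots> = (\<Sum>i\<in>I. \<Sum>j\<in>J. \<pi> i j * C i j) + \<omega>"
    using \<gamma>_int by (simp add: \<gamma>_sum \<gamma>.prob_space)
  finally have primal: "(\<integral>z. c z \<partial>\<gamma>) \<le> (\<Sum>i\<in>I. a i * u i) + (\<Sum>j\<in>J. b j * v j) + 2 * \<omega>"
    using gap by simp
  obtain M where M: "\<And>x y. x \<in> S \<Longrightarrow> y \<in> S \<Longrightarrow> \<bar>c (x, y)\<bar> \<le> M"
    using compact_imp_bounded[OF compact_continuous_image[OF c compact_Times[OF S S]]]
    by (auto simp: bounded_iff)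
  have J: "J \<noteq> {}" using mass by auto
  have pJ: "p j \<in> S" if "j \<in> J" for j using that part(1) by (simp add: J_def)
  define \<phi> where "\<phi> = c_transform J (\<lambda>j x. c (x, p j)) v"
  \<comment> \<open>an upper bound for \<open>v\<close>, so that the infimum defining \<open>\<phi>\<close> is over a set bounded below\<close>
  define V where "V = Max (v ` J)"
  have \<phi>_bdd: "- M - V \<le> c (x, p j) - v j" if "j \<in> J" "x \<in> S" for j x
  proof -
    have "v j \<le> V" using that fin by (simp add: V_def)
    then show ?thesis using M[OF that(2) pJ[OF that(1)]] by linarith
  qed
  have \<phi>_cont: "continuous_on S \<phi>"
    unfolding \<phi>_def
  proof (rule c_transform_continuous_on[OF \<phi>_bdd])
    fix e :: real assume "e > 0"
    from compact_product_uniform_modulus[OF S S c this] obtain d where "d > 0"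
      "\<And>x x' y y'. x \<in> S \<Longrightarrow> x' \<in> S \<Longrightarrow> y \<in> S \<Longrightarrow> y' \<in> S \<Longrightarrow> dist x x' < d \<Longrightarrow> dist y y' < d \<Longrightarrow>
        \<bar>c (x, y) - c (x', y')\<bar> \<le> e" by metis
    then show "\<exists>d>0. \<forall>j\<in>J. \<forall>x\<in>S. \<forall>x'\<in>S. dist x x' < d \<longrightarrow> \<bar>c (x, p j) - c (x', p j)\<bar> \<le> e"
      using pJ by (intro exI[of _ d]) auto
  qed (use J in auto)
  have \<phi>_le: "\<phi> x \<le> c (x, p j) - v j" if "j \<in> J" "x \<in> S" for j x
    unfolding \<phi>_def using \<phi>_bdd that by (intro c_transform_le) auto
  have \<phi>_ge: "u (k x) - \<omega> \<le> \<phi> x" if x: "x \<in> S" "k x \<in> I" for x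
    unfolding \<phi>_def
  proof (rule c_transform_ge)
    fix j assume j: "j \<in> J"
    have "\<bar>c (x, p j) - c (p (k x), p j)\<bar> \<le> \<omega>"
      using x j pJ part d(1) by (intro d(2)) auto
    then show "u (k x) - \<omega> \<le> c (x, p j) - v j" using adm[OF x(2) j] by (simp add: C_def abs_le_iff)
  qed fact
  define \<psi> where "\<psi> = c_transform S (\<lambda>x y. c (x, y)) \<phi>"
  obtain B where B: "\<And>x. x \<in> S \<Longrightarrow> \<phi> x \<le> B"
    using compact_imp_bounded[OF compact_continuous_image[OF \<phi>_cont S]] by (auto simp: bounded_iff abs_le_iff)
  have \<psi>_cont: "continuous_on S \<psi>"
    unfolding \<psi>_def using S \<open>S \<noteq> {}\<close> c B by (rule c_transform_continuous_on_left)
  have \<psi>_le: "\<psi> y \<le> c (x, y) - \<phi> x" if "x \<in> S" "y \<in> S" for x y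
    unfolding \<psi>_def
  proof (rule c_transform_le)
    show "- M - B \<le> c (x, y) - \<phi> x" if "x \<in> S" for x using M[OF that \<open>y \<in> S\<close>] B[OF that] by linarith
  qed fact
  have \<psi>_ge: "v (k y) - \<omega> \<le> \<psi> y" if y: "y \<in> S" "k y \<in> J" for y
    unfolding \<psi>_def
  proof (rule c_transform_ge)
    fix x assume x: "x \<in> S"
    have "\<bar>c (x, y) - c (x, p (k y))\<bar> \<le> \<omega>"
      using x y part d(1) by (intro d(2)) auto
    then show "v (k y) - \<omega> \<le> c (x, y) - \<phi> x" using \<phi>_le[OF y(2) x] by (simp add: abs_le_iff)
  qed fact
  have adm: "(\<phi>, \<psi>) \<in> dual_admissible S c"
    using \<phi>_cont \<psi>_cont \<psi>_le by (fastforce simp: dual_admissible_def)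
  have "AE x in \<mu>. k x \<in> I"
    unfolding I_def a_def using cell part(2) by (intro AE_charged_cell) (simp_all add: space \<mu>.prob_space_axioms)
  then have "(\<integral>x. u (k x) - \<omega> \<partial>\<mu>) \<le> (\<integral>x. \<phi> x \<partial>\<mu>)"
  proof (intro integral_mono_AE)
    show "AE x in \<mu>. u (k x) - \<omega> \<le> \<phi> x"
      using \<open>AE x in \<mu>. k x \<in> I\<close> AE_space by eventually_elim (use \<phi>_ge space in auto)
  qed (use int_\<mu> continuous_on_integrable_prob_measures_on[OF \<mu> S \<phi>_cont] in auto)
  then have 1: "(\<Sum>i\<in>I. a i * u i) - \<omega> \<le> (\<integral>x. \<phi> x \<partial>\<mu>)"
    using int_\<mu> by (simp add: sum_\<mu> \<mu>.prob_space)
  have "AE x in \<nu>. k x \<in> J"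
    unfolding J_def b_def using cell part(2) by (intro AE_charged_cell) (simp_all add: space \<nu>.prob_space_axioms)
  then have "(\<integral>x. v (k x) - \<omega> \<partial>\<nu>) \<le> (\<integral>x. \<psi> x \<partial>\<nu>)"
  proof (intro integral_mono_AE)
    show "AE x in \<nu>. v (k x) - \<omega> \<le> \<psi> x"
      using \<open>AE x in \<nu>. k x \<in> J\<close> AE_space by eventually_elim (use \<psi>_ge space in auto)
  qed (use int_\<nu> continuous_on_integrable_prob_measures_on[OF \<nu> S \<psi>_cont] in auto)
  then have 2: "(\<Sum>j\<in>J. b j * v j) - \<omega> \<le> (\<integral>x. \<psi> x \<partial>\<nu>)"
    using int_\<nu> by (simp add: sum_\<nu> \<nu>.prob_space)
  have "(\<integral>z. c z \<partial>\<gamma>) \<le> dual_value \<mu> \<nu> (\<phi>, \<psi>) + e"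
    using primal 1 2 by (simp add: dual_value_def \<omega>_def)
  with \<gamma> adm show thesis by (rule that)
qed

section \<open>Attainment of the dual problem by normalized potentials\<close>

locale transport_problem =
  fixes S :: "'a::euclidean_space set" and c :: "'a \<times> 'a \<Rightarrow> real" and M :: real
  assumes compact_S: "compact S" and S_nonempty: "S \<noteq> {}"
    and continuous_c: "continuous_on (S \<times> S) c"
    and c_nonneg: "\<And>x y. x \<in> S \<Longrightarrow> y \<in> S \<Longrightarrow> 0 \<le> c (x, y)"
    and c_le: "\<And>x y. x \<in> S \<Longrightarrow> y \<in> S \<Longrightarrow> c (x, y) \<le> M"
begin

definition conj_potential :: "('a \<Rightarrow> real) \<Rightarrow> 'a \<Rightarrow> real" where
  "conj_potential = c_transform S (\<lambda>x y. c (x, y))"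

text \<open>
  The oscillation of \<open>\<phi>\<close> between two points is bounded by that of \<open>c\<close> in its first variable, uniformly in
  the second. Quantifying over bounds \<open>e\<close> avoids a supremum over \<open>y\<close> and makes the condition
  stable under pointwise limits.
\<close>
definition cost_modulus :: "('a \<Rightarrow> real) \<Rightarrow> bool" where
  "cost_modulus \<phi> \<longleftrightarrow> (\<forall>x\<in>S. \<forall>x'\<in>S. \<forall>e. (\<forall>y\<in>S. \<bar>c (x, y) - c (x', y)\<bar> \<le> e) \<longrightarrow> \<bar>\<phi> x - \<phi> x'\<bar> \<le> e)"

text \<open>
  This class is compact for uniform convergence and large enough for duality: replacing a potential
  by a double transform and shifting a constant from \<open>\<phi>\<close> to \<open>\<psi>\<close> does not decrease any dual value. The shift is
  chosen to make \<open>\<phi>\<close> nonnegative, since integration against a nonnegative function preserves convexity.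
\<close>
definition normalized_potentials :: "('a \<Rightarrow> real) set" where
  "normalized_potentials = {\<phi>. cost_modulus \<phi> \<and> (\<forall>x\<in>S. 0 \<le> \<phi> x \<and> \<phi> x \<le> M)}"

definition potential_value :: "'a measure \<Rightarrow> 'a measure \<Rightarrow> ('a \<Rightarrow> real) \<Rightarrow> real" where
  "potential_value \<mu> \<nu> \<phi> = dual_value \<mu> \<nu> (\<phi>, conj_potential \<phi>)"

lemma cost_equicontinuous:
  assumes "e > 0"
  obtains d where "d > 0"
    "\<And>\<phi> x x'. cost_modulus \<phi> \<Longrightarrow> x \<in> S \<Longrightarrow> x' \<in> S \<Longrightarrow> dist x x' < d \<Longrightarrow> \<bar>\<phi> x - \<phi> x'\<bar> < e"
proof -
  have "e / 2 > 0" using assms by simp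
  from compact_product_uniform_modulus[OF compact_S compact_S continuous_c this] obtain d
    where d: "d > 0" "\<And>x x' y y'. x \<in> S \<Longrightarrow> x' \<in> S \<Longrightarrow> y \<in> S \<Longrightarrow> y' \<in> S \<Longrightarrow> dist x x' < d \<Longrightarrow>
      dist y y' < d \<Longrightarrow> \<bar>c (x, y) - c (x', y')\<bar> \<le> e / 2" by metis
  have "\<bar>\<phi> x - \<phi> x'\<bar> < e" if "cost_modulus \<phi>" "x \<in> S" "x' \<in> S" "dist x x' < d" for \<phi> x x'
  proof -
    have "\<forall>y\<in>S. \<bar>c (x, y) - c (x', y)\<bar> \<le> e / 2" using d that by simp
    then have "\<bar>\<phi> x - \<phi> x'\<bar> \<le> e / 2" using that unfolding cost_modulus_def by blast
    then show ?thesis using assms by simp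
  qed
  with d(1) show thesis by (rule that)
qed

lemma cost_modulus_continuous_on:
  assumes "cost_modulus \<phi>"
  shows "continuous_on S \<phi>"
  unfolding continuous_on_iff
proof (intro ballI allI impI)
  fix x and e :: real assume x: "x \<in> S" and "e > 0"
  from cost_equicontinuous[OF this(2)] obtain d where d: "d > 0"
    "\<And>\<phi> x x'. cost_modulus \<phi> \<Longrightarrow> x \<in> S \<Longrightarrow> x' \<in> S \<Longrightarrow> dist x x' < d \<Longrightarrow> \<bar>\<phi> x - \<phi> x'\<bar> < e"
    by metis
  then show "\<exists>d>0. \<forall>x'\<in>S. dist x' x < d \<longrightarrow> dist (\<phi> x') (\<phi> x) < e"
    using assms x by (intro exI[of _ d]) (simp add: dist_real_def)
qed

lemma conj_potential_le:
  assumes "\<And>x. x \<in> S \<Longrightarrow> \<phi> x \<le> B" and "x \<in> S" "y \<in> S"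
  shows "conj_potential \<phi> y \<le> c (x, y) - \<phi> x"
  unfolding conj_potential_def
proof (rule c_transform_le)
  show "- B \<le> c (x, y) - \<phi> x" if "x \<in> S" for x
    using assms(1)[OF that] c_nonneg[OF that \<open>y \<in> S\<close>] by linarith
qed fact

lemma conj_potential_ge:
  assumes "\<And>x. x \<in> S \<Longrightarrow> m \<le> c (x, y) - \<phi> x"
  shows "m \<le> conj_potential \<phi> y"
  unfolding conj_potential_def using assms S_nonempty by (rule c_transform_ge)

lemma dual_admissible_conj_potential:
  assumes "continuous_on S \<phi>" and "\<And>x. x \<in> S \<Longrightarrow> \<phi> x \<le> B"
  shows "(\<phi>, conj_potential \<phi>) \<in> dual_admissible S c"
proof -
  have "continuous_on S (conj_potential \<phi>)"
    unfolding conj_potential_def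
    using compact_S S_nonempty continuous_c assms(2) by (rule c_transform_continuous_on_left)
  moreover have "\<phi> x + conj_potential \<phi> y \<le> c (x, y)" if "x \<in> S" "y \<in> S" for x y
    using conj_potential_le[of \<phi> B x y] assms(2) that by simp
  ultimately show ?thesis using assms(1) by (simp add: dual_admissible_def)
qed

lemma normalized_potentialsD:
  assumes "\<phi> \<in> normalized_potentials"
  shows "continuous_on S \<phi>" "\<And>x. x \<in> S \<Longrightarrow> 0 \<le> \<phi> x" "\<And>x. x \<in> S \<Longrightarrow> \<phi> x \<le> M"
    "(\<phi>, conj_potential \<phi>) \<in> dual_admissible S c"
proof -
  show *: "continuous_on S \<phi>" "\<And>x. x \<in> S \<Longrightarrow> 0 \<le> \<phi> x" "\<And>x. x \<in> S \<Longrightarrow> \<phi> x \<le> M"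
    using assms cost_modulus_continuous_on by (auto simp: normalized_potentials_def)
  then show "(\<phi>, conj_potential \<phi>) \<in> dual_admissible S c"
    by (intro dual_admissible_conj_potential)
qed

text \<open>
  The double transform \<open>\<phi>1\<close> of \<open>\<phi>0\<close> lies above \<open>\<phi>0\<close> and inherits the modulus of \<open>c\<close>, so it
  oscillates by at most \<open>M\<close>. Subtracting its minimum normalizes it. One \<open>\<phi>\<close> serves for all
  marginals.
\<close>
lemma normalize_admissible_pair:
  assumes p: "p \<in> dual_admissible S c"
  obtains \<phi> where "\<phi> \<in> normalized_potentials"
    "\<And>\<mu> \<nu>. \<mu> \<in> prob_measures_on S \<Longrightarrow> \<nu> \<in> prob_measures_on S \<Longrightarrow>
      dual_value \<mu> \<nu> p \<le> potential_value \<mu> \<nu> \<phi>"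
proof -
  obtain \<phi>0 \<psi>0 where p_eq: "p = (\<phi>0, \<psi>0)" by (cases p)
  have cont0: "continuous_on S \<phi>0" "continuous_on S \<psi>0"
    and le0: "\<And>x y. x \<in> S \<Longrightarrow> y \<in> S \<Longrightarrow> \<phi>0 x + \<psi>0 y \<le> c (x, y)"
    using p by (auto simp: p_eq dual_admissible_def)
  obtain B where B: "\<And>y. y \<in> S \<Longrightarrow> \<psi>0 y \<le> B"
    using compact_imp_bounded[OF compact_continuous_image[OF cont0(2) compact_S]]
    by (auto simp: bounded_iff abs_le_iff)
  define \<phi>1 where "\<phi>1 = c_transform S (\<lambda>y x. c (x, y)) \<psi>0"
  have lower: "- B \<le> c (x, y) - \<psi>0 y" if "x \<in> S" "y \<in> S" for x y
    using B[OF that(2)] c_nonneg[OF that] by linarith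
  have \<phi>1_le: "\<phi>1 x \<le> c (x, y) - \<psi>0 y" if "x \<in> S" "y \<in> S" for x y
    unfolding \<phi>1_def using lower that by (intro c_transform_le) auto
  have \<phi>1_ge: "\<phi>0 x \<le> \<phi>1 x" if "x \<in> S" for x
    unfolding \<phi>1_def
  proof (rule c_transform_ge)
    show "\<phi>0 x \<le> c (x, y) - \<psi>0 y" if "y \<in> S" for y using le0[OF \<open>x \<in> S\<close> that] by simp
  qed (rule S_nonempty)
  have diff: "\<phi>1 x - \<phi>1 x' \<le> e" if "x \<in> S" "x' \<in> S" "\<And>y. y \<in> S \<Longrightarrow> c (x, y) - c (x', y) \<le> e" for x x' e
    unfolding \<phi>1_def
  proof (rule c_transform_diff_le)
    show "- B \<le> c (x, y) - \<psi>0 y" if "y \<in> S" for y using lower \<open>x \<in> S\<close> that by blast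
    show "c (x, y) - \<psi>0 y - (c (x', y) - \<psi>0 y) \<le> e" if "y \<in> S" for y
      using \<open>\<And>y. y \<in> S \<Longrightarrow> c (x, y) - c (x', y) \<le> e\<close>[OF that] by simp
  qed (rule S_nonempty)
  have mod1: "cost_modulus \<phi>1"
    unfolding cost_modulus_def
  proof (intro ballI allI impI)
    fix x x' e assume x: "x \<in> S" "x' \<in> S" and e: "\<forall>y\<in>S. \<bar>c (x, y) - c (x', y)\<bar> \<le> e"
    have "\<phi>1 x - \<phi>1 x' \<le> e" using e by (intro diff x) (auto simp: abs_le_iff)
    moreover have "\<phi>1 x' - \<phi>1 x \<le> e" using e by (intro diff x) (auto simp: abs_le_iff)
    ultimately show "\<bar>\<phi>1 x - \<phi>1 x'\<bar> \<le> e" by simp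
  qed
  obtain x0 where x0: "x0 \<in> S" "\<And>x. x \<in> S \<Longrightarrow> \<phi>1 x0 \<le> \<phi>1 x"
    using continuous_attains_inf[OF compact_S S_nonempty cost_modulus_continuous_on[OF mod1]] by blast
  define m where "m = \<phi>1 x0"
  define \<phi> where "\<phi> x = \<phi>1 x - m" for x
  have "\<phi> x \<le> M" if x: "x \<in> S" for x
    unfolding \<phi>_def m_def
  proof (rule diff[OF x x0(1)])
    show "c (x, y) - c (x0, y) \<le> M" if "y \<in> S" for y
      using c_le[OF x that] c_nonneg[OF x0(1) that] by simp
  qed
  moreover have "cost_modulus \<phi>" using mod1 by (simp add: cost_modulus_def \<phi>_def)
  ultimately have K: "\<phi> \<in> normalized_potentials"
    using x0 by (auto simp: normalized_potentials_def \<phi>_def m_def)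
  have conj: "\<psi>0 y + m \<le> conj_potential \<phi> y" if "y \<in> S" for y
  proof (rule conj_potential_ge)
    show "\<psi>0 y + m \<le> c (x, y) - \<phi> x" if "x \<in> S" for x
      using \<phi>1_le[OF that \<open>y \<in> S\<close>] by (simp add: \<phi>_def)
  qed
  have "dual_value \<mu> \<nu> p \<le> potential_value \<mu> \<nu> \<phi>"
    if \<mu>: "\<mu> \<in> prob_measures_on S" and \<nu>: "\<nu> \<in> prob_measures_on S" for \<mu> \<nu>
  proof -
    interpret \<mu>: prob_space \<mu> using \<mu> by (rule prob_measures_onD)
    interpret \<nu>: prob_space \<nu> using \<nu> by (rule prob_measures_onD)
    note int_\<mu> = continuous_on_integrable_prob_measures_on[OF \<mu> compact_S]
      and int_\<nu> = continuous_on_integrable_prob_measures_on[OF \<nu> compact_S]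
    have cont: "continuous_on S \<phi>" "continuous_on S (conj_potential \<phi>)"
      using normalized_potentialsD[OF K] by (auto simp: dual_admissible_def)
    have "(\<integral>x. \<phi>0 x \<partial>\<mu>) \<le> (\<integral>x. \<phi> x + m \<partial>\<mu>)"
      using \<phi>1_ge cont cont0 cost_modulus_continuous_on[OF mod1]
      by (intro integral_mono int_\<mu>) (auto simp: \<phi>_def prob_measures_onD(3)[OF \<mu>] intro!: continuous_intros)
    also have "\<dots> = (\<integral>x. \<phi> x \<partial>\<mu>) + m" using int_\<mu>[OF cont(1)] by (simp add: \<mu>.prob_space)
    finally have 1: "(\<integral>x. \<phi>0 x \<partial>\<mu>) \<le> (\<integral>x. \<phi> x \<partial>\<mu>) + m" .
    have "(\<integral>y. \<psi>0 y \<partial>\<nu>) + m = (\<integral>y. \<psi>0 y + m \<partial>\<nu>)" using int_\<nu>[OF cont0(2)] by (simp add: \<nu>.prob_space)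
    also have "\<dots> \<le> (\<integral>y. conj_potential \<phi> y \<partial>\<nu>)"
      using conj cont cont0
      by (intro integral_mono int_\<nu>) (auto simp: prob_measures_onD(3)[OF \<nu>] intro!: continuous_intros)
    finally show ?thesis using 1 by (simp add: p_eq dual_value_def potential_value_def)
  qed
  with K show thesis by (rule that)
qed

lemma potential_value_diff_le:
  assumes \<mu>: "\<mu> \<in> prob_measures_on S" and \<nu>: "\<nu> \<in> prob_measures_on S"
    and \<phi>: "\<phi> \<in> normalized_potentials" "\<phi>' \<in> normalized_potentials"
    and close: "\<And>x. x \<in> S \<Longrightarrow> \<bar>\<phi> x - \<phi>' x\<bar> \<le> e"
  shows "potential_value \<mu> \<nu> \<phi> - potential_value \<mu> \<nu> \<phi>' \<le> 2 * e"
proof -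
  interpret \<mu>: prob_space \<mu> using \<mu> by (rule prob_measures_onD)
  interpret \<nu>: prob_space \<nu> using \<nu> by (rule prob_measures_onD)
  note int_\<mu> = continuous_on_integrable_prob_measures_on[OF \<mu> compact_S]
    and int_\<nu> = continuous_on_integrable_prob_measures_on[OF \<nu> compact_S]
  have cont: "continuous_on S \<phi>" "continuous_on S \<phi>'" "continuous_on S (conj_potential \<phi>)"
      "continuous_on S (conj_potential \<phi>')"
    using normalized_potentialsD[OF \<phi>(1)] normalized_potentialsD[OF \<phi>(2)] by (auto simp: dual_admissible_def)
  have conj: "conj_potential \<phi> y - conj_potential \<phi>' y \<le> e" if y: "y \<in> S" for y
    unfolding conj_potential_def
  proof (rule c_transform_diff_le)
    show "- M \<le> c (x, y) - \<phi> x" if "x \<in> S" for x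
      using normalized_potentialsD(3)[OF \<phi>(1) that] c_nonneg[OF that y] by simp
    show "c (x, y) - \<phi> x - (c (x, y) - \<phi>' x) \<le> e" if "x \<in> S" for x
      using close[OF that] by (simp add: abs_le_iff)
  qed (rule S_nonempty)
  have "(\<integral>x. \<phi> x \<partial>\<mu>) \<le> (\<integral>x. \<phi>' x + e \<partial>\<mu>)"
    using close cont
    by (intro integral_mono int_\<mu>) (auto simp: prob_measures_onD(3)[OF \<mu>] abs_le_iff algebra_simps intro!: continuous_intros)
  moreover have "(\<integral>y. conj_potential \<phi> y \<partial>\<nu>) \<le> (\<integral>y. conj_potential \<phi>' y + e \<partial>\<nu>)"
    using conj cont
    by (intro integral_mono int_\<nu>) (auto simp: prob_measures_onD(3)[OF \<nu>] algebra_simps intro!: continuous_intros)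
  ultimately show ?thesis
    using int_\<mu>[OF cont(2)] int_\<nu>[OF cont(4)]
    by (simp add: potential_value_def dual_value_def \<mu>.prob_space \<nu>.prob_space)
qed

text \<open>
  Arzela-Ascoli; both defining conditions survive pointwise limits.
\<close>
lemma normalized_potentials_seq_compact:
  fixes \<phi> :: "nat \<Rightarrow> 'a \<Rightarrow> real"
  assumes \<phi>: "\<And>n. \<phi> n \<in> normalized_potentials"
  obtains g r where "g \<in> normalized_potentials" "strict_mono (r :: nat \<Rightarrow> nat)"
    "uniform_limit S (\<lambda>n. \<phi> (r n)) g sequentially"
proof -
  have "\<exists>d>0. \<forall>n y. y \<in> S \<and> norm (x - y) < d \<longrightarrow> norm (\<phi> n x - \<phi> n y) < e"
    if "x \<in> S" "0 < e" for x e
  proof -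
    from cost_equicontinuous[OF that(2)] obtain d where d: "d > 0"
      "\<And>\<phi> x x'. cost_modulus \<phi> \<Longrightarrow> x \<in> S \<Longrightarrow> x' \<in> S \<Longrightarrow> dist x x' < d \<Longrightarrow> \<bar>\<phi> x - \<phi> x'\<bar> < e"
      by metis
    moreover have "cost_modulus (\<phi> n)" for n using \<phi> by (simp add: normalized_potentials_def)
    ultimately show ?thesis using that(1) by (intro exI[of _ d]) (simp add: dist_norm)
  qed
  moreover have "norm (\<phi> n x) \<le> M" if "x \<in> S" for n x
    using normalized_potentialsD(2,3)[OF \<phi>, of x n] that by simp
  ultimately obtain g r where r: "strict_mono (r :: nat \<Rightarrow> nat)"
    and g: "\<And>e. 0 < e \<Longrightarrow> \<exists>N. \<forall>n x. n \<ge> N \<and> x \<in> S \<longrightarrow> norm (\<phi> (r n) x - g x) < e"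
    using Arzela_Ascoli[OF compact_S, of \<phi> M] by metis
  have unif: "uniform_limit S (\<lambda>n. \<phi> (r n)) g sequentially"
    unfolding uniform_limit_sequentially_iff dist_norm using g by blast
  have lim: "(\<lambda>n. \<phi> (r n) x) \<longlonglongrightarrow> g x" if "x \<in> S" for x
    using unif that by (rule tendsto_uniform_limitI)
  have "0 \<le> g x" "g x \<le> M" if "x \<in> S" for x
    using normalized_potentialsD(2,3)[OF \<phi> that]
    by (auto intro!: LIMSEQ_le_const[OF lim[OF that]] LIMSEQ_le_const2[OF lim[OF that]])
  moreover have "cost_modulus g"
    unfolding cost_modulus_def
  proof (intro ballI allI impI)
    fix x x' e assume x: "x \<in> S" "x' \<in> S" and e: "\<forall>y\<in>S. \<bar>c (x, y) - c (x', y)\<bar> \<le> e"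
    have "(\<lambda>n. \<bar>\<phi> (r n) x - \<phi> (r n) x'\<bar>) \<longlonglongrightarrow> \<bar>g x - g x'\<bar>"
      by (intro tendsto_intros lim x)
    moreover have "\<bar>\<phi> (r n) x - \<phi> (r n) x'\<bar> \<le> e" for n
      using \<phi>[of "r n"] x e unfolding normalized_potentials_def cost_modulus_def by blast
    ultimately show "\<bar>g x - g x'\<bar> \<le> e" by (auto intro: LIMSEQ_le_const2)
  qed
  ultimately have "g \<in> normalized_potentials" by (simp add: normalized_potentials_def)
  then show thesis using r unif by (rule that)
qed

lemma dual_value_le_transport_cost:
  assumes \<mu>: "\<mu> \<in> prob_measures_on S" and \<nu>: "\<nu> \<in> prob_measures_on S"
    and p: "p \<in> dual_admissible S c"
  shows "dual_value \<mu> \<nu> p \<le> transport_cost S c \<mu> \<nu>"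
  unfolding transport_cost_def
proof (rule cINF_greatest)
  show "couplings S \<mu> \<nu> \<noteq> {}"
    using kantorovich_approximate_duality[OF compact_S \<mu> \<nu> continuous_c zero_less_one] by blast
qed (rule dual_value_le_coupling[OF compact_S continuous_c _ p])

lemma potential_value_tendsto:
  assumes \<mu>: "\<mu> \<in> prob_measures_on S" and \<nu>: "\<nu> \<in> prob_measures_on S"
    and \<phi>: "\<And>n. \<phi> n \<in> normalized_potentials" "g \<in> normalized_potentials"
    and unif: "uniform_limit S \<phi> g sequentially"
  shows "(\<lambda>n. potential_value \<mu> \<nu> (\<phi> n)) \<longlonglongrightarrow> potential_value \<mu> \<nu> g"
proof (rule LIMSEQ_I)
  fix e :: real assume "e > 0"
  then have "e / 4 > 0" by simp
  with unif obtain N where N: "\<And>n x. n \<ge> N \<Longrightarrow> x \<in> S \<Longrightarrow> dist (\<phi> n x) (g x) < e / 4"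
    unfolding uniform_limit_sequentially_iff by blast
  have "norm (potential_value \<mu> \<nu> (\<phi> n) - potential_value \<mu> \<nu> g) < e" if "n \<ge> N" for n
  proof -
    have "\<bar>\<phi> n x - g x\<bar> \<le> e / 4" "\<bar>g x - \<phi> n x\<bar> \<le> e / 4" if "x \<in> S" for x
      using N[OF \<open>n \<ge> N\<close> that] unfolding dist_real_def by linarith+
    then show ?thesis
      using potential_value_diff_le[OF \<mu> \<nu> \<phi>(1)[of n] \<phi>(2), of "e / 4"]
        potential_value_diff_le[OF \<mu> \<nu> \<phi>(2) \<phi>(1)[of n], of "e / 4"] \<open>e > 0\<close> by (auto simp: abs_less_iff)
  qed
  then show "\<exists>N. \<forall>n\<ge>N. norm (potential_value \<mu> \<nu> (\<phi> n) - potential_value \<mu> \<nu> g) < e" by blast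
qed

lemma potential_value_le_transport_cost:
  assumes "\<mu> \<in> prob_measures_on S" "\<nu> \<in> prob_measures_on S" "\<phi> \<in> normalized_potentials"
  shows "potential_value \<mu> \<nu> \<phi> \<le> transport_cost S c \<mu> \<nu>"
  unfolding potential_value_def
  using assms normalized_potentialsD(4) by (intro dual_value_le_transport_cost) auto

text \<open>
  Pairs that are optimal up to \<open>1 / n\<close> can be taken normalized, and a uniform limit of them is optimal.
\<close>
theorem kantorovich_duality:
  assumes \<mu>: "\<mu> \<in> prob_measures_on S" and \<nu>: "\<nu> \<in> prob_measures_on S"
  obtains \<phi> where "\<phi> \<in> normalized_potentials" "potential_value \<mu> \<nu> \<phi> = transport_cost S c \<mu> \<nu>"
proof -
  have "\<exists>\<phi>\<in>normalized_potentials. transport_cost S c \<mu> \<nu> - e \<le> potential_value \<mu> \<nu> \<phi>" if "e > 0" for e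
  proof -
    from kantorovich_approximate_duality[OF compact_S \<mu> \<nu> continuous_c that] obtain \<gamma> p
      where \<gamma>: "\<gamma> \<in> couplings S \<mu> \<nu>" and p: "p \<in> dual_admissible S c"
        and gap: "(\<integral>z. c z \<partial>\<gamma>) \<le> dual_value \<mu> \<nu> p + e" by blast
    have "transport_cost S c \<mu> \<nu> \<le> (\<integral>z. c z \<partial>\<gamma>)"
      unfolding transport_cost_def
    proof (rule cINF_lower[OF _ \<gamma>], rule bdd_belowI2)
      show "dual_value \<mu> \<nu> p \<le> (\<integral>z. c z \<partial>\<gamma>')" if "\<gamma>' \<in> couplings S \<mu> \<nu>" for \<gamma>'
        using dual_value_le_coupling[OF compact_S continuous_c that p] .
    qed
    moreover obtain \<phi> where "\<phi> \<in> normalized_potentials" "dual_value \<mu> \<nu> p \<le> potential_value \<mu> \<nu> \<phi>"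
      using normalize_admissible_pair[OF p] \<mu> \<nu> by metis
    ultimately show ?thesis using gap by (intro bexI[of _ \<phi>]) simp_all
  qed
  then have "\<forall>n. \<exists>\<phi>. \<phi> \<in> normalized_potentials \<and>
      transport_cost S c \<mu> \<nu> - 1 / real (Suc n) \<le> potential_value \<mu> \<nu> \<phi>"
    by (metis divide_pos_pos of_nat_0_less_iff zero_less_Suc zero_less_one)
  then obtain \<phi> where \<phi>: "\<And>n. \<phi> n \<in> normalized_potentials"
    "\<And>n. transport_cost S c \<mu> \<nu> - 1 / real (Suc n) \<le> potential_value \<mu> \<nu> (\<phi> n)" by metis
  obtain g r where g: "g \<in> normalized_potentials" and r: "strict_mono (r :: nat \<Rightarrow> nat)"
    and unif: "uniform_limit S (\<lambda>n. \<phi> (r n)) g sequentially"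
    using normalized_potentials_seq_compact[of \<phi>, OF \<phi>(1)] .
  have "(\<lambda>n. transport_cost S c \<mu> \<nu> - 1 / real (Suc n)) \<longlonglongrightarrow> transport_cost S c \<mu> \<nu> - 0"
    using LIMSEQ_inverse_real_of_nat by (intro tendsto_intros) (simp add: inverse_eq_divide)
  from LIMSEQ_subseq_LIMSEQ[OF this r]
  have "(\<lambda>n. transport_cost S c \<mu> \<nu> - 1 / real (Suc (r n))) \<longlonglongrightarrow> transport_cost S c \<mu> \<nu>"
    by (simp add: o_def)
  moreover have "(\<lambda>n. potential_value \<mu> \<nu> (\<phi> (r n))) \<longlonglongrightarrow> potential_value \<mu> \<nu> g"
    using potential_value_tendsto[OF \<mu> \<nu> \<phi>(1) g unif] .
  ultimately have "transport_cost S c \<mu> \<nu> \<le> potential_value \<mu> \<nu> g"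
    using \<phi>(2) by (intro LIMSEQ_le) auto
  moreover have "potential_value \<mu> \<nu> g \<le> transport_cost S c \<mu> \<nu>"
    using \<mu> \<nu> g by (rule potential_value_le_transport_cost)
  ultimately show thesis using g by (intro that[of g]) auto
qed

text \<open>
  A Kantorovich potential is only required to be a best admissible pair; since some admissible pair
  attains the transport cost, so does every best one.
\<close>
lemma kantorovich_potentials_value:
  assumes \<mu>: "\<mu> \<in> prob_measures_on S" and \<nu>: "\<nu> \<in> prob_measures_on S"
    and p: "p \<in> kantorovich_potentials S c \<mu> \<nu>"
  shows "p \<in> dual_admissible S c" "dual_value \<mu> \<nu> p = transport_cost S c \<mu> \<nu>"
proof -
  show adm: "p \<in> dual_admissible S c" using p by (simp add: kantorovich_potentials_def)
  obtain \<phi> where \<phi>: "\<phi> \<in> normalized_potentials" "potential_value \<mu> \<nu> \<phi> = transport_cost S c \<mu> \<nu>"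
    using kantorovich_duality[OF \<mu> \<nu>] .
  then have "transport_cost S c \<mu> \<nu> \<le> dual_value \<mu> \<nu> p"
    using p normalized_potentialsD(4)[OF \<phi>(1)] by (auto simp: kantorovich_potentials_def potential_value_def)
  then show "dual_value \<mu> \<nu> p = transport_cost S c \<mu> \<nu>"
    using dual_value_le_transport_cost[OF \<mu> \<nu> adm] by simp
qed

end

section \<open>Directional derivatives of the transport cost\<close>

text \<open>
  The gradient is given by a definite description, which denotes because a linear functional on a
  Euclidean space is an inner product with a unique vector.
\<close>
lemma gradient_has_derivative:
  fixes f :: "'b::euclidean_space \<Rightarrow> real"
  assumes "f differentiable (at x)"
  shows "(f has_derivative (\<lambda>v. gradient f x \<bullet> v)) (at x)"
proof -
  obtain f' where f': "(f has_derivative f') (at x)" using assms by (auto simp: differentiable_def)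
  then have "linear f'" by (rule has_derivative_linear)
  then have "f' = (\<lambda>v. v \<bullet> adjoint f' 1)" by (simp add: adjoint_works)
  with f' have D: "GDERIV f x :> adjoint f' 1" by (simp add: gderiv_def)
  have "gradient f x = adjoint f' 1"
    unfolding gradient_def
  proof (rule the_equality)
    show "GDERIV f x :> adjoint f' 1" by (rule D)
    fix D' assume "GDERIV f x :> D'"
    then have "(\<lambda>v. v \<bullet> D') = (\<lambda>v. v \<bullet> adjoint f' 1)"
      using D unfolding gderiv_def by (rule has_derivative_unique)
    then show "D' = adjoint f' 1" by (metis vector_eq_ldot)
  qed
  then show ?thesis using D by (simp add: gderiv_def inner_commute)
qed

lemma has_derivative_imp_has_directional_derivative:
  assumes "(f has_derivative f') (at x)"
  shows "has_directional_derivative f x v (f' v)"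
proof -
  have "((\<lambda>t. x + t *\<^sub>R v) has_derivative (\<lambda>t. t *\<^sub>R v)) (at 0)"
    by (auto intro!: derivative_eq_intros)
  moreover have "(f has_derivative f') (at (x + 0 *\<^sub>R v))" using assms by simp
  ultimately have "((\<lambda>t. f (x + t *\<^sub>R v)) has_derivative (\<lambda>t. f' (t *\<^sub>R v))) (at 0)"
    by (rule has_derivative_compose)
  moreover have "f' (t *\<^sub>R v) = f' v * t" for t
    using linear_scale[OF has_derivative_linear[OF assms]] by simp
  ultimately have "((\<lambda>t. f (x + t *\<^sub>R v)) has_real_derivative f' v) (at 0)"
    by (simp add: has_field_derivative_def)
  then have "((\<lambda>h. (f (x + h *\<^sub>R v) - f x) / h) \<longlongrightarrow> f' v) (at 0)"
    by (simp add: DERIV_def)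
  then show ?thesis
    unfolding has_directional_derivative_def by (rule filterlim_mono) (simp_all add: at_le)
qed

lemma has_directional_derivative_unique:
  assumes "has_directional_derivative f x v l" "has_directional_derivative f x v l'"
  shows "l = l'"
  using assms unfolding has_directional_derivative_def
  by (intro tendsto_unique[OF trivial_limit_at_right_real])

lemma gateaux_gradient_eqI:
  assumes "\<And>v. has_directional_derivative f x v (g \<bullet> v)"
  shows "gateaux_gradient f x = g"
  unfolding gateaux_gradient_def
proof (rule the_equality)
  fix g' assume "\<forall>v. has_directional_derivative f x v (g' \<bullet> v)"
  then have "g' \<bullet> v = g \<bullet> v" for v
    using assms by (intro has_directional_derivative_unique[of f x v]) auto
  then show "g' = g" by (metis vector_eq_rdot)
qed (use assms in auto)

text \<open>
  Completeness of Lebesgue measure is essential: \<open>g\<close> is arbitrary on the exceptional null set. The lemma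
  serves for \<open>x \<mapsto> \<nabla>\<rho>(x, \<theta>)\<close>, which is a limit of difference quotients only almost everywhere.
\<close>
lemma borel_measurable_lebesgue_on_AE_limit:
  fixes g :: "'a::euclidean_space \<Rightarrow> 'c::euclidean_space"
  assumes S: "S \<in> sets lebesgue" and f: "\<And>n. f n \<in> borel_measurable (lebesgue_on S)"
    and lim: "AE x in lebesgue_on S. (\<lambda>n. f n x) \<longlonglongrightarrow> g x"
  shows "g \<in> borel_measurable (lebesgue_on S)"
proof -
  have "(\<lambda>x. lim (\<lambda>n. f n x)) \<in> borel_measurable (lebesgue_on S)"
    using f by measurable
  then have "(\<lambda>x. if x \<in> S then lim (\<lambda>n. f n x) else 0) \<in> borel_measurable lebesgue"
    using S by (simp add: borel_measurable_if)
  moreover have "AE x in lebesgue_on S. lim (\<lambda>n. f n x) = g x"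
    using lim by eventually_elim (rule limI)
  then have "AE x in lebesgue. (if x \<in> S then lim (\<lambda>n. f n x) else 0) = (if x \<in> S then g x else 0)"
    using S by (auto simp: AE_restrict_space_iff elim!: eventually_mono)
  ultimately have "(\<lambda>x. if x \<in> S then g x else 0) \<in> borel_measurable lebesgue"
    by (rule borel_measurable_AE)
  then show ?thesis using S by (simp add: borel_measurable_if)
qed

text \<open>
  The measure lives on the Borel sets while its density is only Lebesgue measurable, so \<open>M\<close> is
  recovered as the push-forward of a measure on the Lebesgue sets under the identity map.
\<close>
lemma has_density_on_integral:
  fixes S :: "'a::euclidean_space set" and \<phi> :: "'a \<Rightarrow> real"
  assumes M: "M \<in> prob_measures_on S" and g: "has_density_on S M g"
    and \<phi>: "\<phi> \<in> borel_measurable (restrict_space borel S)"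
  shows "integrable M \<phi> \<longleftrightarrow> integrable (lebesgue_on S) (\<lambda>x. \<phi> x * g x)"
    "(\<integral>x. \<phi> x \<partial>M) = (\<integral>x. \<phi> x * g x \<partial>lebesgue_on S)"
proof -
  let ?L = "lebesgue_on S" and ?R = "restrict_space borel S"
  have g': "g \<in> borel_measurable ?L" "AE x in ?L. 0 \<le> g x"
    and dens: "\<And>A. A \<in> sets M \<Longrightarrow> emeasure M A = (\<integral>\<^sup>+x\<in>A. ennreal (g x) \<partial>?L)"
    using g by (auto simp: has_density_on_def)
  have "(\<lambda>x. x) \<in> ?L \<rightarrow>\<^sub>M borel" using id_borel_measurable_lebesgue_on[of S] by (simp add: id_def)
  then have id: "(\<lambda>x. x) \<in> ?L \<rightarrow>\<^sub>M ?R" by (intro measurable_restrict_space2) auto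
  have \<phi>': "\<phi> \<in> borel_measurable ?L" using measurable_compose[OF id \<phi>] .
  have M_eq: "M = distr (density ?L g) ?R (\<lambda>x. x)"
  proof (rule measure_eqI)
    show "sets M = sets (distr (density ?L g) ?R (\<lambda>x. x))"
      using prob_measures_onD(2)[OF M] by simp
    fix A assume "A \<in> sets M"
    then have A: "A \<in> sets ?R" using prob_measures_onD(2)[OF M] by simp
    have "A \<inter> space ?L \<in> sets ?L" using measurable_sets[OF id A] by (simp add: vimage_def Int_def)
    then show "emeasure M A = emeasure (distr (density ?L g) ?R (\<lambda>x. x)) A"
      using id A g' dens[OF \<open>A \<in> sets M\<close>]
      by (subst emeasure_distr) (auto simp: emeasure_density indicator_def intro!: nn_integral_cong)
  qed
  show "integrable M \<phi> \<longleftrightarrow> integrable ?L (\<lambda>x. \<phi> x * g x)"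
    using id \<phi> \<phi>' g' by (simp add: M_eq integrable_distr_eq integrable_density mult.commute)
  show "(\<integral>x. \<phi> x \<partial>M) = (\<integral>x. \<phi> x * g x \<partial>?L)"
    using id \<phi> \<phi>' g' by (simp add: M_eq integral_distr integral_density mult.commute)
qed

lemma filterlim_at_right_0I:
  fixes X :: "nat \<Rightarrow> real"
  assumes "\<And>n. 0 < X n" "X \<longlonglongrightarrow> 0"
  shows "filterlim X (at_right 0) sequentially"
  using assms by (simp add: filterlim_at less_imp_neq[THEN not_sym])

locale transport_family = transport_problem S c M
  for S :: "'a::euclidean_space set" and c :: "'a \<times> 'a \<Rightarrow> real" and M :: real +
  fixes \<nu> :: "'a measure" and \<Theta> :: "'b::euclidean_space set" and \<mu> :: "'b \<Rightarrow> 'a measure"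
    and \<rho> :: "'a \<Rightarrow> 'b \<Rightarrow> real" and \<eta> :: "'a \<Rightarrow> real" and f :: "'b \<Rightarrow> real"
  assumes \<nu>: "\<nu> \<in> prob_measures_on S" and open_\<Theta>: "open \<Theta>"
    and \<mu>: "\<And>\<theta>. \<theta> \<in> \<Theta> \<Longrightarrow> \<mu> \<theta> \<in> prob_measures_on S"
    and density: "\<And>\<theta>. \<theta> \<in> \<Theta> \<Longrightarrow> has_density_on S (\<mu> \<theta>) (\<lambda>x. \<rho> x \<theta>)"
    and integrable_\<eta>: "integrable (lebesgue_on S) \<eta>"
    and gradient_bound: "AE x in lebesgue_on S. \<forall>\<theta>\<in>\<Theta>.
      \<rho> x differentiable (at \<theta>) \<and> norm (gradient (\<rho> x) \<theta>) \<le> \<eta> x"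
    and f: "\<And>\<theta>. \<theta> \<in> \<Theta> \<Longrightarrow> f \<theta> = transport_cost S c (\<mu> \<theta>) \<nu>"
begin

abbreviation "L \<equiv> lebesgue_on S"

definition slope :: "('a \<Rightarrow> real) \<Rightarrow> 'b \<Rightarrow> 'b" where
  "slope \<phi> \<theta> = (\<integral>x. \<phi> x *\<^sub>R gradient (\<rho> x) \<theta> \<partial>L)"

definition optimal_potentials :: "'b \<Rightarrow> ('a \<Rightarrow> real) set" where
  "optimal_potentials \<theta> = {\<phi>\<in>normalized_potentials. potential_value (\<mu> \<theta>) \<nu> \<phi> = f \<theta>}"

lemma S_lebesgue: "S \<in> sets lebesgue"
  using compact_S by (simp add: compact_imp_closed)

lemma continuous_on_measurable_L: "continuous_on S \<phi> \<Longrightarrow> \<phi> \<in> borel_measurable L"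
  for \<phi> :: "'a \<Rightarrow> real"
  using S_lebesgue by (rule continuous_imp_measurable_on_sets_lebesgue[rotated])

lemma density_integral:
  assumes "\<theta> \<in> \<Theta>" "continuous_on S \<phi>"
  shows "integrable L (\<lambda>x. \<phi> x * \<rho> x \<theta>)" "(\<integral>x. \<phi> x \<partial>\<mu> \<theta>) = (\<integral>x. \<phi> x * \<rho> x \<theta> \<partial>L)"
  using has_density_on_integral[OF \<mu>[OF assms(1)] density[OF assms(1)]
      borel_measurable_continuous_on_restrict[OF assms(2)]]
    continuous_on_integrable_prob_measures_on[OF \<mu>[OF assms(1)] compact_S assms(2)] by auto

lemma measurable_density: "\<theta> \<in> \<Theta> \<Longrightarrow> (\<lambda>x. \<rho> x \<theta>) \<in> borel_measurable L"
  using density by (simp add: has_density_on_def)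

lemma dual_value_diff:
  assumes "\<theta> \<in> \<Theta>" "\<theta>' \<in> \<Theta>" "continuous_on S (fst p)"
  shows "dual_value (\<mu> \<theta>) \<nu> p - dual_value (\<mu> \<theta>') \<nu> p = (\<integral>x. fst p x * (\<rho> x \<theta> - \<rho> x \<theta>') \<partial>L)"
    "integrable L (\<lambda>x. fst p x * (\<rho> x \<theta> - \<rho> x \<theta>'))"
  using density_integral[OF assms(1,3)] density_integral[OF assms(2,3)]
  by (simp_all add: dual_value_def right_diff_distrib)

text \<open>
  Mean value inequality on a convex set.
\<close>
lemma density_lipschitz:
  assumes "\<forall>\<theta>\<in>\<Theta>. \<rho> x differentiable (at \<theta>) \<and> norm (gradient (\<rho> x) \<theta>) \<le> \<eta> x"
    and T: "convex T" "T \<subseteq> \<Theta>" "\<theta> \<in> T" "\<theta>' \<in> T"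
  shows "\<bar>\<rho> x \<theta> - \<rho> x \<theta>'\<bar> \<le> \<eta> x * norm (\<theta> - \<theta>')"
proof -
  have "norm (\<rho> x \<theta> - \<rho> x \<theta>') \<le> \<eta> x * norm (\<theta> - \<theta>')"
  proof (rule differentiable_bound[OF T(1) _ _ T(3,4)])
    fix \<xi> assume "\<xi> \<in> T"
    then have *: "\<rho> x differentiable (at \<xi>)" "norm (gradient (\<rho> x) \<xi>) \<le> \<eta> x" using assms T by auto
    show "(\<rho> x has_derivative (\<lambda>v. gradient (\<rho> x) \<xi> \<bullet> v)) (at \<xi> within T)"
      using gradient_has_derivative[OF *(1)] by (rule has_derivative_at_withinI)
    show "onorm (\<lambda>v. gradient (\<rho> x) \<xi> \<bullet> v) \<le> \<eta> x"
    proof (rule onorm_le)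
      fix v
      have "norm (gradient (\<rho> x) \<xi> \<bullet> v) \<le> norm (gradient (\<rho> x) \<xi>) * norm v"
        by (simp add: Cauchy_Schwarz_ineq2)
      also have "\<dots> \<le> \<eta> x * norm v" using *(2) by (intro mult_right_mono) auto
      finally show "norm (gradient (\<rho> x) \<xi> \<bullet> v) \<le> \<eta> x * norm v" .
    qed
  qed
  then show ?thesis by simp
qed

lemma density_quotient_tendsto:
  assumes "\<forall>\<theta>\<in>\<Theta>. \<rho> x differentiable (at \<theta>) \<and> norm (gradient (\<rho> x) \<theta>) \<le> \<eta> x" and "\<theta> \<in> \<Theta>"
    and X: "filterlim X (at_right 0) sequentially"
  shows "(\<lambda>n. (\<rho> x (\<theta> + X n *\<^sub>R v) - \<rho> x \<theta>) / X n) \<longlonglongrightarrow> gradient (\<rho> x) \<theta> \<bullet> v"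
  using has_derivative_imp_has_directional_derivative[OF gradient_has_derivative, of "\<rho> x" \<theta> v] assms
  unfolding has_directional_derivative_def by (auto intro: filterlim_compose)

lemma ball_direction:
  assumes "0 < t" "t < r / (norm v + 1)"
  shows "\<theta> + t *\<^sub>R v \<in> ball \<theta> r"
proof -
  have "t * norm v \<le> t * (norm v + 1)" using assms by (intro mult_left_mono) auto
  also have "\<dots> < r" using assms by (simp add: pos_less_divide_eq add_nonneg_pos)
  finally show ?thesis using assms by (simp add: dist_norm)
qed

lemma shrinking_sequence:
  assumes "d > 0"
  obtains X :: "nat \<Rightarrow> real" where "\<And>n. 0 < X n" "\<And>n. X n < d" "filterlim X (at_right 0) sequentially"
proof -
  define X where "X n = (d / 2) * inverse (real (Suc n))" for n
  have lim: "X \<longlonglongrightarrow> (d / 2) * 0"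
    unfolding X_def[abs_def] by (intro tendsto_intros LIMSEQ_inverse_real_of_nat)
  have X: "0 < X n" "X n < d" for n
  proof -
    show "0 < X n" using assms by (simp add: X_def)
    have "inverse (real (Suc n)) \<le> 1" by (simp add: inverse_le_1_iff)
    then have "X n \<le> (d / 2) * 1" unfolding X_def using assms by (intro mult_left_mono) auto
    then show "X n < d" using assms by simp
  qed
  then have "filterlim X (at_right 0) sequentially"
    using lim by (intro filterlim_at_right_0I) simp_all
  with X show thesis by (rule that)
qed

lemma measurable_gradient:
  assumes \<theta>: "\<theta> \<in> \<Theta>"
  shows "(\<lambda>x. gradient (\<rho> x) \<theta>) \<in> borel_measurable L"
proof (rule borel_measurable_euclidean_space[THEN iffD2], rule ballI)
  fix v :: 'b
  obtain r where r: "r > 0" "ball \<theta> r \<subseteq> \<Theta>" by (rule openE[OF open_\<Theta> \<theta>])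
  then have "r / (norm v + 1) > 0" by (simp add: add_nonneg_pos)
  then obtain X where X: "\<And>n. 0 < X n" "\<And>n. X n < r / (norm v + 1)"
      "filterlim X (at_right 0) sequentially"
    using shrinking_sequence by blast
  have "\<theta> + X n *\<^sub>R v \<in> \<Theta>" for n using ball_direction[OF X(1)[of n] X(2)[of n], of \<theta>] r by blast
  then have "(\<lambda>x. (\<rho> x (\<theta> + X n *\<^sub>R v) - \<rho> x \<theta>) / X n) \<in> borel_measurable L" for n
    using measurable_density \<theta> by measurable
  moreover have "AE x in L. (\<lambda>n. (\<rho> x (\<theta> + X n *\<^sub>R v) - \<rho> x \<theta>) / X n) \<longlonglongrightarrow> gradient (\<rho> x) \<theta> \<bullet> v"
    using gradient_bound by eventually_elim (rule density_quotient_tendsto[OF _ \<theta> X(3)])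
  ultimately show "(\<lambda>x. gradient (\<rho> x) \<theta> \<bullet> v) \<in> borel_measurable L"
    by (rule borel_measurable_lebesgue_on_AE_limit[OF S_lebesgue])
qed

lemma integrable_slope:
  assumes \<theta>: "\<theta> \<in> \<Theta>" and \<phi>: "continuous_on S \<phi>"
  shows "integrable L (\<lambda>x. \<phi> x *\<^sub>R gradient (\<rho> x) \<theta>)"
proof -
  obtain B where B: "\<And>x. x \<in> S \<Longrightarrow> \<bar>\<phi> x\<bar> \<le> B"
    using compact_imp_bounded[OF compact_continuous_image[OF \<phi> compact_S]] by (auto simp: bounded_iff)
  have bound: "AE x in L. norm (\<phi> x *\<^sub>R gradient (\<rho> x) \<theta>) \<le> norm (B * \<eta> x)"
    using gradient_bound AE_space
  proof eventually_elim
    case (elim x)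
    then have x: "x \<in> S" "norm (gradient (\<rho> x) \<theta>) \<le> \<eta> x" using \<theta> by auto
    then have "norm (\<phi> x *\<^sub>R gradient (\<rho> x) \<theta>) \<le> B * \<eta> x"
      using B[OF x(1)] by (simp add: mult_mono)
    then show ?case by simp
  qed
  have "integrable L (\<lambda>x. B * \<eta> x)" using integrable_\<eta> by simp
  moreover have "(\<lambda>x. \<phi> x *\<^sub>R gradient (\<rho> x) \<theta>) \<in> borel_measurable L"
    using measurable_gradient[OF \<theta>] continuous_on_measurable_L[OF \<phi>] by measurable
  ultimately show ?thesis using bound by (rule Bochner_Integration.integrable_bound)
qed

lemma slope_inner:
  assumes "\<theta> \<in> \<Theta>" "continuous_on S \<phi>"
  shows "slope \<phi> \<theta> \<bullet> v = (\<integral>x. \<phi> x * (gradient (\<rho> x) \<theta> \<bullet> v) \<partial>L)"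
  unfolding slope_def using integral_inner_left[of v, OF integrable_slope[OF assms]] by simp

text \<open>
  Dominated convergence with majorant \<open>B |v| \<eta>\<close>. The potentials may vary with \<open>n\<close>, as they do for the
  upper bound in Danskin's principle, where each is optimal at a different parameter.
\<close>
lemma dual_quotient_tendsto:
  assumes \<theta>: "\<theta> \<in> \<Theta>" and r: "ball \<theta> r \<subseteq> \<Theta>"
    and X: "\<And>n. 0 < X n" "\<And>n. X n < r / (norm v + 1)" "filterlim X (at_right 0) sequentially"
    and p: "\<And>n. continuous_on S (fst (p n))" "continuous_on S \<phi>"
    and bound: "\<And>n x. x \<in> S \<Longrightarrow> \<bar>fst (p n) x\<bar> \<le> B"
    and lim: "\<And>x. x \<in> S \<Longrightarrow> (\<lambda>n. fst (p n) x) \<longlonglongrightarrow> \<phi> x"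
  shows "(\<lambda>n. (dual_value (\<mu> (\<theta> + X n *\<^sub>R v)) \<nu> (p n) - dual_value (\<mu> \<theta>) \<nu> (p n)) / X n) \<longlonglongrightarrow> slope \<phi> \<theta> \<bullet> v"
proof -
  have in_ball: "\<theta> + X n *\<^sub>R v \<in> ball \<theta> r" for n by (rule ball_direction[OF X(1) X(2)])
  then have in_\<Theta>: "\<theta> + X n *\<^sub>R v \<in> \<Theta>" for n using r by blast
  have "r > 0" using in_ball[of 0] ball_eq_empty[of \<theta> r] by fastforce
  have eq: "(dual_value (\<mu> (\<theta> + X n *\<^sub>R v)) \<nu> (p n) - dual_value (\<mu> \<theta>) \<nu> (p n)) / X n =
      (\<integral>x. fst (p n) x * ((\<rho> x (\<theta> + X n *\<^sub>R v) - \<rho> x \<theta>) / X n) \<partial>L)" for n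
    using dual_value_diff[OF in_\<Theta> \<theta> p(1), of n n] by simp
  have [measurable]: "fst (p n) \<in> borel_measurable L" "\<phi> \<in> borel_measurable L"
    "(\<lambda>x. \<rho> x \<theta>) \<in> borel_measurable L" "(\<lambda>x. \<rho> x (\<theta> + X n *\<^sub>R v)) \<in> borel_measurable L"
    "(\<lambda>x. gradient (\<rho> x) \<theta>) \<in> borel_measurable L" for n
    using p continuous_on_measurable_L measurable_density in_\<Theta> \<theta> measurable_gradient by auto
  have "(\<lambda>n. \<integral>x. fst (p n) x * ((\<rho> x (\<theta> + X n *\<^sub>R v) - \<rho> x \<theta>) / X n) \<partial>L) \<longlonglongrightarrow>
      (\<integral>x. \<phi> x * (gradient (\<rho> x) \<theta> \<bullet> v) \<partial>L)"
  proof (rule integral_dominated_convergence)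
    show "integrable L (\<lambda>x. B * norm v * \<eta> x)" using integrable_\<eta> by simp
    show "AE x in L. (\<lambda>n. fst (p n) x * ((\<rho> x (\<theta> + X n *\<^sub>R v) - \<rho> x \<theta>) / X n)) \<longlonglongrightarrow>
        \<phi> x * (gradient (\<rho> x) \<theta> \<bullet> v)"
      using gradient_bound AE_space
    proof eventually_elim
      case (elim x)
      then show ?case
        by (intro tendsto_mult lim density_quotient_tendsto[OF _ \<theta> X(3)]) auto
    qed
    show "AE x in L. norm (fst (p n) x * ((\<rho> x (\<theta> + X n *\<^sub>R v) - \<rho> x \<theta>) / X n)) \<le> B * norm v * \<eta> x" for n
      using gradient_bound AE_space
    proof eventually_elim
      case (elim x)
      have "\<bar>\<rho> x (\<theta> + X n *\<^sub>R v) - \<rho> x \<theta>\<bar> \<le> \<eta> x * norm (\<theta> + X n *\<^sub>R v - \<theta>)"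
        using in_ball[of n] \<open>r > 0\<close> r elim by (intro density_lipschitz[of _ "ball \<theta> r"]) auto
      also have "\<dots> = \<eta> x * norm v * X n" using X(1)[of n] by simp
      finally have "\<bar>(\<rho> x (\<theta> + X n *\<^sub>R v) - \<rho> x \<theta>) / X n\<bar> \<le> \<eta> x * norm v"
        using X(1)[of n] by (simp add: pos_divide_le_eq)
      moreover have "\<bar>fst (p n) x\<bar> \<le> B" using bound elim by simp
      ultimately have "\<bar>fst (p n) x\<bar> * \<bar>(\<rho> x (\<theta> + X n *\<^sub>R v) - \<rho> x \<theta>) / X n\<bar> \<le> B * (\<eta> x * norm v)"
        by (intro mult_mono) auto
      then show ?case by (simp add: abs_mult mult_ac)
    qed
  qed measurable
  then show ?thesis unfolding eq slope_inner[OF \<theta> p(2)] .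
qed

lemma potential_value_lipschitz:
  assumes T: "convex T" "T \<subseteq> \<Theta>" "\<theta> \<in> T" "\<theta>' \<in> T" and \<phi>: "\<phi> \<in> normalized_potentials"
  shows "\<bar>potential_value (\<mu> \<theta>) \<nu> \<phi> - potential_value (\<mu> \<theta>') \<nu> \<phi>\<bar> \<le> M * (\<integral>x. \<bar>\<eta> x\<bar> \<partial>L) * norm (\<theta> - \<theta>')"
proof -
  have cont: "continuous_on S (fst (\<phi>, conj_potential \<phi>))" using normalized_potentialsD(1)[OF \<phi>] by simp
  have \<theta>: "\<theta> \<in> \<Theta>" "\<theta>' \<in> \<Theta>" using T by auto
  note diff = dual_value_diff[OF \<theta> cont]
  have "\<bar>potential_value (\<mu> \<theta>) \<nu> \<phi> - potential_value (\<mu> \<theta>') \<nu> \<phi>\<bar> = \<bar>\<integral>x. \<phi> x * (\<rho> x \<theta> - \<rho> x \<theta>') \<partial>L\<bar>"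
    using diff(1) by (simp add: potential_value_def)
  also have "\<dots> \<le> (\<integral>x. \<bar>\<phi> x * (\<rho> x \<theta> - \<rho> x \<theta>')\<bar> \<partial>L)" by (rule integral_abs_bound)
  also have "\<dots> \<le> (\<integral>x. M * norm (\<theta> - \<theta>') * \<bar>\<eta> x\<bar> \<partial>L)"
  proof (rule integral_mono_AE)
    show "AE x in L. \<bar>\<phi> x * (\<rho> x \<theta> - \<rho> x \<theta>')\<bar> \<le> M * norm (\<theta> - \<theta>') * \<bar>\<eta> x\<bar>"
      using gradient_bound AE_space
    proof eventually_elim
      case (elim x)
      then have "\<bar>\<rho> x \<theta> - \<rho> x \<theta>'\<bar> \<le> \<eta> x * norm (\<theta> - \<theta>')" using T by (intro density_lipschitz) auto
      also have "\<dots> \<le> \<bar>\<eta> x\<bar> * norm (\<theta> - \<theta>')" by (intro mult_right_mono) auto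
      finally have "\<bar>\<phi> x\<bar> * \<bar>\<rho> x \<theta> - \<rho> x \<theta>'\<bar> \<le> M * (\<bar>\<eta> x\<bar> * norm (\<theta> - \<theta>'))"
        using normalized_potentialsD(2,3)[OF \<phi>, of x] elim by (intro mult_mono) auto
      then show ?case by (simp add: abs_mult mult_ac)
    qed
  qed (use diff(2) integrable_\<eta> in auto)
  finally show ?thesis by (simp add: mult_ac)
qed

lemma potential_value_le_f:
  assumes "\<theta> \<in> \<Theta>" "\<phi> \<in> normalized_potentials"
  shows "potential_value (\<mu> \<theta>) \<nu> \<phi> \<le> f \<theta>"
  unfolding f[OF assms(1)] using \<mu>[OF assms(1)] \<nu> assms(2) by (rule potential_value_le_transport_cost)

lemma optimal_potentials_nonempty:
  assumes "\<theta> \<in> \<Theta>"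
  obtains \<phi> where "\<phi> \<in> optimal_potentials \<theta>"
  using kantorovich_duality[OF \<mu>[OF assms] \<nu>] f[OF assms] by (auto simp: optimal_potentials_def)

lemma M_nonneg: "0 \<le> M"
  using S_nonempty c_nonneg c_le by (meson ex_in_conv order_trans)

text \<open>
  A maximum of functions with a common Lipschitz constant has that constant.
\<close>
lemma f_lipschitz:
  assumes T: "convex T" "T \<subseteq> \<Theta>"
  shows "(M * (\<integral>x. \<bar>\<eta> x\<bar> \<partial>L))-lipschitz_on T f"
proof (rule lipschitz_onI)
  show "0 \<le> M * (\<integral>x. \<bar>\<eta> x\<bar> \<partial>L)" using M_nonneg by simp
  have *: "f \<theta> - f \<theta>' \<le> M * (\<integral>x. \<bar>\<eta> x\<bar> \<partial>L) * norm (\<theta> - \<theta>')" if \<theta>: "\<theta> \<in> T" "\<theta>' \<in> T" for \<theta> \<theta>'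
  proof -
    obtain \<phi> where \<phi>: "\<phi> \<in> normalized_potentials" "potential_value (\<mu> \<theta>) \<nu> \<phi> = f \<theta>"
      using optimal_potentials_nonempty[of \<theta>] \<theta> T by (auto simp: optimal_potentials_def)
    then show ?thesis
      using potential_value_lipschitz[OF T \<theta> \<phi>(1)] potential_value_le_f[OF _ \<phi>(1), of \<theta>'] \<theta> T by auto
  qed
  fix \<theta> \<theta>' assume "\<theta> \<in> T" "\<theta>' \<in> T"
  then show "dist (f \<theta>) (f \<theta>') \<le> M * (\<integral>x. \<bar>\<eta> x\<bar> \<partial>L) * dist \<theta> \<theta>'"
    using *[of \<theta> \<theta>'] *[of \<theta>' \<theta>] by (auto simp: dist_norm norm_minus_commute abs_le_iff)
qed

lemma locally_lipschitz_f: "locally_lipschitz_on \<Theta> f"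
  unfolding locally_lipschitz_on_def
proof
  fix \<theta> assume \<theta>: "\<theta> \<in> \<Theta>"
  obtain r where r: "r > 0" "ball \<theta> r \<subseteq> \<Theta>" by (rule openE[OF open_\<Theta> \<theta>])
  have "(M * (\<integral>x. \<bar>\<eta> x\<bar> \<partial>L))-lipschitz_on (ball \<theta> r \<inter> \<Theta>) f"
    using f_lipschitz[OF convex_ball r(2)] by (rule lipschitz_on_subset) auto
  then show "\<exists>r>0. \<exists>L. L-lipschitz_on (ball \<theta> r \<inter> \<Theta>) f" using r(1) by blast
qed

lemma continuous_on_f: "continuous_on \<Theta> f"
  unfolding continuous_on_eq_continuous_at[OF open_\<Theta>]
proof
  fix \<theta> assume \<theta>: "\<theta> \<in> \<Theta>"
  obtain r where r: "r > 0" "ball \<theta> r \<subseteq> \<Theta>" by (rule openE[OF open_\<Theta> \<theta>])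
  have "continuous_on (ball \<theta> r) f"
    using f_lipschitz[OF convex_ball r(2)] by (rule lipschitz_on_continuous_on)
  then show "continuous (at \<theta>) f" using r(1) by (simp add: continuous_on_eq_continuous_at)
qed

text \<open>
  Along the sequence \<open>\<theta> + X n v\<close>, take optimal potentials \<open>\<psi> n\<close> and a uniformly convergent
  subsequence with limit \<open>g\<close>. Since \<open>f\<close> and the dual values are Lipschitz, \<open>g\<close> is optimal at \<open>\<theta>\<close>. The
  quotients of \<open>f\<close> lie between those of the dual values of the fixed \<open>g\<close> and of the varying \<open>\<psi> n\<close>, and both
  converge to \<open>slope g \<theta> \<bullet> v\<close>.
\<close>
lemma danskin_sequence:
  assumes \<theta>: "\<theta> \<in> \<Theta>" and r: "ball \<theta> r \<subseteq> \<Theta>"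
    and X: "\<And>n. 0 < X n" "\<And>n. X n < r / (norm v + 1)" "filterlim X (at_right 0) sequentially"
  obtains s g where "strict_mono (s :: nat \<Rightarrow> nat)" "g \<in> optimal_potentials \<theta>"
    "(\<lambda>n. (f (\<theta> + X (s n) *\<^sub>R v) - f \<theta>) / X (s n)) \<longlonglongrightarrow> slope g \<theta> \<bullet> v"
    "\<And>p. p \<in> dual_admissible S c \<Longrightarrow> dual_value (\<mu> \<theta>) \<nu> p = f \<theta> \<Longrightarrow> slope (fst p) \<theta> \<bullet> v \<le> slope g \<theta> \<bullet> v"
proof -
  have in_ball: "\<theta> + X n *\<^sub>R v \<in> ball \<theta> r" for n by (rule ball_direction[OF X(1) X(2)])
  then have in_\<Theta>: "\<theta> + X n *\<^sub>R v \<in> \<Theta>" for n using r by blast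
  have "r > 0" using in_ball[of 0] ball_eq_empty[of \<theta> r] by fastforce
  have "\<forall>n. \<exists>\<phi>. \<phi> \<in> optimal_potentials (\<theta> + X n *\<^sub>R v)"
    using optimal_potentials_nonempty[OF in_\<Theta>] by blast
  then obtain \<phi> where "\<And>n. \<phi> n \<in> optimal_potentials (\<theta> + X n *\<^sub>R v)" by metis
  then have \<phi>: "\<And>n. \<phi> n \<in> normalized_potentials"
      "\<And>n. potential_value (\<mu> (\<theta> + X n *\<^sub>R v)) \<nu> (\<phi> n) = f (\<theta> + X n *\<^sub>R v)"
    by (auto simp: optimal_potentials_def)
  obtain g s where g: "g \<in> normalized_potentials" and s: "strict_mono (s :: nat \<Rightarrow> nat)"
    and unif: "uniform_limit S (\<lambda>n. \<phi> (s n)) g sequentially"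
    using normalized_potentials_seq_compact[of \<phi>, OF \<phi>(1)] .
  define Y where "Y n = X (s n)" for n
  have Y: "\<And>n. 0 < Y n" "\<And>n. Y n < r / (norm v + 1)" "filterlim Y (at_right 0) sequentially"
    using X(1,2) filterlim_compose[OF X(3) filterlim_subseq[OF s]] by (auto simp: Y_def[abs_def])
  define \<psi> where "\<psi> n = \<phi> (s n)" for n
  have \<psi>: "\<And>n. \<psi> n \<in> normalized_potentials"
      "\<And>n. potential_value (\<mu> (\<theta> + Y n *\<^sub>R v)) \<nu> (\<psi> n) = f (\<theta> + Y n *\<^sub>R v)"
    using \<phi> by (auto simp: \<psi>_def Y_def)
  have Y_in: "\<theta> + Y n *\<^sub>R v \<in> \<Theta>" for n using in_\<Theta> by (simp add: Y_def)
  have unif: "uniform_limit S \<psi> g sequentially" using unif by (simp add: \<psi>_def[abs_def])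
  have Y0: "Y \<longlonglongrightarrow> 0" using Y(3) by (simp add: filterlim_at)
  define C where "C = M * (\<integral>x. \<bar>\<eta> x\<bar> \<partial>L) * norm v"
  have g_opt: "g \<in> optimal_potentials \<theta>"
  proof -
    have close: "\<bar>potential_value (\<mu> \<theta>) \<nu> (\<psi> n) - f \<theta>\<bar> \<le> 2 * C * Y n" for n
    proof -
      have "\<bar>potential_value (\<mu> \<theta>) \<nu> (\<psi> n) - potential_value (\<mu> (\<theta> + Y n *\<^sub>R v)) \<nu> (\<psi> n)\<bar> \<le>
          M * (\<integral>x. \<bar>\<eta> x\<bar> \<partial>L) * norm (\<theta> - (\<theta> + Y n *\<^sub>R v))"
        using in_ball[of "s n"] \<open>r > 0\<close> r \<psi>(1) by (intro potential_value_lipschitz[of "ball \<theta> r"]) (auto simp: Y_def)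
      moreover have "dist (f \<theta>) (f (\<theta> + Y n *\<^sub>R v)) \<le> M * (\<integral>x. \<bar>\<eta> x\<bar> \<partial>L) * dist \<theta> (\<theta> + Y n *\<^sub>R v)"
        using in_ball[of "s n"] \<open>r > 0\<close>
        by (intro lipschitz_onD[OF f_lipschitz[OF convex_ball r]]) (auto simp: Y_def)
      moreover have "norm (\<theta> - (\<theta> + Y n *\<^sub>R v)) = Y n * norm v" "dist \<theta> (\<theta> + Y n *\<^sub>R v) = Y n * norm v"
        using Y(1)[of n] by (simp_all add: dist_norm)
      ultimately show ?thesis
        unfolding \<psi>(2) by (simp add: C_def dist_real_def mult_ac)
    qed
    have "(\<lambda>n. 2 * C * Y n) \<longlonglongrightarrow> 2 * C * 0" by (intro tendsto_intros Y0)
    then have lim: "(\<lambda>n. 2 * C * Y n) \<longlonglongrightarrow> 0" by simp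
    have "(\<lambda>n. potential_value (\<mu> \<theta>) \<nu> (\<psi> n) - f \<theta>) \<longlonglongrightarrow> 0"
      by (rule Lim_null_comparison[OF _ lim]) (simp add: close)
    then have "(\<lambda>n. potential_value (\<mu> \<theta>) \<nu> (\<psi> n)) \<longlonglongrightarrow> f \<theta>" by (simp add: LIM_zero_iff)
    moreover have "(\<lambda>n. potential_value (\<mu> \<theta>) \<nu> (\<psi> n)) \<longlonglongrightarrow> potential_value (\<mu> \<theta>) \<nu> g"
      using potential_value_tendsto[OF \<mu>[OF \<theta>] \<nu> \<psi>(1) g unif] .
    ultimately have "f \<theta> = potential_value (\<mu> \<theta>) \<nu> g" by (rule LIMSEQ_unique)
    with g show ?thesis by (simp add: optimal_potentials_def)
  qed
  have lower: "(\<lambda>n. (dual_value (\<mu> (\<theta> + Y n *\<^sub>R v)) \<nu> p - dual_value (\<mu> \<theta>) \<nu> p) / Y n) \<longlonglongrightarrow> slope (fst p) \<theta> \<bullet> v"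
    "\<And>n. (dual_value (\<mu> (\<theta> + Y n *\<^sub>R v)) \<nu> p - dual_value (\<mu> \<theta>) \<nu> p) / Y n \<le> (f (\<theta> + Y n *\<^sub>R v) - f \<theta>) / Y n"
    if p: "p \<in> dual_admissible S c" "dual_value (\<mu> \<theta>) \<nu> p = f \<theta>" for p
  proof -
    have cont: "continuous_on S (fst p)" using p(1) by (auto simp: dual_admissible_def)
    obtain B where B: "\<And>x. x \<in> S \<Longrightarrow> \<bar>fst p x\<bar> \<le> B"
      using compact_imp_bounded[OF compact_continuous_image[OF cont compact_S]] by (auto simp: bounded_iff)
    show "(\<lambda>n. (dual_value (\<mu> (\<theta> + Y n *\<^sub>R v)) \<nu> p - dual_value (\<mu> \<theta>) \<nu> p) / Y n) \<longlonglongrightarrow> slope (fst p) \<theta> \<bullet> v"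
      using cont B by (intro dual_quotient_tendsto[OF \<theta> r Y, where B = B]) auto
    show "(dual_value (\<mu> (\<theta> + Y n *\<^sub>R v)) \<nu> p - dual_value (\<mu> \<theta>) \<nu> p) / Y n \<le> (f (\<theta> + Y n *\<^sub>R v) - f \<theta>) / Y n" for n
      using dual_value_le_transport_cost[OF \<mu>[OF Y_in] \<nu> p(1), of n] Y(1)[of n] p(2) f[OF Y_in, of n]
      by (intro divide_right_mono) auto
  qed
  have upper: "(f (\<theta> + Y n *\<^sub>R v) - f \<theta>) / Y n \<le>
      (dual_value (\<mu> (\<theta> + Y n *\<^sub>R v)) \<nu> (\<psi> n, conj_potential (\<psi> n)) - dual_value (\<mu> \<theta>) \<nu> (\<psi> n, conj_potential (\<psi> n))) / Y n" for n
    using \<psi>(2)[of n] potential_value_le_f[OF \<theta> \<psi>(1)[of n]] Y(1)[of n]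
    by (intro divide_right_mono) (auto simp: potential_value_def)
  have upper_lim: "(\<lambda>n. (dual_value (\<mu> (\<theta> + Y n *\<^sub>R v)) \<nu> (\<psi> n, conj_potential (\<psi> n)) -
      dual_value (\<mu> \<theta>) \<nu> (\<psi> n, conj_potential (\<psi> n))) / Y n) \<longlonglongrightarrow> slope g \<theta> \<bullet> v"
    using normalized_potentialsD(1-3)[OF \<psi>(1)] normalized_potentialsD(1)[OF g] tendsto_uniform_limitI[OF unif]
    by (intro dual_quotient_tendsto[OF \<theta> r Y, where B = M]) auto
  have g_adm: "(g, conj_potential g) \<in> dual_admissible S c" "dual_value (\<mu> \<theta>) \<nu> (g, conj_potential g) = f \<theta>"
    using normalized_potentialsD(4)[OF g] g_opt by (auto simp: optimal_potentials_def potential_value_def)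
  have lower_lim: "(\<lambda>n. (dual_value (\<mu> (\<theta> + Y n *\<^sub>R v)) \<nu> (g, conj_potential g) -
      dual_value (\<mu> \<theta>) \<nu> (g, conj_potential g)) / Y n) \<longlonglongrightarrow> slope g \<theta> \<bullet> v"
    using lower(1)[OF g_adm] by simp
  have lim: "(\<lambda>n. (f (\<theta> + Y n *\<^sub>R v) - f \<theta>) / Y n) \<longlonglongrightarrow> slope g \<theta> \<bullet> v"
    by (rule tendsto_sandwich[OF _ _ lower_lim upper_lim]) (simp_all only: lower(2)[OF g_adm] upper eventually_True)
  have max: "slope (fst p) \<theta> \<bullet> v \<le> slope g \<theta> \<bullet> v"
    if p: "p \<in> dual_admissible S c" "dual_value (\<mu> \<theta>) \<nu> p = f \<theta>" for p
    using lower[OF p] by (intro LIMSEQ_le[OF _ lim]) auto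
  show thesis using that[OF s g_opt] lim max by (simp add: Y_def)
qed

text \<open>
  Every sequence of step sizes has a subsequence along which the quotients converge, and every limit so
  obtained is the maximum of \<open>slope h \<theta> \<bullet> v\<close> over optimal \<open>h\<close>. As this number does not depend on the
  sequence, the one-sided derivative exists.
\<close>
lemma danskin:
  assumes \<theta>: "\<theta> \<in> \<Theta>"
  obtains g where "g \<in> optimal_potentials \<theta>" "has_directional_derivative f \<theta> v (slope g \<theta> \<bullet> v)"
    "\<And>p. p \<in> dual_admissible S c \<Longrightarrow> dual_value (\<mu> \<theta>) \<nu> p = f \<theta> \<Longrightarrow> slope (fst p) \<theta> \<bullet> v \<le> slope g \<theta> \<bullet> v"
proof -
  obtain r where r: "r > 0" "ball \<theta> r \<subseteq> \<Theta>" by (rule openE[OF open_\<Theta> \<theta>])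
  \<comment> \<open>steps shorter than \<open>d\<close> stay in the ball; the \<open>+ 1\<close> covers the direction \<open>v = 0\<close>\<close>
  define d where "d = r / (norm v + 1)"
  have d: "d > 0" using r by (simp add: d_def add_nonneg_pos)
  obtain X where X: "\<And>n. 0 < X n" "\<And>n. X n < d" "filterlim X (at_right 0) sequentially"
    using shrinking_sequence[OF d] by blast
  obtain s :: "nat \<Rightarrow> nat" and g where g: "g \<in> optimal_potentials \<theta>"
    and max: "\<And>p. p \<in> dual_admissible S c \<Longrightarrow> dual_value (\<mu> \<theta>) \<nu> p = f \<theta> \<Longrightarrow> slope (fst p) \<theta> \<bullet> v \<le> slope g \<theta> \<bullet> v"
    using danskin_sequence[OF \<theta> r(2) X[unfolded d_def]] by blast
  have opt_adm: "(h, conj_potential h) \<in> dual_admissible S c" "dual_value (\<mu> \<theta>) \<nu> (h, conj_potential h) = f \<theta>"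
    if "h \<in> optimal_potentials \<theta>" for h
    using that normalized_potentialsD(4) by (auto simp: optimal_potentials_def potential_value_def)
  have "((\<lambda>t. (f (\<theta> + t *\<^sub>R v) - f \<theta>) / t) \<longlongrightarrow> slope g \<theta> \<bullet> v) (at_right 0)"
  proof (rule tendsto_at_right_sequentially[OF d])
    fix Z :: "nat \<Rightarrow> real" assume Z: "\<And>n. 0 < Z n" "\<And>n. Z n < d" "Z \<longlonglongrightarrow> 0"
    let ?Q = "\<lambda>n. (f (\<theta> + Z n *\<^sub>R v) - f \<theta>) / Z n"
    have Z_right: "filterlim Z (at_right 0) sequentially" using Z(1,3) by (rule filterlim_at_right_0I)
    show "?Q \<longlonglongrightarrow> slope g \<theta> \<bullet> v"
    proof (rule ccontr)
      assume "\<not> ?Q \<longlonglongrightarrow> slope g \<theta> \<bullet> v"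
      then obtain e where e: "e > 0" "\<not> (\<forall>\<^sub>F n in sequentially. dist (?Q n) (slope g \<theta> \<bullet> v) < e)"
        by (auto simp: tendsto_iff)
      from not_eventually_sequentiallyD[OF e(2)] obtain q where q: "strict_mono (q :: nat \<Rightarrow> nat)"
        "\<And>n. \<not> dist (?Q (q n)) (slope g \<theta> \<bullet> v) < e" by blast
      define Y where "Y n = Z (q n)" for n
      have Y: "\<And>n. 0 < Y n" "\<And>n. Y n < d" "filterlim Y (at_right 0) sequentially"
        using Z(1,2) filterlim_compose[OF Z_right filterlim_subseq[OF q(1)]] by (auto simp: Y_def[abs_def])
      obtain s :: "nat \<Rightarrow> nat" and h where "strict_mono s" and h: "h \<in> optimal_potentials \<theta>"
        and lim: "(\<lambda>n. (f (\<theta> + Y (s n) *\<^sub>R v) - f \<theta>) / Y (s n)) \<longlonglongrightarrow> slope h \<theta> \<bullet> v"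
        and max': "\<And>p. p \<in> dual_admissible S c \<Longrightarrow> dual_value (\<mu> \<theta>) \<nu> p = f \<theta> \<Longrightarrow> slope (fst p) \<theta> \<bullet> v \<le> slope h \<theta> \<bullet> v"
        by (rule danskin_sequence[OF \<theta> r(2) Y(1) Y(2)[unfolded d_def] Y(3)]) (rule that, assumption+)
      have "slope h \<theta> \<bullet> v = slope g \<theta> \<bullet> v"
        using max[OF opt_adm[OF h]] max'[OF opt_adm[OF g]] by simp
      with lim have "(\<lambda>n. ?Q (q (s n))) \<longlonglongrightarrow> slope g \<theta> \<bullet> v" by (simp add: Y_def)
      from tendstoD[OF this e(1)] have "\<forall>\<^sub>F n in sequentially. False" using q(2) by simp
      then show False by simp
    qed
  qed
  with g max show thesis by (intro that) (auto simp: has_directional_derivative_def)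
qed

end

section \<open>Null sets of convex kinks\<close>

text \<open>
  Tilting \<open>g\<close> by a rational slope \<open>q\<close> strictly between the one-sided derivatives turns a kink into a
  strict local minimum. Inside a given interval with rational endpoints there is at most one strict
  minimizer, so the kinks are indexed by triples of rationals.
\<close>
lemma countable_convex_kinks:
  fixes g :: "real \<Rightarrow> real"
  shows "countable {t. \<exists>r l. has_directional_derivative g t 1 r \<and>
    has_directional_derivative g t (- 1) l \<and> r + l > 0}"
proof -
  define K where "K = (\<lambda>(q, a, b). {t. a < t \<and> t < b \<and>
    (\<forall>s. a < s \<and> s < b \<and> s \<noteq> t \<longrightarrow> g t - q * t < g s - q * s)})"
  have "countable (K z)" for z
  proof -
    have "x = y" if "x \<in> K z" "y \<in> K z" for x y
    proof (rule ccontr)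
      assume "x \<noteq> y"
      obtain q a b where z: "z = (q, a, b)" by (cases z)
      from that \<open>x \<noteq> y\<close> have "g x - q * x < g y - q * y" "g y - q * y < g x - q * x"
        unfolding z K_def by simp_all
      then show False by simp
    qed
    then have "K z = {} \<or> (\<exists>x. K z = {x})" by blast
    then show ?thesis by auto
  qed
  then have "countable (\<Union>z\<in>\<rat> \<times> \<rat> \<times> \<rat>. K z)"
    by (intro countable_UN countable_SIGMA countable_rat)
  have "\<exists>z\<in>\<rat> \<times> \<rat> \<times> \<rat>. t \<in> K z"
    if r: "has_directional_derivative g t 1 r" and l: "has_directional_derivative g t (- 1) l"
      and "r + l > 0" for t r l
  proof -
    have "- l < r" using \<open>r + l > 0\<close> by simp
    then obtain q where q: "q \<in> \<rat>" "- l < q" "q < r" using Rats_dense_in_real by blast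
    have "\<forall>\<^sub>F h in at_right 0. q < (g (t + h) - g t) / h"
      using order_tendstoD(1)[OF r[unfolded has_directional_derivative_def] q(3)] by simp
    then obtain d1 where d1: "d1 > 0" "\<And>h. 0 < h \<Longrightarrow> h < d1 \<Longrightarrow> q < (g (t + h) - g t) / h"
      unfolding eventually_at_right_field by auto
    have "- q < l" using q(2) by simp
    then have "\<forall>\<^sub>F h in at_right 0. - q < (g (t - h) - g t) / h"
      using order_tendstoD(1)[OF l[unfolded has_directional_derivative_def]] by simp
    then obtain d2 where d2: "d2 > 0" "\<And>h. 0 < h \<Longrightarrow> h < d2 \<Longrightarrow> - q < (g (t - h) - g t) / h"
      unfolding eventually_at_right_field by auto
    define d where "d = min d1 d2"
    have min: "g t - q * t < g s - q * s" if "\<bar>s - t\<bar> < d" "s \<noteq> t" for s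
    proof (cases "s > t")
      case True
      then have "q * (s - t) < g s - g t"
        using d1(2)[of "s - t"] that by (simp add: d_def field_simps)
      then show ?thesis by (simp add: algebra_simps)
    next
      case False
      then have "s < t" using that by simp
      then have "- q * (t - s) < g s - g t"
        using d2(2)[of "t - s"] that by (simp add: d_def pos_less_divide_eq)
      then show ?thesis by (simp add: algebra_simps)
    qed
    have "d > 0" using d1(1) d2(1) by (simp add: d_def)
    then obtain a b where ab: "a \<in> \<rat>" "b \<in> \<rat>" "t - d < a" "a < t" "t < b" "b < t + d"
      using Rats_dense_in_real[of "t - d" t] Rats_dense_in_real[of t "t + d"] by auto
    have "t \<in> K (q, a, b)" unfolding K_def using ab min by auto
    then show ?thesis using q ab by blast
  qed
  then have "{t. \<exists>r l. has_directional_derivative g t 1 r \<and>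
      has_directional_derivative g t (- 1) l \<and> r + l > 0} \<subseteq> (\<Union>z\<in>\<rat> \<times> \<rat> \<times> \<rat>. K z)"
    by (intro subsetI UN_iff[THEN iffD2]) (elim CollectE exE conjE)
  from countable_subset[OF this \<open>countable (\<Union>z\<in>\<rat> \<times> \<rat> \<times> \<rat>. K z)\<close>] show ?thesis .
qed

text \<open>
  Average the measures of the translates \<open>N - t v\<close> over \<open>t \<in> {0..1}\<close>. By translation
  invariance each equals the measure of \<open>N\<close>; by Tonelli the average is an integral of lengths of line
  sections, all of which vanish.
\<close>
lemma null_sets_countable_lines:
  fixes N :: "'b::euclidean_space set"
  assumes N[measurable]: "N \<in> sets borel" and lines: "\<And>x. countable {t::real. x + t *\<^sub>R v \<in> N}"
  shows "N \<in> null_sets lborel"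
proof -
  let ?f = "\<lambda>(x::'b) (t::real). indicator N (x + t *\<^sub>R v) * indicator {0..1} t :: ennreal"
  have meas: "(\<lambda>(x, t). ?f x t) \<in> borel_measurable (lborel \<Otimes>\<^sub>M lborel)"
    by measurable
  have "(\<integral>\<^sup>+t. \<integral>\<^sup>+x. ?f x t \<partial>lborel \<partial>lborel) = (\<integral>\<^sup>+x. \<integral>\<^sup>+t. ?f x t \<partial>lborel \<partial>lborel)"
    using meas by (rule lborel_pair.Fubini')
  also have "\<dots> = (\<integral>\<^sup>+(x::'b). 0 \<partial>lborel)"
  proof (intro nn_integral_cong)
    fix x :: 'b
    have "{t::real. x + t *\<^sub>R v \<in> N} \<in> null_sets lborel"
      using lines by (rule countable_imp_null_set_lborel)
    then have "AE t::real in lborel. x + t *\<^sub>R v \<notin> N"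
      by (auto dest!: AE_not_in)
    then have "(\<integral>\<^sup>+t. ?f x t \<partial>lborel) = (\<integral>\<^sup>+(t::real). 0 \<partial>lborel)"
      by (intro nn_integral_cong_AE) (auto elim!: eventually_mono)
    then show "(\<integral>\<^sup>+t. ?f x t \<partial>lborel) = 0" by simp
  qed
  finally have 0: "(\<integral>\<^sup>+t. \<integral>\<^sup>+x. ?f x t \<partial>lborel \<partial>lborel) = 0" by simp
  have "(\<integral>\<^sup>+x. ?f x t \<partial>lborel) = emeasure lborel N * indicator {0..1} t" for t
  proof -
    have "(\<integral>\<^sup>+x. ?f x t \<partial>lborel) = (\<integral>\<^sup>+x. indicator N (t *\<^sub>R v + x) \<partial>lborel) * indicator {0..1} t"
      by (subst nn_integral_multc[symmetric]) (auto simp: add.commute)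
    also have "(\<integral>\<^sup>+x. indicator N (t *\<^sub>R v + x) \<partial>lborel) =
        (\<integral>\<^sup>+x. indicator N x \<partial>distr lborel borel ((+) (t *\<^sub>R v)))"
      by (subst nn_integral_distr) auto
    also have "\<dots> = emeasure lborel N" unfolding lborel_distr_plus by simp
    finally show ?thesis .
  qed
  with 0 have "emeasure lborel N = 0" by (simp add: nn_integral_cmult)
  then show ?thesis by (simp add: null_sets_def)
qed

text \<open>
  The Borel measurability needed for Tonelli comes from writing the sum of the two one-sided
  derivatives as a limit of second-order differences of a Borel extension of \<open>f\<close>.
\<close>
lemma null_sets_convex_kinks:
  fixes f :: "'b::euclidean_space \<Rightarrow> real"
  assumes S: "open S" "continuous_on S f"
    and r: "\<And>x. x \<in> S \<Longrightarrow> has_directional_derivative f x v (r x)"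
    and l: "\<And>x. x \<in> S \<Longrightarrow> has_directional_derivative f x (- v) (l x)"
  shows "{x\<in>S. r x + l x > 0} \<in> null_sets lborel" (is "?N \<in> _")
proof (rule null_sets_countable_lines)
  \<comment> \<open>\<open>f\<close> is continuous only on \<open>S\<close>, while \<open>x + h n *\<^sub>R v\<close> may lie outside\<close>
  define F where "F x = indicator S x *\<^sub>R f x" for x
  define h :: "nat \<Rightarrow> real" where "h n = 1 / real (Suc n)" for n
  define Q where "Q n x = (F (x + h n *\<^sub>R v) - F x) / h n + (F (x + h n *\<^sub>R - v) - F x) / h n" for n x
  have F[measurable]: "F \<in> borel_measurable borel"
    unfolding F_def using S by (intro borel_measurable_continuous_on_indicator) auto
  have [measurable]: "Q n \<in> borel_measurable borel" for n
    unfolding Q_def by measurable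
  have h: "filterlim h (at_right 0) sequentially"
    using LIMSEQ_inverse_real_of_nat
    unfolding h_def[abs_def] by (simp add: filterlim_at inverse_eq_divide)
  have quot: "((\<lambda>n. (F (x + h n *\<^sub>R w) - F x) / h n) \<longlongrightarrow> d) sequentially"
    if x: "x \<in> S" and d: "has_directional_derivative f x w d" for x w d
  proof -
    have "((\<lambda>n. (f (x + h n *\<^sub>R w) - f x) / h n) \<longlonglongrightarrow> d)"
      using filterlim_compose[OF d[unfolded has_directional_derivative_def] h] .
    moreover have "((\<lambda>n. x + h n *\<^sub>R w) \<longlongrightarrow> x + 0 *\<^sub>R w) sequentially"
      using h by (intro tendsto_intros) (simp add: filterlim_at)
    then have "\<forall>\<^sub>F n in sequentially. x + h n *\<^sub>R w \<in> S"
      using topological_tendstoD[of _ x sequentially S] S(1) x by simp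
    then have "\<forall>\<^sub>F n in sequentially. (f (x + h n *\<^sub>R w) - f x) / h n = (F (x + h n *\<^sub>R w) - F x) / h n"
      by eventually_elim (use x in \<open>simp add: F_def\<close>)
    ultimately show ?thesis by (rule Lim_transform_eventually)
  qed
  have "lim (\<lambda>n. Q n x) = r x + l x" if "x \<in> S" for x
    unfolding Q_def using that by (intro limI tendsto_add quot r l)
  then have "?N = S \<inter> {x. lim (\<lambda>n. Q n x) > 0}" by auto
  moreover have "{x. lim (\<lambda>n. Q n x) > 0} \<in> sets borel"
    by measurable
  ultimately show "?N \<in> sets borel" using S(1) by auto
  fix x
  define g where "g t = f (x + t *\<^sub>R v)" for t
  have "has_directional_derivative g t s d" if "has_directional_derivative f (x + t *\<^sub>R v) (s *\<^sub>R v) d" for t s d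
    using that by (simp add: has_directional_derivative_def g_def algebra_simps)
  note dir = this
  have "{t. x + t *\<^sub>R v \<in> ?N} \<subseteq> {t. \<exists>r l. has_directional_derivative g t 1 r \<and>
    has_directional_derivative g t (- 1) l \<and> r + l > 0}"
  proof safe
    fix t assume "x + t *\<^sub>R v \<in> S" "r (x + t *\<^sub>R v) + l (x + t *\<^sub>R v) > 0"
    then show "\<exists>r l. has_directional_derivative g t 1 r \<and>
        has_directional_derivative g t (- 1) l \<and> r + l > 0"
      using r l by (intro exI[of _ "r (x + t *\<^sub>R v)"] exI[of _ "l (x + t *\<^sub>R v)"]) (auto intro: dir)
  qed
  then show "countable {t. x + t *\<^sub>R v \<in> ?N}"
    by (rule countable_subset) (rule countable_convex_kinks)
qed

section \<open>Multivalued subdifferentials and Hausdorff dimension\<close>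

text \<open>
  Vanishing \<open>s\<close>-dimensional Hausdorff measure. One number \<open>e\<close> bounds both the diameters and the sum,
  so that countable unions only need \<open>e\<close> to be split into a geometric series.
\<close>
definition hausdorff_null :: "real \<Rightarrow> 'b::metric_space set \<Rightarrow> bool" where
  "hausdorff_null s A \<longleftrightarrow> (\<forall>e>0. \<exists>U :: nat \<Rightarrow> 'b set. A \<subseteq> (\<Union>n. U n) \<and>
     (\<forall>n. bounded (U n) \<and> diameter (U n) \<le> e) \<and> (\<Sum>n. hausdorff_gauge s (U n)) \<le> ennreal e)"

lemma hausdorff_measure_eq_0:
  assumes "hausdorff_null s A"
  shows "hausdorff_measure s A = 0"
proof -
  have "hausdorff_premeasure s \<delta> A = 0" if "\<delta> > 0" for \<delta>
  proof -
    have "hausdorff_premeasure s \<delta> A \<le> 0 + ennreal e" if "e > 0" for e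
    proof -
      have "min e \<delta> > 0" using \<open>\<delta> > 0\<close> that by simp
      from assms[unfolded hausdorff_null_def, rule_format, OF this] obtain U where U: "A \<subseteq> (\<Union>n. U n)"
        "\<And>n. bounded (U n)" "\<And>n. diameter (U n) \<le> min e \<delta>"
        "(\<Sum>n. hausdorff_gauge s (U n)) \<le> ennreal (min e \<delta>)"
        by blast
      have "hausdorff_premeasure s \<delta> A \<le> (\<Sum>n. hausdorff_gauge s (U n))"
        unfolding hausdorff_premeasure_def using U(1-3)
        by (intro INF_lower CollectI conjI allI) (auto intro: order_trans[OF U(3)])
      also have "\<dots> \<le> ennreal e"
        by (rule order_trans[OF U(4)]) (rule ennreal_leI, rule min.cobounded1)
      finally show ?thesis by simp
    qed
    then have "hausdorff_premeasure s \<delta> A \<le> 0"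
      by (rule ennreal_le_epsilon)
    then show ?thesis by simp
  qed
  then have "hausdorff_measure s A = (SUP \<delta>\<in>{0::real<..}. 0)"
    unfolding hausdorff_measure_def by (intro SUP_cong) auto
  then show ?thesis by simp
qed

lemma hausdorff_dimension_le:
  assumes "0 \<le> d" and "\<And>s. d < s \<Longrightarrow> hausdorff_null s A"
  shows "hausdorff_dimension A \<le> ereal d"
proof (rule ereal_le_epsilon2)
  fix e :: real assume "e > 0"
  then have "hausdorff_measure (d + e) A = 0"
    using assms by (intro hausdorff_measure_eq_0) auto
  then have "hausdorff_dimension A \<le> ereal (d + e)"
    unfolding hausdorff_dimension_def using assms \<open>e > 0\<close> by (intro INF_lower) auto
  then show "hausdorff_dimension A \<le> ereal d + ereal e" by simp
qed

lemma hausdorff_null_subset: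
  "hausdorff_null s B \<Longrightarrow> A \<subseteq> B \<Longrightarrow> hausdorff_null s A"
  unfolding hausdorff_null_def by (meson order_trans)

lemma hausdorff_null_UN_nat:
  assumes "\<And>k::nat. hausdorff_null s (A k)"
  shows "hausdorff_null s (\<Union>k. A k)"
  unfolding hausdorff_null_def
proof safe
  fix e :: real assume "e > 0"
  have pos: "e * (1 / 2) ^ Suc k > 0" for k using \<open>e > 0\<close> by simp
  have "\<exists>U. A k \<subseteq> (\<Union>n. U n) \<and>
     (\<forall>n. bounded (U n) \<and> diameter (U n) \<le> e * (1 / 2) ^ Suc k) \<and>
     (\<Sum>n. hausdorff_gauge s (U n)) \<le> ennreal (e * (1 / 2) ^ Suc k)" for k
    by (rule assms[of k, unfolded hausdorff_null_def, rule_format, OF pos])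
  then obtain U where U: "\<And>k. A k \<subseteq> (\<Union>n. U k n)"
     "\<And>k n. bounded (U k n)" "\<And>k n. diameter (U k n) \<le> e * (1 / 2) ^ Suc k"
     "\<And>k. (\<Sum>n. hausdorff_gauge s (U k n)) \<le> ennreal (e * (1 / 2) ^ Suc k)"
    by metis
  define V where "V n = (case prod_decode n of (k, j) \<Rightarrow> U k j)" for n
  have "(\<Union>k. A k) \<subseteq> (\<Union>n. V n)"
  proof
    fix x assume "x \<in> (\<Union>k. A k)"
    then obtain k j where "x \<in> U k j" using U(1) by blast
    then have "x \<in> V (prod_encode (k, j))" by (simp add: V_def)
    then show "x \<in> (\<Union>n. V n)" by blast
  qed
  moreover have "bounded (V n) \<and> diameter (V n) \<le> e" for n
  proof -
    obtain k j where kj: "prod_decode n = (k, j)" by fastforce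
    have "e * (1 / 2) ^ Suc k \<le> e * 1"
      using \<open>e > 0\<close> by (intro mult_left_mono power_le_one) auto
    then show ?thesis using U(2,3)[of k j] by (simp add: V_def kj)
  qed
  moreover have "(\<Sum>n. hausdorff_gauge s (V n)) \<le> ennreal e"
  proof -
    have "(\<Sum>n. hausdorff_gauge s (V n)) =
        (\<Sum>n. (\<lambda>(k, j). hausdorff_gauge s (U k j)) (prod_decode n))"
      by (intro suminf_cong) (simp add: V_def split: prod.splits)
    also have "\<dots> = (\<Sum>k. \<Sum>j. hausdorff_gauge s (U k j))"
      using suminf_ennreal_2dimen[of "\<lambda>k. \<Sum>j. hausdorff_gauge s (U k j)"
          "\<lambda>(k, j). hausdorff_gauge s (U k j)"] by (simp add: o_def)
    also have "\<dots> \<le> (\<Sum>k. ennreal (e * (1 / 2) ^ Suc k))"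
      by (intro suminf_le U) auto
    also have "\<dots> = ennreal (\<Sum>k. e * (1 / 2) ^ Suc k)"
      using pos power_half_series
      by (intro suminf_ennreal2 summable_mult) (auto simp: less_imp_le sums_iff)
    also have "(\<Sum>k. e * (1 / 2) ^ Suc k) = e"
      using sums_mult[OF power_half_series, of e] by (simp add: sums_iff)
    finally show ?thesis .
  qed
  ultimately show "\<exists>U. (\<Union>k. A k) \<subseteq> (\<Union>n. U n) \<and>
     (\<forall>n. bounded (U n) \<and> diameter (U n) \<le> e) \<and>
     (\<Sum>n. hausdorff_gauge s (U n)) \<le> ennreal e"
    by blast
qed

lemma hausdorff_null_UN:
  assumes "countable I" and "\<And>i. i \<in> I \<Longrightarrow> hausdorff_null s (A i)"
  shows "hausdorff_null s (\<Union>i\<in>I. A i)"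
proof (cases "I = {}")
  case True
  then show ?thesis
    by (auto simp: hausdorff_null_def hausdorff_gauge_def diameter_def intro!: exI[of _ "\<lambda>_. {}"])
next
  case False
  have "hausdorff_null s (\<Union>k::nat. A (from_nat_into I k))"
    by (intro hausdorff_null_UN_nat assms from_nat_into False)
  also have "(\<Union>k::nat. A (from_nat_into I k)) = (\<Union>i\<in>I. A i)"
    using range_from_nat_into[OF False assms(1)] by (metis image_image)
  finally show ?thesis .
qed

lemma hausdorff_null_finite_covers:
  fixes A :: "'b::real_normed_vector set"
  assumes "s > 0"
    and cover: "\<And>e. e > 0 \<Longrightarrow> \<exists>(Z :: 'z set) W r. finite Z \<and> A \<subseteq> (\<Union>z\<in>Z. W z) \<and>
      (\<forall>z\<in>Z. \<forall>x\<in>W z. \<forall>y\<in>W z. norm (x - y) \<le> r) \<and> 0 \<le> r \<and> r \<le> e \<and>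
      real (card Z) * r powr s \<le> e"
  shows "hausdorff_null s A"
  unfolding hausdorff_null_def
proof safe
  fix e :: real assume "e > 0"
  from cover[OF this] obtain Z :: "'z set" and W r where Z: "finite Z" "A \<subseteq> (\<Union>z\<in>Z. W z)"
    and W: "\<And>z x y. z \<in> Z \<Longrightarrow> x \<in> W z \<Longrightarrow> y \<in> W z \<Longrightarrow> norm (x - y) \<le> r"
    and r: "0 \<le> r" "r \<le> e" "real (card Z) * r powr s \<le> e"
    by blast
  obtain h where h: "bij_betw h {..<card Z} Z"
    using ex_bij_betw_nat_finite[OF \<open>finite Z\<close>] by (auto simp: atLeast0LessThan)
  define U where "U n = (if n < card Z then W (h n) else {})" for n
  have diam: "diameter (U n) \<le> r" and bdd: "bounded (U n)" for n
  proof -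
    have *: "norm (x - y) \<le> r" if "x \<in> U n" "y \<in> U n" for x y
    proof -
      have "n < card Z" using that by (auto simp: U_def split: if_splits)
      moreover from this have "h n \<in> Z" using h by (auto simp: bij_betw_def)
      ultimately show ?thesis using that W by (simp add: U_def)
    qed
    then show "diameter (U n) \<le> r" by (intro diameter_le) (use r in auto)
    show "bounded (U n)" unfolding bounded_two_points using * by (auto simp: dist_norm)
  qed
  have "A \<subseteq> (\<Union>n. U n)"
  proof
    fix x assume "x \<in> A"
    then obtain z where z: "z \<in> Z" "x \<in> W z" using Z by blast
    then obtain n where "n < card Z" "h n = z"
      using h unfolding bij_betw_def by (metis imageE lessThan_iff)
    then show "x \<in> (\<Union>n. U n)" using z by (auto simp: U_def intro!: exI[of _ n])
  qed
  moreover have "(\<Sum>n. hausdorff_gauge s (U n)) \<le> ennreal e"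
  proof -
    have "(\<Sum>n. hausdorff_gauge s (U n)) = (\<Sum>n<card Z. hausdorff_gauge s (U n))"
      by (intro suminf_finite) (auto simp: U_def hausdorff_gauge_def)
    also have "\<dots> \<le> (\<Sum>n<card Z. ennreal (r powr s))"
      using diam diameter_ge_0[OF bdd] \<open>s > 0\<close>
      by (intro sum_mono) (auto simp: hausdorff_gauge_def intro!: ennreal_leI powr_mono2)
    also have "\<dots> = ennreal (real (card Z) * r powr s)"
      by (simp add: ennreal_mult' ennreal_of_nat_eq_real_of_nat)
    also have "\<dots> \<le> ennreal e" using r by (simp add: ennreal_leI)
    finally show ?thesis .
  qed
  moreover have "bounded (U n) \<and> diameter (U n) \<le> e" for n
    using diam[of n] bdd r by (auto intro: order_trans)
  ultimately show "\<exists>U. A \<subseteq> (\<Union>n. U n) \<and> (\<forall>n. bounded (U n) \<and> diameter (U n) \<le> e) \<and>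
     (\<Sum>n. hausdorff_gauge s (U n)) \<le> ennreal e"
    by blast
qed

definition subgradients :: "'b::real_inner set \<Rightarrow> ('b \<Rightarrow> real) \<Rightarrow> 'b \<Rightarrow> 'b set" where
  "subgradients S F x = {p. \<forall>y\<in>S. F x + p \<bullet> (y - x) \<le> F y}"

lemma convex_subgradients: "convex (subgradients S F x)"
proof (rule convexI)
  fix p q and u v :: real
  assume pq: "p \<in> subgradients S F x" "q \<in> subgradients S F x" and uv: "0 \<le> u" "0 \<le> v" "u + v = 1"
  have "F x + (u *\<^sub>R p + v *\<^sub>R q) \<bullet> (y - x) \<le> F y" if "y \<in> S" for y
  proof -
    have "F x + (u *\<^sub>R p + v *\<^sub>R q) \<bullet> (y - x) =
        u * (F x + p \<bullet> (y - x)) + v * (F x + q \<bullet> (y - x))"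
      using uv(3) by (simp add: inner_add_left distrib_left) (metis distrib_right mult_1)
    also have "\<dots> \<le> u * F y + v * F y"
      using pq uv that by (intro add_mono mult_left_mono) (auto simp: subgradients_def)
    also have "\<dots> = F y" using uv(3) by (metis distrib_right mult_1)
    finally show ?thesis .
  qed
  then show "u *\<^sub>R p + v *\<^sub>R q \<in> subgradients S F x" by (simp add: subgradients_def)
qed

text \<open>
  Monotonicity of the subdifferential: adding the two subgradient inequalities gives
  \<open>(p - p') \<bullet> (x - x') \<ge> 0\<close>, so the resolvent \<open>x + p \<mapsto> x\<close> is 1-Lipschitz.
\<close>
lemma norm_diff_le_resolvent:
  assumes "x \<in> S" "x' \<in> S" "p \<in> subgradients S F x" "p' \<in> subgradients S F x'"
  shows "norm (x - x') \<le> norm ((x + p) - (x' + p'))"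
proof -
  have "F x + p \<bullet> (x' - x) \<le> F x'" "F x' + p' \<bullet> (x - x') \<le> F x"
    using assms by (auto simp: subgradients_def)
  then have "(p - p') \<bullet> (x - x') \<ge> 0" by (simp add: algebra_simps)
  then have "(norm (x - x'))\<^sup>2 \<le> ((x + p) - (x' + p')) \<bullet> (x - x')"
    by (simp add: power2_norm_eq_inner algebra_simps)
  also have "\<dots> \<le> norm ((x + p) - (x' + p')) * norm (x - x')"
    by (rule norm_cauchy_schwarz)
  finally have "norm (x - x') * norm (x - x') \<le> norm ((x + p) - (x' + p')) * norm (x - x')"
    by (simp add: power2_eq_square)
  then show ?thesis
    by (cases "x = x'") auto
qed

text \<open>
  The set is a 1-Lipschitz image of part of the intersection of a cube with the hyperplane
  \<open>{y. y \<bullet> i = q}\<close>. A grid of mesh \<open>1 / n\<close> covers this intersection by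
  at most \<open>(2 k n + 1) ^ (DIM('b) - 1)\<close> cells of diameter \<open>O(1 / n)\<close>, and their
  \<open>s\<close>-th powers sum to \<open>O(n powr (DIM('b) - 1 - s))\<close>.
\<close>
lemma hausdorff_null_resolvent_of_hyperplane:
  fixes S :: "'b::euclidean_space set" and k :: nat
  assumes i: "i \<in> Basis" and s: "s > real DIM('b) - 1"
  shows "hausdorff_null s
    {x\<in>S. \<exists>p\<in>subgradients S F x. (x + p) \<bullet> i = q \<and> (\<forall>b\<in>Basis. \<bar>(x + p) \<bullet> b\<bar> \<le> k)}"
    (is "hausdorff_null s ?A")
proof (rule hausdorff_null_finite_covers)
  have dim: "DIM('b) \<ge> 1" using DIM_positive[where 'a='b] by linarith
  then show "s > 0" using s by linarith
  define m where "m = DIM('b) - 1"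
  have ms: "real m < s" using s dim by (simp add: m_def of_nat_diff)
  define good where "good x p \<longleftrightarrow> p \<in> subgradients S F x \<and> (x + p) \<bullet> i = q \<and>
    (\<forall>b\<in>Basis. \<bar>(x + p) \<bullet> b\<bar> \<le> k)" for x p
  have "\<forall>x\<in>?A. \<exists>p. good x p" by (auto simp: good_def)
  then obtain P where "\<forall>x\<in>?A. good x (P x)" by (rule bchoice[THEN exE])
  then have P: "\<And>x. x \<in> ?A \<Longrightarrow> P x \<in> subgradients S F x"
      "\<And>x. x \<in> ?A \<Longrightarrow> (x + P x) \<bullet> i = q"
      "\<And>x b. x \<in> ?A \<Longrightarrow> b \<in> Basis \<Longrightarrow> \<bar>(x + P x) \<bullet> b\<bar> \<le> k"
    unfolding good_def by blast+
  define y where "y x = x + P x" for x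
  have "(\<lambda>n. (2 * real k + 1) ^ m * real DIM('b) powr s * real n powr (real m - s)) \<longlonglongrightarrow>
      (2 * real k + 1) ^ m * real DIM('b) powr s * 0"
    using ms by (intro tendsto_intros tendsto_neg_powr filterlim_real_sequentially) auto
  moreover have "(\<lambda>n. real DIM('b) / real n) \<longlonglongrightarrow> 0" by (rule lim_const_over_n)
  ultimately have lim: "\<forall>\<^sub>F n in sequentially. (2 * real k + 1) ^ m * real DIM('b) powr s * real n powr (real m - s) < e
      \<and> real DIM('b) / real n < e" if "e > 0" for e
    using that by (intro eventually_conj order_tendstoD(2)) auto
  fix e :: real assume "e > 0"
  from eventually_conj[OF lim[OF this] eventually_gt_at_top[of 0]]
  obtain n :: nat where n: "n > 0" "real DIM('b) / real n < e"
     "(2 * real k + 1) ^ m * real DIM('b) powr s * real n powr (real m - s) < e"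
    unfolding eventually_sequentially by blast
  define r where "r = real DIM('b) / real n"
  define Z where "Z = PiE (Basis - {i}) (\<lambda>_. {- int (k * n)..int (k * n)})"
  define W where "W z = {x\<in>?A. \<forall>b\<in>Basis - {i}. \<lfloor>n * (y x \<bullet> b)\<rfloor> = z b}" for z
  have fin: "finite Z" unfolding Z_def by (intro finite_PiE) auto
  have card: "real (card Z) = real (2 * (k * n) + 1) ^ m"
    using i by (simp add: Z_def card_PiE m_def card_Diff_singleton add.commute)
  have cov: "?A \<subseteq> (\<Union>z\<in>Z. W z)"
  proof
    fix x assume x: "x \<in> ?A"
    define z where "z = restrict (\<lambda>b. \<lfloor>n * (y x \<bullet> b)\<rfloor>) (Basis - {i})"
    have "\<lfloor>n * (y x \<bullet> b)\<rfloor> \<in> {- int (k * n)..int (k * n)}" if "b \<in> Basis" for b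
    proof -
      have "\<bar>y x \<bullet> b\<bar> \<le> k" using P(3)[OF x that] by (simp add: y_def)
      then have "\<bar>n * (y x \<bullet> b)\<bar> \<le> real n * k"
        by (simp add: abs_mult mult_left_mono)
      then have "- (real k * real n) \<le> n * (y x \<bullet> b)" "n * (y x \<bullet> b) \<le> real k * real n"
        by (auto simp: abs_le_iff mult.commute)
      then show ?thesis
        by (auto simp: le_floor_iff) (metis floor_mono floor_of_nat of_nat_mult)
    qed
    then have "z \<in> Z" by (auto simp: z_def Z_def)
    moreover have "x \<in> W z" using x by (auto simp: W_def z_def)
    ultimately show "x \<in> (\<Union>z\<in>Z. W z)" by blast
  qed
  have small: "norm (x - x') \<le> r" if "x \<in> W z" "x' \<in> W z" for x x' z
  proof -
    have x: "x \<in> ?A" "x' \<in> ?A" using that by (auto simp: W_def)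
    have "\<bar>(y x - y x') \<bullet> b\<bar> \<le> 1 / n" if b: "b \<in> Basis" for b
    proof (cases "b = i")
      case True
      then show ?thesis using P(2)[OF x(1)] P(2)[OF x(2)] by (simp add: y_def inner_diff_left)
    next
      case False
      then have "\<lfloor>n * (y x \<bullet> b)\<rfloor> = \<lfloor>n * (y x' \<bullet> b)\<rfloor>"
        using b \<open>x \<in> W z\<close> \<open>x' \<in> W z\<close> by (simp add: W_def)
      then have "\<bar>n * (y x \<bullet> b) - n * (y x' \<bullet> b)\<bar> \<le> 1" by linarith
      then have "n * \<bar>(y x - y x') \<bullet> b\<bar> \<le> 1"
        by (simp add: inner_diff_left abs_mult flip: right_diff_distrib)
      then show ?thesis using n(1) by (simp add: field_simps)
    qed
    then have "(\<Sum>b\<in>Basis. \<bar>(y x - y x') \<bullet> b\<bar>) \<le> (\<Sum>b\<in>(Basis::'b set). 1 / n)"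
      by (rule sum_mono)
    then have "norm (y x - y x') \<le> r"
      using norm_le_l1[of "y x - y x'"] by (simp add: r_def)
    moreover have "norm (x - x') \<le> norm (y x - y x')"
      unfolding y_def using x P(1) by (intro norm_diff_le_resolvent[of x S x' "P x" F "P x'"]) auto
    ultimately show ?thesis by simp
  qed
  have "real (card Z) * r powr s \<le> e"
  proof -
    have "real (card Z) \<le> ((2 * real k + 1) * n) ^ m"
      unfolding card using n(1) by (intro power_mono) (auto simp: algebra_simps)
    then have "real (card Z) * r powr s \<le> ((2 * real k + 1) * n) ^ m * r powr s"
      by (intro mult_right_mono) auto
    also have "\<dots> = (2 * real k + 1) ^ m * real DIM('b) powr s * (real n ^ m / real n powr s)"
      by (simp add: r_def power_mult_distrib powr_divide)
    also have "real n ^ m / real n powr s = real n powr (real m - s)"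
      using n(1) by (simp add: powr_diff powr_realpow)
    finally show ?thesis using n(3) by simp
  qed
  then show "\<exists>Z W r. finite (Z :: ('b \<Rightarrow> int) set) \<and> ?A \<subseteq> (\<Union>z\<in>Z. W z) \<and>
      (\<forall>z\<in>Z. \<forall>x\<in>W z. \<forall>y\<in>W z. norm (x - y) \<le> r) \<and> 0 \<le> r \<and> r \<le> e \<and>
      real (card Z) * r powr s \<le> e"
    using fin cov small n(2) by (intro exI[of _ Z] exI[of _ W] exI[of _ r]) (auto simp: r_def)
qed

text \<open>
  If two subgradients at \<open>x\<close> differ in the coordinate \<open>i\<close>, then by convexity of the subdifferential
  the \<open>i\<close>-th coordinates of \<open>x + p\<close> fill an interval, which contains a rational \<open>q\<close>. Countably many
  hyperplanes therefore suffice.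
\<close>
lemma hausdorff_null_multiple_subgradients:
  fixes S :: "'b::euclidean_space set"
  assumes s: "s > real DIM('b) - 1"
  shows "hausdorff_null s
    {x\<in>S. \<exists>p\<in>subgradients S F x. \<exists>p'\<in>subgradients S F x. p \<noteq> p'}"
proof -
  define A where "A i q k =
    {x\<in>S. \<exists>p\<in>subgradients S F x. (x + p) \<bullet> i = q \<and> (\<forall>b\<in>Basis. \<bar>(x + p) \<bullet> b\<bar> \<le> real k)}" for i q k
  have "hausdorff_null s (\<Union>(i, q, k)\<in>Basis \<times> \<rat> \<times> UNIV. A i q k)"
    using s by (intro hausdorff_null_UN countable_SIGMA countable_rat)
      (auto simp: A_def intro: hausdorff_null_resolvent_of_hyperplane countable_finite)
  then show ?thesis
  proof (rule hausdorff_null_subset, safe)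
    fix x p p' assume x: "x \<in> S" "p \<in> subgradients S F x" "p' \<in> subgradients S F x" "p \<noteq> p'"
    then obtain i where i: "i \<in> Basis" "p \<bullet> i \<noteq> p' \<bullet> i"
      by (meson euclidean_eqI)
    have "\<exists>p p'. p \<in> subgradients S F x \<and> p' \<in> subgradients S F x \<and> p \<bullet> i < p' \<bullet> i"
      using x i by (meson linorder_less_linear)
    then obtain p p' where p: "p \<in> subgradients S F x" "p' \<in> subgradients S F x" "p \<bullet> i < p' \<bullet> i"
      by blast
    obtain q where q: "q \<in> \<rat>" "(x + p) \<bullet> i < q" "q < (x + p') \<bullet> i"
      using p(3) Rats_dense_in_real[of "(x + p) \<bullet> i" "(x + p') \<bullet> i"]
      by (auto simp: inner_add_left)
    define u where "u = (q - (x + p) \<bullet> i) / (p' \<bullet> i - p \<bullet> i)"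
    have u: "0 \<le> u" "u \<le> 1" "u * (p' \<bullet> i - p \<bullet> i) = q - (x + p) \<bullet> i"
      using q p(3) by (auto simp: u_def inner_add_left divide_simps)
    define w where "w = (1 - u) *\<^sub>R p + u *\<^sub>R p'"
    have w: "w \<in> subgradients S F x"
      unfolding w_def using u p convexD[OF convex_subgradients, of p S F x p' "1 - u" u] by auto
    have "(x + w) \<bullet> i = q" using u(3) by (simp add: w_def inner_add_left algebra_simps)
    moreover obtain k :: nat where "norm (x + w) \<le> k" using real_arch_simple by blast
    then have "\<forall>b\<in>Basis. \<bar>(x + w) \<bullet> b\<bar> \<le> k" by (meson Basis_le_norm order_trans)
    ultimately have "x \<in> A i q k" using x w by (auto simp: A_def)
    then show "x \<in> (\<Union>(i, q, k)\<in>Basis \<times> \<rat> \<times> UNIV. A i q k)" using i q by auto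
  qed
qed

section \<open>Gradient formula and semiconvexity\<close>

lemma norm_square_convex:
  fixes a b :: "'b::real_inner"
  assumes "0 \<le> t" "t \<le> 1"
  shows "(norm ((1 - t) *\<^sub>R a + t *\<^sub>R b))\<^sup>2 \<le> (1 - t) * (norm a)\<^sup>2 + t * (norm b)\<^sup>2"
proof -
  have "(1 - t) * (norm a)\<^sup>2 + t * (norm b)\<^sup>2 - (norm ((1 - t) *\<^sub>R a + t *\<^sub>R b))\<^sup>2 =
      t * (1 - t) * (norm (a - b))\<^sup>2"
    by (simp add: power2_norm_eq_inner inner_commute algebra_simps)
  moreover have "0 \<le> t * (1 - t) * (norm (a - b))\<^sup>2" using assms by simp
  ultimately show ?thesis by simp
qed

text \<open>
  Difference quotients of a convex function increase with the step, so the one-sided derivative is at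
  most the quotient for the full step from \<open>x\<close> to \<open>y\<close>.
\<close>
lemma convex_on_subgradientI:
  assumes conv: "convex_on B F" and x: "x \<in> B"
    and dir: "\<And>v. \<exists>l. has_directional_derivative F x v l \<and> p \<bullet> v \<le> l"
  shows "p \<in> subgradients B F x"
  unfolding subgradients_def
proof (intro CollectI ballI)
  fix y assume y: "y \<in> B"
  obtain l where l: "((\<lambda>t. (F (x + t *\<^sub>R (y - x)) - F x) / t) \<longlongrightarrow> l) (at_right 0)" "p \<bullet> (y - x) \<le> l"
    using dir[of "y - x"] by (auto simp: has_directional_derivative_def)
  have "\<forall>\<^sub>F t in at_right (0::real). (F (x + t *\<^sub>R (y - x)) - F x) / t \<le> F y - F x"
  proof (rule eventually_at_rightI[of 0 1])
    fix t :: real assume t: "t \<in> {0<..<1}"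
    have "x + t *\<^sub>R (y - x) = (1 - t) *\<^sub>R x + t *\<^sub>R y" by (simp add: algebra_simps)
    then have "F (x + t *\<^sub>R (y - x)) \<le> (1 - t) * F x + t * F y"
      using convex_onD[OF conv, of t x y] t x y by simp
    then have "F (x + t *\<^sub>R (y - x)) - F x \<le> (F y - F x) * t" by (simp add: algebra_simps)
    then show "(F (x + t *\<^sub>R (y - x)) - F x) / t \<le> F y - F x" using t by (simp add: pos_divide_le_eq)
  qed simp
  with l(1) have "l \<le> F y - F x" by (rule tendsto_upperbound) simp
  with l(2) show "F x + p \<bullet> (y - x) \<le> F y" by simp
qed

lemma has_directional_derivative_add_square:
  fixes f :: "'b::real_inner \<Rightarrow> real"
  assumes "has_directional_derivative f x v l"
  shows "has_directional_derivative (\<lambda>y. f y + C / 2 * (norm y)\<^sup>2) x v (l + C * (x \<bullet> v))"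
proof -
  have "((\<lambda>t. (f (x + t *\<^sub>R v) - f x) / t + (C * (x \<bullet> v) + C / 2 * t * (norm v)\<^sup>2)) \<longlongrightarrow>
      l + (C * (x \<bullet> v) + C / 2 * 0 * (norm v)\<^sup>2)) (at_right 0)"
    using assms unfolding has_directional_derivative_def by (intro tendsto_intros)
  moreover have "\<forall>\<^sub>F t in at_right 0. (f (x + t *\<^sub>R v) - f x) / t + (C * (x \<bullet> v) + C / 2 * t * (norm v)\<^sup>2) =
      (f (x + t *\<^sub>R v) + C / 2 * (norm (x + t *\<^sub>R v))\<^sup>2 - (f x + C / 2 * (norm x)\<^sup>2)) / t"
  proof (rule eventually_at_rightI[of 0 1])
    fix t :: real assume "t \<in> {0<..<1}"
    moreover have "(norm (x + t *\<^sub>R v))\<^sup>2 = (norm x)\<^sup>2 + 2 * t * (x \<bullet> v) + t\<^sup>2 * (norm v)\<^sup>2"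
      unfolding power2_norm_eq_inner by (simp add: inner_commute power2_eq_square algebra_simps)
    ultimately show "(f (x + t *\<^sub>R v) - f x) / t + (C * (x \<bullet> v) + C / 2 * t * (norm v)\<^sup>2) =
      (f (x + t *\<^sub>R v) + C / 2 * (norm (x + t *\<^sub>R v))\<^sup>2 - (f x + C / 2 * (norm x)\<^sup>2)) / t"
      by (simp add: field_simps power2_eq_square)
  qed simp
  ultimately show ?thesis
    unfolding has_directional_derivative_def by (auto intro: Lim_transform_eventually)
qed

context transport_family
begin

definition gradient_formula_at :: "'b \<Rightarrow> bool" where
  "gradient_formula_at \<theta> \<longleftrightarrow> gateaux_differentiable f \<theta> \<and>
    (\<forall>(\<phi>, \<psi>)\<in>kantorovich_potentials S c (\<mu> \<theta>) \<nu>.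
      gateaux_gradient f \<theta> = (\<integral>x. \<phi> x *\<^sub>R gradient (\<rho> x) \<theta> \<partial>lebesgue_on S))"

lemma optimal_potentials_admissible:
  assumes "\<phi> \<in> optimal_potentials \<theta>"
  shows "(\<phi>, conj_potential \<phi>) \<in> dual_admissible S c" "dual_value (\<mu> \<theta>) \<nu> (\<phi>, conj_potential \<phi>) = f \<theta>"
  using assms normalized_potentialsD(4) by (auto simp: optimal_potentials_def potential_value_def)

text \<open>
  With a single slope the one-sided derivative is linear in the direction. For an arbitrary pair of
  potentials the derivative dominates \<open>slope \<phi> \<theta> \<bullet> v\<close>; a linear form dominating another one equals
  it, as the directions \<open>v\<close> and \<open>- v\<close> show.
\<close>
lemma gradient_formula_if_unique_slope:
  assumes \<theta>: "\<theta> \<in> \<Theta>"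
    and unique: "\<And>\<phi> \<phi>'. \<phi> \<in> optimal_potentials \<theta> \<Longrightarrow> \<phi>' \<in> optimal_potentials \<theta> \<Longrightarrow> slope \<phi> \<theta> = slope \<phi>' \<theta>"
  shows "gradient_formula_at \<theta>"
proof -
  obtain \<phi>0 where \<phi>0: "\<phi>0 \<in> optimal_potentials \<theta>" using optimal_potentials_nonempty[OF \<theta>] .
  define s where "s = slope \<phi>0 \<theta>"
  have dir: "has_directional_derivative f \<theta> v (s \<bullet> v)"
    and max: "\<And>p. p \<in> dual_admissible S c \<Longrightarrow> dual_value (\<mu> \<theta>) \<nu> p = f \<theta> \<Longrightarrow> slope (fst p) \<theta> \<bullet> v \<le> s \<bullet> v" for v
    using danskin[OF \<theta>, of v] unique[OF \<phi>0] unfolding s_def by metis+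
  have "gateaux_differentiable f \<theta>"
    unfolding gateaux_differentiable_def using dir
    by (intro exI[of _ "\<lambda>v. s \<bullet> v"] conjI bounded_linear.linear bounded_linear_inner_right) auto
  moreover have "gateaux_gradient f \<theta> = s" using dir by (rule gateaux_gradient_eqI)
  moreover have "slope (fst p) \<theta> = s" if "p \<in> kantorovich_potentials S c (\<mu> \<theta>) \<nu>" for p
  proof -
    note p = kantorovich_potentials_value[OF \<mu>[OF \<theta>] \<nu> that]
    have "slope (fst p) \<theta> \<bullet> v = s \<bullet> v" for v
      using max[of p v] max[of p "- v"] p f[OF \<theta>] by simp
    then show ?thesis by (metis vector_eq_rdot)
  qed
  ultimately show ?thesis unfolding gradient_formula_at_def slope_def by fastforce
qed

text \<open>
  Off the kinks in the coordinate directions, the largest and the smallest value of \<open>slope \<phi> \<theta> \<bullet> b\<close>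
  over optimal \<open>\<phi>\<close> coincide for every basis vector \<open>b\<close>.
\<close>
lemma AE_gradient_formula: "AE \<theta> in lebesgue_on \<Theta>. gradient_formula_at \<theta>"
proof -
  have "\<forall>v \<theta>. \<exists>l. \<theta> \<in> \<Theta> \<longrightarrow> has_directional_derivative f \<theta> v l \<and>
      (\<forall>\<phi>\<in>optimal_potentials \<theta>. slope \<phi> \<theta> \<bullet> v \<le> l)"
    using danskin optimal_potentials_admissible by (metis fst_conv)
  then obtain D where D: "\<And>v \<theta>. \<theta> \<in> \<Theta> \<Longrightarrow> has_directional_derivative f \<theta> v (D v \<theta>)"
    and D_ge: "\<And>v \<theta> \<phi>. \<theta> \<in> \<Theta> \<Longrightarrow> \<phi> \<in> optimal_potentials \<theta> \<Longrightarrow> slope \<phi> \<theta> \<bullet> v \<le> D v \<theta>"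
    by metis
  have "{\<theta>\<in>\<Theta>. D b \<theta> + D (- b) \<theta> > 0} \<in> null_sets lborel" for b
    using open_\<Theta> continuous_on_f D by (intro null_sets_convex_kinks) auto
  then have null: "(\<Union>b\<in>Basis. {\<theta>\<in>\<Theta>. D b \<theta> + D (- b) \<theta> > 0}) \<in> null_sets lebesgue"
    by (intro null_sets_UN' null_sets_completionI) (auto intro: countable_finite)
  have formula: "gradient_formula_at \<theta>"
    if \<theta>: "\<theta> \<in> \<Theta>" and smooth: "\<theta> \<notin> (\<Union>b\<in>Basis. {\<theta>\<in>\<Theta>. D b \<theta> + D (- b) \<theta> > 0})" for \<theta>
  proof (rule gradient_formula_if_unique_slope[OF \<theta>])
    have le: "slope \<phi> \<theta> \<bullet> b \<le> slope \<phi>' \<theta> \<bullet> b"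
      if "\<phi> \<in> optimal_potentials \<theta>" "\<phi>' \<in> optimal_potentials \<theta>" "b \<in> Basis" for \<phi> \<phi>' b
    proof -
      have "D b \<theta> + D (- b) \<theta> \<le> 0" using smooth \<theta> that(3) by auto
      then show ?thesis using D_ge[OF \<theta> that(1), of b] D_ge[OF \<theta> that(2), of "- b"] by simp
    qed
    fix \<phi> \<phi>' assume opt: "\<phi> \<in> optimal_potentials \<theta>" "\<phi>' \<in> optimal_potentials \<theta>"
    show "slope \<phi> \<theta> = slope \<phi>' \<theta>"
    proof (rule euclidean_eqI)
      fix b :: 'b assume "b \<in> Basis"
      then show "slope \<phi> \<theta> \<bullet> b = slope \<phi>' \<theta> \<bullet> b" using le opt by (simp add: antisym)
    qed
  qed
  have "\<Theta> \<inter> space lebesgue \<in> sets lebesgue" using open_\<Theta> by simp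
  then show ?thesis
    using AE_not_in[OF null] formula by (auto simp: AE_restrict_space_iff elim!: eventually_mono)
qed

text \<open>
  Multiplying the convexity inequality of \<open>\<rho>(x, \<theta>) + h(x) |\<theta>|\<^sup>2 / 2\<close> by \<open>\<phi> x \<ge> 0\<close> and integrating shows
  that the dual value plus \<open>I |\<theta>|\<^sup>2 / 2\<close> is convex, where \<open>I = \<integral>\<phi> h\<close>. As \<open>I \<le> C\<close>, the constant \<open>C\<close>
  works for all normalized potentials at once.
\<close>
lemma potential_value_semiconvex:
  assumes h: "integrable L h"
    and convex: "AE x in L. locally_convex_on \<Theta> (\<lambda>\<theta>. \<rho> x \<theta> + h x * (norm \<theta>)\<^sup>2 / 2)"
    and B: "ball \<theta> r \<subseteq> \<Theta>" "a \<in> ball \<theta> r" "b \<in> ball \<theta> r" and t: "0 < t" "t < 1"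
    and \<phi>: "\<phi> \<in> normalized_potentials"
  defines "C \<equiv> M * (\<integral>x. \<bar>h x\<bar> \<partial>L)"
  shows "potential_value (\<mu> ((1 - t) *\<^sub>R a + t *\<^sub>R b)) \<nu> \<phi> + C / 2 * (norm ((1 - t) *\<^sub>R a + t *\<^sub>R b))\<^sup>2 \<le>
    (1 - t) * (potential_value (\<mu> a) \<nu> \<phi> + C / 2 * (norm a)\<^sup>2) +
    t * (potential_value (\<mu> b) \<nu> \<phi> + C / 2 * (norm b)\<^sup>2)"
proof -
  define z where "z = (1 - t) *\<^sub>R a + t *\<^sub>R b"
  have "z \<in> ball \<theta> r" unfolding z_def using B t by (intro convexD[OF convex_ball]) auto
  then have in_\<Theta>: "a \<in> \<Theta>" "b \<in> \<Theta>" "z \<in> \<Theta>" using B by auto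
  have cont: "continuous_on S \<phi>" using normalized_potentialsD(1)[OF \<phi>] .
  define P where "P \<xi> = (\<integral>x. \<phi> x * \<rho> x \<xi> \<partial>L)" for \<xi>
  define I where "I = (\<integral>x. \<phi> x * h x \<partial>L)"
  have int_\<rho>: "integrable L (\<lambda>x. \<phi> x * \<rho> x \<xi>)" if "\<xi> \<in> \<Theta>" for \<xi>
    using density_integral(1)[OF that cont] .
  have \<phi>h_le: "AE x in L. \<bar>\<phi> x * h x\<bar> \<le> M * \<bar>h x\<bar>"
    using AE_space by eventually_elim
      (use normalized_potentialsD(2,3)[OF \<phi>] in \<open>auto simp: abs_mult intro!: mult_right_mono\<close>)
  have int_h: "integrable L (\<lambda>x. \<phi> x * h x)"
  proof (rule Bochner_Integration.integrable_bound)
    show "integrable L (\<lambda>x. M * \<bar>h x\<bar>)" using h by simp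
    show "AE x in L. norm (\<phi> x * h x) \<le> norm (M * \<bar>h x\<bar>)"
      using \<phi>h_le by eventually_elim (use M_nonneg in simp)
    show "(\<lambda>x. \<phi> x * h x) \<in> borel_measurable L"
      using continuous_on_measurable_L[OF cont] h by measurable
  qed
  have "\<bar>I\<bar> \<le> (\<integral>x. \<bar>\<phi> x * h x\<bar> \<partial>L)" unfolding I_def by (rule integral_abs_bound)
  also have "\<dots> \<le> (\<integral>x. M * \<bar>h x\<bar> \<partial>L)" using \<phi>h_le int_h h by (intro integral_mono_AE) auto
  finally have "I \<le> C" by (simp add: C_def)
  let ?g = "\<lambda>\<xi> x. \<phi> x * \<rho> x \<xi> + \<phi> x * h x * ((norm \<xi>)\<^sup>2 / 2)"
  have int_g: "integrable L (?g \<xi>)" "(\<integral>x. ?g \<xi> x \<partial>L) = P \<xi> + I * ((norm \<xi>)\<^sup>2 / 2)" if "\<xi> \<in> \<Theta>" for \<xi>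
    using int_\<rho>[OF that] int_h by (simp_all add: P_def I_def)
  have "(\<integral>x. ?g z x \<partial>L) \<le> (\<integral>x. (1 - t) * ?g a x + t * ?g b x \<partial>L)"
  proof (rule integral_mono_AE)
    show "AE x in L. ?g z x \<le> (1 - t) * ?g a x + t * ?g b x"
      using convex AE_space
    proof eventually_elim
      case (elim x)
      then have "convex_on (ball \<theta> r) (\<lambda>\<theta>. \<rho> x \<theta> + h x * (norm \<theta>)\<^sup>2 / 2)"
        using B(1) by (simp add: locally_convex_on_def)
      from convex_onD[OF this, of t a b]
      have "\<rho> x z + h x * (norm z)\<^sup>2 / 2 \<le>
          (1 - t) * (\<rho> x a + h x * (norm a)\<^sup>2 / 2) + t * (\<rho> x b + h x * (norm b)\<^sup>2 / 2)"
        using t B by (simp add: z_def)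
      moreover have "\<phi> x \<ge> 0" using elim normalized_potentialsD(2)[OF \<phi>] by simp
      ultimately have "\<phi> x * (\<rho> x z + h x * (norm z)\<^sup>2 / 2) \<le>
          \<phi> x * ((1 - t) * (\<rho> x a + h x * (norm a)\<^sup>2 / 2) + t * (\<rho> x b + h x * (norm b)\<^sup>2 / 2))"
        by (rule mult_left_mono)
      then show ?case by (simp add: algebra_simps)
    qed
  qed (use int_g in_\<Theta> in auto)
  also have "\<dots> = (1 - t) * (P a + I * ((norm a)\<^sup>2 / 2)) + t * (P b + I * ((norm b)\<^sup>2 / 2))"
    using int_g in_\<Theta> by (subst Bochner_Integration.integral_add) auto
  finally have "P z + I * ((norm z)\<^sup>2 / 2) \<le>
      (1 - t) * (P a + I * ((norm a)\<^sup>2 / 2)) + t * (P b + I * ((norm b)\<^sup>2 / 2))"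
    using int_g in_\<Theta> by simp
  moreover have "(C - I) / 2 * (norm z)\<^sup>2 \<le> (C - I) / 2 * ((1 - t) * (norm a)\<^sup>2 + t * (norm b)\<^sup>2)"
    unfolding z_def using \<open>I \<le> C\<close> t by (intro mult_left_mono norm_square_convex) auto
  ultimately have "P z + C / 2 * (norm z)\<^sup>2 \<le>
      (1 - t) * (P a + C / 2 * (norm a)\<^sup>2) + t * (P b + C / 2 * (norm b)\<^sup>2)"
    by (simp add: field_simps)
  moreover define k where "k = (\<integral>y. conj_potential \<phi> y \<partial>\<nu>)"
  have "potential_value (\<mu> \<xi>) \<nu> \<phi> = P \<xi> + k" if "\<xi> \<in> \<Theta>" for \<xi>
    using density_integral(2)[OF that cont] by (simp add: potential_value_def dual_value_def P_def k_def)
  ultimately have "potential_value (\<mu> z) \<nu> \<phi> + C / 2 * (norm z)\<^sup>2 \<le>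
      (1 - t) * (potential_value (\<mu> a) \<nu> \<phi> + C / 2 * (norm a)\<^sup>2) +
      t * (potential_value (\<mu> b) \<nu> \<phi> + C / 2 * (norm b)\<^sup>2)"
    using in_\<Theta> by (simp add: algebra_simps)
  then show ?thesis by (simp only: z_def)
qed

text \<open>
  A maximum of functions that are semiconvex with a common constant.
\<close>
lemma semiconvex_f:
  assumes h: "integrable L h"
    and convex: "AE x in L. locally_convex_on \<Theta> (\<lambda>\<theta>. \<rho> x \<theta> + h x * (norm \<theta>)\<^sup>2 / 2)"
    and B: "ball \<theta> r \<subseteq> \<Theta>"
  defines "C \<equiv> M * (\<integral>x. \<bar>h x\<bar> \<partial>L)"
  shows "convex_on (ball \<theta> r) (\<lambda>\<xi>. f \<xi> + C / 2 * (norm \<xi>)\<^sup>2)"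
proof (rule convex_onI)
  fix t :: real and a b assume t: "0 < t" "t < 1" and ab: "a \<in> ball \<theta> r" "b \<in> ball \<theta> r"
  define z where "z = (1 - t) *\<^sub>R a + t *\<^sub>R b"
  have "z \<in> ball \<theta> r" unfolding z_def using ab t by (intro convexD[OF convex_ball]) auto
  then have in_\<Theta>: "a \<in> \<Theta>" "b \<in> \<Theta>" "z \<in> \<Theta>" using B ab by auto
  obtain \<phi> where \<phi>: "\<phi> \<in> normalized_potentials" "potential_value (\<mu> z) \<nu> \<phi> = f z"
    using optimal_potentials_nonempty[OF in_\<Theta>(3)] by (auto simp: optimal_potentials_def)
  have "f z + C / 2 * (norm z)\<^sup>2 \<le> (1 - t) * (potential_value (\<mu> a) \<nu> \<phi> + C / 2 * (norm a)\<^sup>2) +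
      t * (potential_value (\<mu> b) \<nu> \<phi> + C / 2 * (norm b)\<^sup>2)"
    using potential_value_semiconvex[OF h convex B ab t \<phi>(1)] \<phi>(2) by (simp add: C_def z_def)
  also have "\<dots> \<le> (1 - t) * (f a + C / 2 * (norm a)\<^sup>2) + t * (f b + C / 2 * (norm b)\<^sup>2)"
  proof -
    have "(1 - t) * potential_value (\<mu> a) \<nu> \<phi> \<le> (1 - t) * f a"
      using potential_value_le_f[OF in_\<Theta>(1) \<phi>(1)] t by (intro mult_left_mono) auto
    moreover have "t * potential_value (\<mu> b) \<nu> \<phi> \<le> t * f b"
      using potential_value_le_f[OF in_\<Theta>(2) \<phi>(1)] t by (intro mult_left_mono) auto
    ultimately show ?thesis by (simp add: distrib_left)
  qed
  finally show "f ((1 - t) *\<^sub>R a + t *\<^sub>R b) + C / 2 * (norm ((1 - t) *\<^sub>R a + t *\<^sub>R b))\<^sup>2 \<le>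
      (1 - t) * (f a + C / 2 * (norm a)\<^sup>2) + t * (f b + C / 2 * (norm b)\<^sup>2)"
    by (simp add: z_def)
qed (rule convex_ball)

lemma locally_semiconvex_f:
  assumes h: "integrable L h"
    and convex: "AE x in L. locally_convex_on \<Theta> (\<lambda>\<theta>. \<rho> x \<theta> + h x * (norm \<theta>)\<^sup>2 / 2)"
  shows "locally_semiconvex_on \<Theta> f"
  unfolding locally_semiconvex_on_def
proof
  fix \<theta> assume \<theta>: "\<theta> \<in> \<Theta>"
  obtain r where r: "r > 0" "ball \<theta> r \<subseteq> \<Theta>" by (rule openE[OF open_\<Theta> \<theta>])
  from r semiconvex_f[OF h convex r(2)]
  show "\<exists>r>0. \<exists>C. ball \<theta> r \<subseteq> \<Theta> \<and> convex_on (ball \<theta> r) (\<lambda>\<xi>. f \<xi> + C / 2 * (norm \<xi>)\<^sup>2)" by blast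
qed

text \<open>
  On each ball in \<open>\<Theta>\<close> the function \<open>F\<close> is convex and dominates its one-sided derivatives, so
  \<open>slope \<phi> \<theta> + C \<theta>\<close> is a subgradient of \<open>F\<close> for every optimal \<open>\<phi>\<close>. Countably many balls cover \<open>\<Theta>\<close>.
\<close>
lemma hausdorff_null_multiple_slopes:
  assumes h: "integrable L h"
    and convex: "AE x in L. locally_convex_on \<Theta> (\<lambda>\<theta>. \<rho> x \<theta> + h x * (norm \<theta>)\<^sup>2 / 2)"
    and s: "s > real DIM('b) - 1"
  shows "hausdorff_null s {\<theta>\<in>\<Theta>. \<exists>\<phi>\<in>optimal_potentials \<theta>. \<exists>\<phi>'\<in>optimal_potentials \<theta>. slope \<phi> \<theta> \<noteq> slope \<phi>' \<theta>}"
    (is "hausdorff_null s ?N")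
proof -
  define C where "C = M * (\<integral>x. \<bar>h x\<bar> \<partial>L)"
  define F where "F \<xi> = f \<xi> + C / 2 * (norm \<xi>)\<^sup>2" for \<xi>
  define multi where "multi B = {x\<in>B. \<exists>p\<in>subgradients B F x. \<exists>p'\<in>subgradients B F x. p \<noteq> p'}" for B
  define \<B> where "\<B> = {ball \<theta> r |\<theta> r. ball \<theta> r \<subseteq> \<Theta>}"
  have "\<And>B. B \<in> \<B> \<Longrightarrow> open B" by (auto simp: \<B>_def)
  then obtain \<C> where \<C>: "\<C> \<subseteq> \<B>" "countable \<C>" "\<Union>\<C> = \<Union>\<B>" using Lindelof by metis
  have sub: "slope \<phi> \<theta> + C *\<^sub>R \<theta> \<in> subgradients B F \<theta>"
    if "B \<in> \<B>" "\<theta> \<in> B" and \<phi>: "\<phi> \<in> optimal_potentials \<theta>" for B \<theta> \<phi>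
  proof -
    obtain x r where B: "B = ball x r" "ball x r \<subseteq> \<Theta>" using \<open>B \<in> \<B>\<close> by (auto simp: \<B>_def)
    then have \<theta>: "\<theta> \<in> \<Theta>" using \<open>\<theta> \<in> B\<close> by auto
    show ?thesis
    proof (rule convex_on_subgradientI)
      show "convex_on B F" unfolding B(1) F_def C_def by (rule semiconvex_f[OF h convex B(2)])
      fix v
      obtain g where g: "has_directional_derivative f \<theta> v (slope g \<theta> \<bullet> v)"
        "\<And>p. p \<in> dual_admissible S c \<Longrightarrow> dual_value (\<mu> \<theta>) \<nu> p = f \<theta> \<Longrightarrow> slope (fst p) \<theta> \<bullet> v \<le> slope g \<theta> \<bullet> v"
        using danskin[OF \<theta>, of v] by metis
      have "has_directional_derivative F \<theta> v (slope g \<theta> \<bullet> v + C * (\<theta> \<bullet> v))"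
        unfolding F_def[abs_def] by (rule has_directional_derivative_add_square[OF g(1)])
      moreover have "(slope \<phi> \<theta> + C *\<^sub>R \<theta>) \<bullet> v \<le> slope g \<theta> \<bullet> v + C * (\<theta> \<bullet> v)"
        using g(2)[OF optimal_potentials_admissible[OF \<phi>]] by (simp add: inner_add_left)
      ultimately show "\<exists>l. has_directional_derivative F \<theta> v l \<and> (slope \<phi> \<theta> + C *\<^sub>R \<theta>) \<bullet> v \<le> l"
        by blast
    qed fact
  qed
  have "hausdorff_null s (\<Union>B\<in>\<C>. multi B)"
    unfolding multi_def using \<C>(2) s by (intro hausdorff_null_UN hausdorff_null_multiple_subgradients)
  moreover have "?N \<subseteq> (\<Union>B\<in>\<C>. multi B)"
  proof safe
    fix \<theta> \<phi> \<phi>' assume \<theta>: "\<theta> \<in> \<Theta>" and \<phi>: "\<phi> \<in> optimal_potentials \<theta>" "\<phi>' \<in> optimal_potentials \<theta>"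
      and ne: "slope \<phi> \<theta> \<noteq> slope \<phi>' \<theta>"
    obtain r where r: "r > 0" "ball \<theta> r \<subseteq> \<Theta>" by (rule openE[OF open_\<Theta> \<theta>])
    then have "\<theta> \<in> \<Union>\<B>" by (auto simp: \<B>_def intro!: exI[of _ "ball \<theta> r"])
    then obtain B where B: "B \<in> \<C>" "\<theta> \<in> B" using \<C>(3) by blast
    have "B \<in> \<B>" using B \<C>(1) by blast
    have "slope \<phi> \<theta> + C *\<^sub>R \<theta> \<noteq> slope \<phi>' \<theta> + C *\<^sub>R \<theta>" using ne by simp
    with sub[OF \<open>B \<in> \<B>\<close> B(2) \<phi>(1)] sub[OF \<open>B \<in> \<B>\<close> B(2) \<phi>(2)] have "\<theta> \<in> multi B"
      unfolding multi_def using B(2) by (intro CollectI conjI) (assumption, rule bexI, rule bexI)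
    with B(1) show "\<theta> \<in> (\<Union>B\<in>\<C>. multi B)" by blast
  qed
  ultimately show ?thesis by (rule hausdorff_null_subset)
qed

lemma gradient_formula_off_small_set:
  assumes h: "integrable L h"
    and convex: "AE x in L. locally_convex_on \<Theta> (\<lambda>\<theta>. \<rho> x \<theta> + h x * (norm \<theta>)\<^sup>2 / 2)"
  obtains N where "hausdorff_dimension N \<le> ereal (real DIM('b) - 1)"
    "\<And>\<theta>. \<theta> \<in> \<Theta> - N \<Longrightarrow> gradient_formula_at \<theta>"
proof -
  let ?N = "{\<theta>\<in>\<Theta>. \<exists>\<phi>\<in>optimal_potentials \<theta>. \<exists>\<phi>'\<in>optimal_potentials \<theta>. slope \<phi> \<theta> \<noteq> slope \<phi>' \<theta>}"
  have "DIM('b) \<ge> 1" using DIM_positive[where 'a='b] by linarith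
  then have "hausdorff_dimension ?N \<le> ereal (real DIM('b) - 1)"
    by (intro hausdorff_dimension_le hausdorff_null_multiple_slopes[OF h convex]) auto
  moreover have "gradient_formula_at \<theta>" if "\<theta> \<in> \<Theta> - ?N" for \<theta>
  proof (rule gradient_formula_if_unique_slope)
    show "\<theta> \<in> \<Theta>" using that by (rule DiffD1)
    show "slope \<phi> \<theta> = slope \<phi>' \<theta>"
      if "\<phi> \<in> optimal_potentials \<theta>" "\<phi>' \<in> optimal_potentials \<theta>" for \<phi> \<phi>'
      using \<open>\<theta> \<in> \<Theta> - ?N\<close> that by fast
  qed
  ultimately show thesis by (rule that)
qed

end

theorem theorem4p2:
  fixes \<Omega> :: "(real ^ 'd) set"
    and \<Theta> :: "(real ^ 'm) set"
    and \<rho>star :: "(real ^ 'd) measure"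
    and \<mu> :: "real ^ 'm \<Rightarrow> (real ^ 'd) measure"
    and \<rho> :: "real ^ 'd \<Rightarrow> real ^ 'm \<Rightarrow> real"
    and \<eta> :: "real ^ 'd \<Rightarrow> real"
    and c :: "(real ^ 'd) \<times> (real ^ 'd) \<Rightarrow> real"
    and f :: "real ^ 'm \<Rightarrow> real"
  assumes Omega: "compact \<Omega>"
    and rho_star: "\<rho>star \<in> prob_measures_on \<Omega>"
    and A1_open: "open \<Theta>"
    and A1_prob: "\<And>\<theta>. \<theta> \<in> \<Theta> \<Longrightarrow> \<mu> \<theta> \<in> prob_measures_on \<Omega>"
    and A1_ac: "\<And>\<theta>. \<theta> \<in> \<Theta> \<Longrightarrow> absolutely_continuous (restrict_space lborel \<Omega>) (\<mu> \<theta>)"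
    and A1_density: "\<And>\<theta>. \<theta> \<in> \<Theta> \<Longrightarrow> has_density_on \<Omega> (\<mu> \<theta>) (\<lambda>x. \<rho> x \<theta>)"
    and A2_integrable: "integrable (lebesgue_on \<Omega>) \<eta>"
    and A2: "AE x in lebesgue_on \<Omega>. \<forall>\<theta>\<in>\<Theta>.
               \<rho> x differentiable (at \<theta>) \<and> norm (gradient (\<rho> x) \<theta>) \<le> \<eta> x"
    and A3_continuous: "continuous_on (\<Omega> \<times> \<Omega>) c"
    and A3_nonneg: "\<And>x y. x \<in> \<Omega> \<Longrightarrow> y \<in> \<Omega> \<Longrightarrow> 0 \<le> c (x, y)"
    and f: "\<And>\<theta>. \<theta> \<in> \<Theta> \<Longrightarrow> f \<theta> = transport_cost \<Omega> c (\<mu> \<theta>) \<rho>star"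
  shows "locally_lipschitz_on \<Theta> f \<and>
    (AE \<theta>\<^sub>0 in lebesgue_on \<Theta>.
       gateaux_differentiable f \<theta>\<^sub>0 \<and>
       (\<forall>(\<phi>, \<psi>)\<in>kantorovich_potentials \<Omega> c (\<mu> \<theta>\<^sub>0) \<rho>star.
          gateaux_gradient f \<theta>\<^sub>0 = (\<integral>x. \<phi> x *\<^sub>R gradient (\<rho> x) \<theta>\<^sub>0 \<partial>lebesgue_on \<Omega>))) \<and>
    ((\<exists>h :: real ^ 'd \<Rightarrow> real. integrable (lebesgue_on \<Omega>) h \<and>
        (AE x in lebesgue_on \<Omega>. locally_semiconvex_on \<Theta> (\<rho> x) \<and>
           locally_convex_on \<Theta> (\<lambda>\<theta>. \<rho> x \<theta> + h x * (norm \<theta>)\<^sup>2 / 2))) \<longrightarrow>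
     locally_semiconvex_on \<Theta> f \<and>
     (\<exists>N. hausdorff_dimension N \<le> ereal (real CARD('m) - 1) \<and>
        (\<forall>\<theta>\<^sub>0\<in>\<Theta> - N.
           gateaux_differentiable f \<theta>\<^sub>0 \<and>
           (\<forall>(\<phi>, \<psi>)\<in>kantorovich_potentials \<Omega> c (\<mu> \<theta>\<^sub>0) \<rho>star.
              gateaux_gradient f \<theta>\<^sub>0 = (\<integral>x. \<phi> x *\<^sub>R gradient (\<rho> x) \<theta>\<^sub>0 \<partial>lebesgue_on \<Omega>)))))"
proof -
  have "\<Omega> \<noteq> {}"
    using prob_space.not_empty[OF prob_measures_onD(1)[OF rho_star]] prob_measures_onD(3)[OF rho_star] by simp
  obtain M where M: "\<And>x y. x \<in> \<Omega> \<Longrightarrow> y \<in> \<Omega> \<Longrightarrow> c (x, y) \<le> M"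
    using compact_imp_bounded[OF compact_continuous_image[OF A3_continuous compact_Times[OF Omega Omega]]]
    by (auto simp: bounded_iff abs_le_iff)
  interpret transport_family \<Omega> c M \<rho>star \<Theta> \<mu> \<rho> \<eta> f
    using Omega \<open>\<Omega> \<noteq> {}\<close> A3_continuous A3_nonneg M rho_star A1_open A1_prob A1_density A2_integrable A2 f
    by unfold_locales auto
  have "locally_semiconvex_on \<Theta> f \<and>
     (\<exists>N. hausdorff_dimension N \<le> ereal (real CARD('m) - 1) \<and> (\<forall>\<theta>\<^sub>0\<in>\<Theta> - N. gradient_formula_at \<theta>\<^sub>0))"
    if h: "integrable (lebesgue_on \<Omega>) h"
      and A4: "AE x in lebesgue_on \<Omega>. locally_semiconvex_on \<Theta> (\<rho> x) \<and>
        locally_convex_on \<Theta> (\<lambda>\<theta>. \<rho> x \<theta> + h x * (norm \<theta>)\<^sup>2 / 2)" for h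
  proof -
    have convex: "AE x in lebesgue_on \<Omega>. locally_convex_on \<Theta> (\<lambda>\<theta>. \<rho> x \<theta> + h x * (norm \<theta>)\<^sup>2 / 2)"
      using A4 by eventually_elim simp
    obtain N where "hausdorff_dimension N \<le> ereal (real DIM(real ^ 'm) - 1)"
      "\<And>\<theta>. \<theta> \<in> \<Theta> - N \<Longrightarrow> gradient_formula_at \<theta>"
      using gradient_formula_off_small_set[OF h convex] by blast
    then show ?thesis using locally_semiconvex_f[OF h convex] by auto
  qed
  then show ?thesis
    using locally_lipschitz_f AE_gradient_formula unfolding gradient_formula_at_def by blast
qed

end
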